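(* Let $k$ be a positive integer, let $f$ be a non-constant entire function all of whose zeros have multiplicity $\geq k$, and let $S=\{a,b,c\}$, where $a$, $b$ and $c$ are distinct complex numbers. If $E_f(S)=E_{f^{(k)}}(S)$, then $f$ takes one of the following forms: (1) $f(z)=\mathcal{L}_{\theta}(\beta z)$, where $\beta$ is a root of the equation $z^k-1=0$; (2) $f(z)=\mathcal{L}_{\theta}(\eta z)+\frac{2}{3}(a+b+c)$, where $\eta$ is a root of the equation $z^k+1=0$, and $(2a-b-c)(2b-c-a)(2c-a-b)=0$; (3) $f(z)=\mathcal{L}_{\theta}(\zeta z)+\frac{3\pm i\sqrt{3}}{6}(a+b+c)$ (for one of the two choices of sign), where $\zeta\ (\neq 1)$ is a root of the equation $z^{3k}-1=0$, and $a^2+b^2+c^2-ab-bc-ca=0$.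
   Context: For a non-constant meromorphic function $f$ and a set $S$ of complex numbers, $E_f(S)=\bigcup_{a\in S}\{(z,p)\in\mathbb{C}\times\mathbb{N}: f(z)=a \text{ with multiplicity } p\}$; the condition $E_f(S)=E_g(S)$ is expressed by saying that $f$ and $g$ share $S$ counting multiplicities (CM). Here $\theta=\cos\left(\frac{2\pi}{k}\right)+i\sin\left(\frac{2\pi}{k}\right)$, and $\mathcal{L}_{\theta}(z)$ denotes a function of the form $$\mathcal{L}_{\theta}(z)=c_0e^{z}+c_1e^{\theta z}+c_2e^{\theta^2 z}+\ldots+c_{k-1}e^{\theta^{k-1}z},$$ where $c_i\in\mathbb{C}$ for $i\in\{0,1,\ldots,k-1\}$ are some constants with $c_{k-1}\neq 0$. *)

theory Defs
  imports "HOL-Complex_Analysis.Complex_Analysis"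
begin

text \<open>
  \<open>E_set f S\<close> is $E_f(S)$: the pairs \<open>(z, p)\<close> such that \<open>f\<close> takes at \<open>z\<close> some value \<open>a \<in> S\<close>
  with multiplicity \<open>p\<close>. Since \<open>zorder\<close> is unspecified at points near which its argument
  vanishes identically, the frequently-condition is needed to exclude them; for a non-constant
  entire function it always holds.
\<close>

definition E_set :: "(complex \<Rightarrow> complex) \<Rightarrow> complex set \<Rightarrow> (complex \<times> nat) set" where
  "E_set f S = (\<Union>a\<in>S. {(z, p). f z = a \<and> (\<exists>\<^sub>F w in at z. f w \<noteq> a) \<and>
                               0 < p \<and> zorder (\<lambda>w. f w - a) z = int p})"

definition share_CM :: "(complex \<Rightarrow> complex) \<Rightarrow> (complex \<Rightarrow> complex) \<Rightarrow> complex set \<Rightarrow> bool" where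
  "share_CM f g S \<longleftrightarrow> E_set f S = E_set g S"

definition root_theta :: "nat \<Rightarrow> complex" where
  "root_theta k = cis (2 * pi / real k)"

text \<open>
  The notation $\mathcal{L}_\theta$ stands for any function of the given shape, with unspecified
  coefficients, so it is rendered as a predicate.
\<close>

definition is_L_theta :: "nat \<Rightarrow> (complex \<Rightarrow> complex) \<Rightarrow> bool" where
  "is_L_theta k L \<longleftrightarrow>
     (\<exists>c :: nat \<Rightarrow> complex. c (k - 1) \<noteq> 0 \<and>
        (\<forall>z. L z = (\<Sum>i<k. c i * exp (root_theta k ^ i * z))))"

end

theory Submission
  imports Defs "HOL-Real_Asymp.Real_Asymp"
begin

text \<open>
  Let \<open>P(x) = (x - a)(x - b)(x - c)\<close>, \<open>S = {a, b, c}\<close> and \<open>W = f\<^sup>(\<^sup>k\<^sup>)\<close>.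

  The spherical derivative of \<open>f\<close> is bounded. Otherwise Zalcman's rescaling of \<open>f\<close> has a
  non-constant entire limit \<open>g\<close>. Near a point where \<open>g\<close> takes a value in \<open>S\<close>, the rescaled
  functions have three distinct \<open>S\<close>-points, one for each of the values \<open>a\<close>, \<open>b\<close>, \<open>c\<close> of \<open>W\<close>,
  so \<open>g\<close> takes the values \<open>a\<close>, \<open>b\<close>, \<open>c\<close> with multiplicity at least three. The multiplicity
  condition on the zeros of \<open>f\<close> is used to exclude \<open>g\<^sup>(\<^sup>k\<^sup>) = 0\<close>. Then \<open>g'\<^sup>3 / P(g)\<^sup>2\<close> is entire and
  bounded, and it tends to zero where \<open>g\<close> is large, so \<open>g\<close> is constant.

  Hence \<open>|f'| \<le> K (1 + |f|)\<close>, so \<open>f\<close> has exponential type and all its derivatives are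
  \<open>O(1 + |f|)\<close>. By sharing with multiplicities \<open>P(W) = e\<^sup>\<alpha> P(f)\<close>, and \<open>\<alpha>\<close> is linear. If it were
  not constant, \<open>f\<close> would be bounded where \<open>Re \<alpha>\<close> is large, \<open>|W|\<close> would be at most
  \<open>C (1 + exp (Re \<alpha> / 3) |f|)\<close>, and integration along rays would bound \<open>f\<close> by a polynomial of degree
  \<open>k\<close>, which makes \<open>W\<close> constant.

  So \<open>P(W) = A P(f)\<close> with a constant \<open>A\<close>. With \<open>s = (a + b + c) / 3\<close> the Wronskian of \<open>W - s\<close> and
  \<open>f - s\<close> is bounded, hence constant. If it vanishes, \<open>W - s\<close> is a multiple of \<open>f - s\<close>;
  otherwise both solve \<open>y'' = \<rho> y\<close> with a constant \<open>\<rho>\<close>. In either case \<open>W = l f + m\<close>, and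
  \<open>x \<mapsto> l x + m\<close> permutes \<open>{a, b, c}\<close>. The identity, the transpositions and the 3-cycles give the
  three forms.
\<close>

section \<open>Harnack estimates and rescaling\<close>

text \<open>Three values of multiplicity at least three form the parabolic case 3 (1 - 1/3) = 2.
  Elliptic functions realise it, so ramification alone gives no contradiction; the absence of poles
  has to enter, and here it does so without value distribution theory. If g'^3 / P(g)^2 were
  unbounded, a second rescaling would give a solution of G'^3 = H P(G)^2 with H of size comparable
  to 1 near the origin but with very small spherical derivative; such a G stays near one root of P,
  where the equation admits only constants. The decay for large g is a matter of degrees: P(g)^2
  grows like |g|^6, while g'^3 is O(|g|^3).

  The multiplicity of the zeros enters as follows: if g^(k) were identically 0, then g would be a
  non-constant polynomial of degree below k, and its zero would be a limit of zeros of multiplicity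
  at least k.

  The exponent Re \<alpha> / 3 comes from taking the cube root of the relation between P(W) and
  P(f). Its exponential decay beats the weight (1 + s)^k that k integrations along a ray produce,
  and this closes the bootstrap.\<close>

lemma norm_add_cnj_diff:
  "(norm (w + cnj v))\<^sup>2 - (norm (w - v))\<^sup>2 = 4 * Re w * Re v"
  unfolding cmod_power2 by (simp add: algebra_simps power2_eq_square)

text \<open>By \<open>norm_add_cnj_diff\<close>, the map w -> (w - v) / (w + cnj v) sends the right
  half-plane into the unit disc and v to 0, so this is the Schwarz lemma for h followed by a Cayley
  map. The cross-multiplied form yields a derivative bound as well as a lower bound for the real
  part.\<close>

lemma Schwarz_halfplane:
  assumes hol: "h holomorphic_on ball z0 d"
    and pos: "\<And>z. z \<in> ball z0 d \<Longrightarrow> 0 < Re (h z)"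
    and z: "z \<in> ball z0 d"
  shows "d * norm (h z - h z0) \<le> norm (z - z0) * norm (h z + cnj (h z0))"
proof -
  have d: "d > 0" using z by (metis ball_eq_empty empty_iff not_le)
  have r0: "0 < Re (h z0)" using pos[of z0] d by simp
  define \<phi> where "\<phi> = (\<lambda>u. (h (z0 + of_real d * u) - h z0) / (h (z0 + of_real d * u) + cnj (h z0)))"
  have inb: "z0 + of_real d * u \<in> ball z0 d" if "norm u < 1" for u :: complex
    using that d by (simp add: dist_norm norm_mult)
  have nz: "h (z0 + of_real d * u) + cnj (h z0) \<noteq> 0" if "norm u < 1" for u
  proof
    assume "h (z0 + of_real d * u) + cnj (h z0) = 0"
    hence "Re (h (z0 + of_real d * u)) + Re (h z0) = 0" by (metis plus_complex.simps(1) zero_complex.simps(1) cnj.simps(1))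
    thus False using pos[OF inb[OF that]] r0 by simp
  qed
  have sub: "h \<circ> (\<lambda>u. z0 + of_real d * u) holomorphic_on ball 0 1"
    by (rule holomorphic_on_compose_gen[OF _ hol]) (use inb in \<open>auto intro!: holomorphic_intros simp: dist_norm\<close>)
  have hol\<phi>: "\<phi> holomorphic_on ball 0 1"
    unfolding \<phi>_def using nz sub by (auto intro!: holomorphic_intros simp: o_def)
  have lt: "norm (\<phi> u) < 1" if "norm u < 1" for u
  proof -
    have "(norm (h (z0 + of_real d * u) - h z0))\<^sup>2 < (norm (h (z0 + of_real d * u) + cnj (h z0)))\<^sup>2"
      using norm_add_cnj_diff[of "h (z0 + of_real d * u)" "h z0"] pos[OF inb[OF that]] r0
      by (smt (verit) mult_pos_pos)
    hence "norm (h (z0 + of_real d * u) - h z0) < norm (h (z0 + of_real d * u) + cnj (h z0))"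
      by (rule power2_less_imp_less) simp
    thus ?thesis unfolding \<phi>_def using nz[OF that] by (simp add: norm_divide)
  qed
  define u where "u = (z - z0) / of_real d"
  have u: "norm u < 1" using z d by (simp add: u_def norm_divide dist_norm norm_minus_commute)
  have zu: "z0 + of_real d * u = z" using d by (simp add: u_def)
  have "norm (\<phi> u) \<le> norm u"
    by (rule Schwarz_Lemma(1)[OF hol\<phi> _ lt u]) (simp_all add: \<phi>_def)
  hence "norm (h z - h z0) / norm (h z + cnj (h z0)) \<le> norm (z - z0) / d"
    using d by (simp add: \<phi>_def zu norm_divide) (simp add: u_def norm_divide)
  thus ?thesis using d nz[OF u] zu by (simp add: field_simps)
qed

text \<open>Divide \<open>Schwarz_halfplane\<close> by the distance and let z tend to z0; the factor
  \<open>norm (h z + cnj (h z0))\<close> tends to 2 Re (h z0).\<close>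

lemma deriv_bound_halfplane:
  assumes hol: "h holomorphic_on ball z0 d"
    and pos: "\<And>z. z \<in> ball z0 d \<Longrightarrow> 0 < Re (h z)" and d: "d > 0"
  shows "d * norm (deriv h z0) \<le> 2 * Re (h z0)"
proof -
  have fd: "(h has_field_derivative deriv h z0) (at z0)"
    using hol d by (metis centre_in_ball holomorphic_derivI open_ball)
  have 1: "((\<lambda>z. d * norm ((h z - h z0) / (z - z0))) \<longlongrightarrow> d * norm (deriv h z0)) (at z0)"
    using fd unfolding has_field_derivative_iff by (intro tendsto_intros)
  have "isCont h z0" using fd DERIV_isCont by blast
  hence 2: "((\<lambda>z. norm (h z + cnj (h z0))) \<longlongrightarrow> norm (h z0 + cnj (h z0))) (at z0)"
    unfolding isCont_def by (intro tendsto_intros)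
  have ev: "\<forall>\<^sub>F z in at z0. d * norm ((h z - h z0) / (z - z0)) \<le> norm (h z + cnj (h z0))"
    using eventually_at_ball[OF d, of z0 UNIV] eventually_neq_at_within[of z0 z0 UNIV]
  proof eventually_elim
    case (elim z)
    have "d * norm (h z - h z0) \<le> norm (z - z0) * norm (h z + cnj (h z0))"
      by (rule Schwarz_halfplane[OF hol pos]) (use elim in auto)
    thus ?case using elim by (simp add: norm_divide field_simps)
  qed
  have "d * norm (deriv h z0) \<le> norm (h z0 + cnj (h z0))"
    by (rule tendsto_le[OF _ 2 1 ev]) simp
  also have "h z0 + cnj (h z0) = of_real (2 * Re (h z0))"
    by (simp add: complex_eq_iff)
  also have "norm (of_real (2 * Re (h z0)) :: complex) = 2 * Re (h z0)"
    using pos[of z0] d by (simp del: of_real_mult)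
  finally show ?thesis .
qed

text \<open>Harnack's factor (1 - q) / (1 + q) is weakened to (1 - q) / 2. What is used later is
  that it decays only linearly in the distance to the boundary.\<close>

lemma Harnack_lower:
  assumes hol: "h holomorphic_on ball z0 d"
    and pos: "\<And>z. z \<in> ball z0 d \<Longrightarrow> 0 < Re (h z)"
    and z: "z \<in> ball z0 d"
  shows "Re (h z0) * (1 - norm (z - z0) / d) / 2 \<le> Re (h z)"
proof -
  have d: "d > 0" using z by (metis ball_eq_empty empty_iff not_le)
  define q where "q = norm (z - z0) / d"
  define A where "A = norm (h z + cnj (h z0))"
  define x0 where "x0 = Re (h z0)"
  have q: "0 \<le> q" "q < 1" using z d by (auto simp: q_def dist_norm norm_minus_commute)
  have x0: "x0 > 0" using pos[of z0] d by (simp add: x0_def)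
  have le: "norm (h z - h z0) \<le> q * A"
    using Schwarz_halfplane[OF hol pos z] d by (simp add: q_def A_def field_simps)
  have "2 * x0 = norm (of_real (2 * x0) :: complex)" using x0 by (simp del: of_real_mult)
  also have "of_real (2 * x0) = (h z + cnj (h z0)) - (h z - h z0)"
    by (simp add: complex_eq_iff x0_def)
  also have "norm \<dots> \<le> A + q * A" using norm_triangle_ineq4 le unfolding A_def by (smt (verit))
  finally have A: "2 * x0 \<le> (1 + q) * A" by (simp add: algebra_simps)
  have A0: "A > 0" using A x0 q by (smt (verit) mult_nonneg_nonpos)
  have "(norm (h z - h z0))\<^sup>2 \<le> (q * A)\<^sup>2" using le by (simp add: power_mono)
  hence "4 * Re (h z) * x0 \<ge> A\<^sup>2 - (q * A)\<^sup>2"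
    using norm_add_cnj_diff[of "h z" "h z0"] by (simp add: A_def x0_def)
  also have "A\<^sup>2 - (q * A)\<^sup>2 = (1 - q) * A * ((1 + q) * A)" by algebra
  finally have "(1 - q) * A * ((1 + q) * A) \<le> 4 * Re (h z) * x0" .
  moreover have "(1 - q) * A * (2 * x0) \<le> (1 - q) * A * ((1 + q) * A)"
    using A q A0 by (intro mult_left_mono) auto
  ultimately have "((1 - q) * A) * (2*x0) \<le> (2 * Re (h z)) * (2*x0)" by linarith
  hence 1: "(1 - q) * A \<le> 2 * Re (h z)" by (rule mult_right_le_imp_le) (use x0 in simp)
  have "(1 + q) * A \<le> 2 * A" using q A0 by simp
  hence "x0 \<le> A" using A by simp
  hence "(1 - q) * x0 \<le> (1 - q) * A" using q by (intro mult_left_mono) auto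
  thus ?thesis using 1 by (simp add: x0_def q_def mult.commute)
qed

text \<open>Harnack's inequality controls \<open>ln |f|\<close> at the centre by its normal derivative at a point
  where the largest disc in \<open>{|f| > B}\<close> touches the level set \<open>{|f| = B}\<close>.\<close>

lemma holomorphic_growth_from_level_set:
  assumes hol: "f holomorphic_on ball z0 R" and B: "0 < B"
    and w: "w \<in> ball z0 R" "norm (f w) \<le> B" and z0: "B < norm (f z0)"
    and K: "\<And>p. p \<in> ball z0 R \<Longrightarrow> norm (f p) = B \<Longrightarrow> norm (deriv f p) \<le> K"
  shows "\<exists>d. 0 < d \<and> d \<le> dist z0 w \<and> (\<forall>z\<in>ball z0 d. B < norm (f z))
           \<and> ln (norm (f z0) / B) \<le> 2 * K / B * d"
proof -
  have contf: "continuous_on (ball z0 R) f" using hol holomorphic_on_imp_continuous_on by blast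
  define Z where "Z = {z \<in> cball z0 (dist z0 w). norm (f z) \<le> B}"
  have sub: "cball z0 (dist z0 w) \<subseteq> ball z0 R" using w by auto
  have contc: "continuous_on (cball z0 (dist z0 w)) (\<lambda>z. norm (f z))"
    by (intro continuous_intros continuous_on_subset[OF contf sub])
  have "closed (cball z0 (dist z0 w) \<inter> (\<lambda>z. norm (f z)) -` {..B})"
    by (rule continuous_closed_preimage[OF contc]) auto
  moreover have "Z = cball z0 (dist z0 w) \<inter> (\<lambda>z. norm (f z)) -` {..B}" by (auto simp: Z_def)
  ultimately have "closed Z" by simp
  moreover have "w \<in> Z" using w by (simp add: Z_def)
  ultimately obtain p where p: "p \<in> Z" "\<And>y. y \<in> Z \<Longrightarrow> dist z0 p \<le> dist z0 y"
    using distance_attains_inf[of Z z0] by blast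
  define d where "d = dist z0 p"
  have d0: "d > 0" using p(1) z0 by (auto simp: d_def Z_def)
  have dw: "d \<le> dist z0 w" using p(2)[OF \<open>w \<in> Z\<close>] by (simp add: d_def)
  have dR: "d < R" using dw w by simp
  have big: "B < norm (f z)" if "z \<in> ball z0 d" for z
  proof (rule ccontr)
    assume "\<not> B < norm (f z)"
    hence "z \<in> Z" using that dw by (auto simp: Z_def)
    from p(2)[OF this] that show False by (simp add: d_def)
  qed
  have pR: "p \<in> ball z0 R" using dR by (simp add: d_def)
  define \<gamma> where "\<gamma> = (\<lambda>t. z0 + of_real t * (p - z0))"
  have pz: "p - z0 \<noteq> 0" using d0 by (auto simp: d_def)
  have np: "norm (p - z0) = d" by (simp add: d_def dist_norm norm_minus_commute)
  have \<gamma>in: "\<gamma> t \<in> ball z0 d" if "0 \<le> t" "t < 1" for t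
    using that d0 np by (simp add: \<gamma>_def dist_norm norm_mult)
  have hol': "f holomorphic_on ball z0 d" using hol dR by (meson holomorphic_on_subset subset_ball less_imp_le)
  have nz: "f z \<noteq> 0" if "z \<in> ball z0 d" for z using big[OF that] B by auto
  obtain h where h: "h holomorphic_on ball z0 d" "\<And>z. z \<in> ball z0 d \<Longrightarrow> f z = exp (h z)"
    using contractible_imp_holomorphic_log[OF hol' convex_imp_contractible[OF convex_ball] nz] by blast
  \<comment> \<open>The real part of \<open>k\<close> is ln (|f| / B), which is positive on the
    disc, so Harnack applies to it.\<close>
  define k where "k = (\<lambda>z. h z - of_real (ln B))"
  have fk: "norm (f z) = B * exp (Re (k z))" if "z \<in> ball z0 d" for z
    using h(2)[OF that] B by (simp add: k_def exp_diff)
  have holk: "k holomorphic_on ball z0 d" unfolding k_def by (intro holomorphic_intros h)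
  have posk: "0 < Re (k z)" if "z \<in> ball z0 d" for z
    using fk[OF that] big[OF that] B by (smt (verit) exp_le_one_iff mult_left_le)
  define u0 where "u0 = Re (k z0)"
  have u0: "ln (norm (f z0) / B) = u0" using fk[of z0] d0 B by (simp add: u0_def)
  have lowb: "B + B * (u0 * (1 - t) / 2) \<le> norm (f (\<gamma> t))" if t: "0 \<le> t" "t < 1" for t
  proof -
    have "norm (\<gamma> t - z0) / d = t" using t d0 np by (simp add: \<gamma>_def norm_mult)
    hence "u0 * (1 - t) / 2 \<le> Re (k (\<gamma> t))"
      using Harnack_lower[OF holk posk \<gamma>in[OF t]] by (simp add: u0_def)
    hence "1 + u0 * (1 - t) / 2 \<le> exp (Re (k (\<gamma> t)))" by (smt (verit) exp_ge_add_one_self)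
    hence "B * (1 + u0 * (1 - t) / 2) \<le> B * exp (Re (k (\<gamma> t)))" using B by (intro mult_left_mono) auto
    thus ?thesis using fk[OF \<gamma>in[OF t]] by (simp add: algebra_simps)
  qed
  have fp_le: "norm (f p) \<le> B" using p by (simp add: Z_def)
  have fd: "(f has_field_derivative deriv f p) (at p)"
    using hol pR by (metis holomorphic_derivI open_ball)
  have \<gamma>lim: "(\<gamma> \<longlongrightarrow> p) (at_left 1)"
    unfolding \<gamma>_def by (rule tendsto_eq_intros refl | simp)+
  have flim: "((\<lambda>t. norm (f (\<gamma> t))) \<longlongrightarrow> norm (f p)) (at_left 1)"
    by (intro tendsto_norm isCont_tendsto_compose[OF DERIV_isCont[OF fd]] \<gamma>lim)
  have ev01: "\<forall>\<^sub>F t in at_left (1::real). 0 < t \<and> t < 1"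
    using eventually_at_left_real[of 0 "1::real"] by (auto elim!: eventually_mono)
  have "B \<le> norm (f p)"
    by (rule tendsto_lowerbound[OF flim])
       (use ev01 in \<open>eventually_elim, use big \<gamma>in in \<open>force simp: less_imp_le\<close>\<close>, simp)
  hence fpB: "norm (f p) = B" using fp_le by simp
  have \<gamma>at: "filterlim \<gamma> (at p) (at_left 1)"
    unfolding filterlim_at
  proof (intro conjI \<gamma>lim)
    show "\<forall>\<^sub>F t in at_left 1. \<gamma> t \<in> UNIV \<and> \<gamma> t \<noteq> p"
      using ev01
    proof eventually_elim
      case (elim t)
      have "\<gamma> t - p = of_real (t - 1) * (p - z0)" by (simp add: \<gamma>_def algebra_simps)
      moreover have "of_real (t - 1) * (p - z0) \<noteq> 0" using elim pz by (simp del: of_real_diff)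
      ultimately show ?case by auto
    qed
  qed
  have lim2: "((\<lambda>t. norm ((f (\<gamma> t) - f p) / (\<gamma> t - p))) \<longlongrightarrow> norm (deriv f p)) (at_left 1)"
    using filterlim_compose[OF fd[unfolded has_field_derivative_iff] \<gamma>at] by (intro tendsto_norm)
  \<comment> \<open>Along the radius towards p, |f| exceeds B by at least B u0 (1 - t) / 2, while
    the distance to p is (1 - t) d. The difference quotients stay above B u0 / (2 d), and so does
    their limit.\<close>
  have "B * u0 / (2 * d) \<le> norm (deriv f p)"
  proof (rule tendsto_lowerbound[OF lim2])
    show "\<forall>\<^sub>F t in at_left 1. B * u0 / (2 * d) \<le> norm ((f (\<gamma> t) - f p) / (\<gamma> t - p))"
      using ev01
    proof eventually_elim
      case (elim t)
      have "\<gamma> t - p = of_real (t - 1) * (p - z0)" by (simp add: \<gamma>_def algebra_simps)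
      hence n: "norm (\<gamma> t - p) = (1 - t) * d" using elim np by (simp add: norm_mult del: of_real_diff)
      have "B * (u0 * (1 - t) / 2) \<le> norm (f (\<gamma> t)) - norm (f p)" using lowb[of t] elim fpB by simp
      also have "\<dots> \<le> norm (f (\<gamma> t) - f p)" by (rule norm_triangle_ineq2)
      finally have "B * (u0 * (1 - t) / 2) / ((1 - t) * d) \<le> norm (f (\<gamma> t) - f p) / ((1 - t) * d)"
        using elim d0 by (intro divide_right_mono) auto
      moreover have "B * (u0 * (1 - t) / 2) / ((1 - t) * d) = B * u0 / (2 * d)"
        using elim d0 by (simp add: field_simps)
      ultimately show ?case unfolding norm_divide n by simp
    qed
  qed simp
  also have "\<dots> \<le> K" by (rule K[OF pR fpB])
  finally have "u0 \<le> 2 * K / B * d" using B d0 by (simp add: field_simps)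
  thus ?thesis using d0 dw big u0 by blast
qed

text \<open>On the disc f / B has a holomorphic logarithm with positive real part ln (|f| / B). The
  half-plane bound controls its derivative f' / f at the centre.\<close>

lemma log_deriv_bound:
  assumes hol: "f holomorphic_on ball z0 d" and d: "0 < d" and B: "0 < B"
    and big: "\<And>z. z \<in> ball z0 d \<Longrightarrow> B < norm (f z)"
  shows "norm (deriv f z0) \<le> 2 / d * norm (f z0) * ln (norm (f z0) / B)"
proof -
  have nz: "f z \<noteq> 0" if "z \<in> ball z0 d" for z using big[OF that] B by auto
  obtain h where h: "h holomorphic_on ball z0 d" "\<And>z. z \<in> ball z0 d \<Longrightarrow> f z = exp (h z)"
    using contractible_imp_holomorphic_log[OF hol convex_imp_contractible[OF convex_ball] nz] by blast
  define k where "k = (\<lambda>z. h z - of_real (ln B))"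
  have fk: "f z = of_real B * exp (k z)" if "z \<in> ball z0 d" for z
    using h(2)[OF that] B by (simp add: k_def exp_diff exp_of_real)
  have nfk: "norm (f z) = B * exp (Re (k z))" if "z \<in> ball z0 d" for z
    using fk[OF that] B by (simp add: norm_mult)
  have holk: "k holomorphic_on ball z0 d" unfolding k_def by (intro holomorphic_intros h)
  have posk: "0 < Re (k z)" if "z \<in> ball z0 d" for z
    using nfk[OF that] big[OF that] B by (smt (verit) exp_le_one_iff mult_left_le)
  have kd: "(k has_field_derivative deriv k z0) (at z0)"
    using holk d by (metis centre_in_ball holomorphic_derivI open_ball)
  have "((\<lambda>z. of_real B * exp (k z)) has_field_derivative (of_real B * exp (k z0)) * deriv k z0) (at z0)"
    by (rule derivative_eq_intros kd refl | simp)+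
  hence "(f has_field_derivative (of_real B * exp (k z0)) * deriv k z0) (at z0)"
    by (rule has_field_derivative_transform_within[OF _ d]) (use fk in \<open>auto simp: dist_commute\<close>)
  hence "deriv f z0 = f z0 * deriv k z0" using fk[of z0] d DERIV_imp_deriv by force
  hence 1: "norm (deriv f z0) = norm (f z0) * norm (deriv k z0)" by (simp add: norm_mult)
  have 2: "Re (k z0) = ln (norm (f z0) / B)" using nfk[of z0] d B by simp
  have "norm (deriv k z0) \<le> 2 / d * ln (norm (f z0) / B)"
    using deriv_bound_halfplane[OF holk posk d] d 2 by (simp add: field_simps)
  hence "norm (f z0) * norm (deriv k z0) \<le> norm (f z0) * (2 / d * ln (norm (f z0) / B))"
    by (rule mult_left_mono) simp
  thus ?thesis using 1 by (simp add: mult_ac)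
qed

section \<open>Point selection and bounds for rescaled functions\<close>

text \<open>Otherwise every x with M x at least M y has a point within n / M x where M has more than
  doubled. Iteration gives steps that shrink geometrically, so the points converge, and the
  unbounded values of M contradict continuity at the limit.\<close>

lemma doubling_point:
  fixes M :: "complex \<Rightarrow> real"
  assumes cont: "continuous_on UNIV M" and y: "0 < M y" and n: "0 < n"
  shows "\<exists>x. M y \<le> M x \<and> (\<forall>z\<in>cball x (n / M x). M z \<le> 2 * M x)"
proof (rule ccontr)
  assume "\<not> ?thesis"
  hence *: "\<exists>z. M y \<le> M x \<longrightarrow> dist x z \<le> n / M x \<and> 2 * M x < M z" for x
    by (metis mem_cball not_le)
  then obtain s where s: "\<And>x. M y \<le> M x \<Longrightarrow> dist x (s x) \<le> n / M x \<and> 2 * M x < M (s x)"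
    by metis
  define x where "x = (\<lambda>j. (s ^^ j) y)"
  have xS: "x (Suc j) = s (x j)" for j by (simp add: x_def)
  have x0: "x 0 = y" by (simp add: x_def)
  have ge: "2 ^ j * M y \<le> M (x j)" for j
  proof (induction j)
    case (Suc j)
    have "M y \<le> 2 ^ j * M y" using y by simp
    hence "M y \<le> M (x j)" using Suc by linarith
    from s[OF this] Suc show ?case by (simp add: xS)
  qed (simp add: x0)
  have gey: "M y \<le> M (x j)" for j
    using ge[of j] y by (smt (verit) mult_le_cancel_right1 one_le_power)
  have dist: "dist (x j) (x (Suc j)) \<le> n / M y * (1/2)^j" for j
  proof -
    have "dist (x j) (x (Suc j)) \<le> n / M (x j)" using s[OF gey[of j]] by (simp add: xS)
    also have "\<dots> \<le> n / (2^j * M y)" using ge[of j] y n by (intro divide_left_mono mult_pos_pos) (auto intro: less_le_trans[OF _ gey])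
    finally show ?thesis by (simp add: field_simps power_one_over)
  qed
  have "summable (\<lambda>j. norm (x (Suc j) - x j))"
  proof (rule summable_comparison_test'[where N=0])
    show "summable (\<lambda>j. n / M y * (1/2)^j :: real)" by (intro summable_mult summable_geometric) simp
    show "norm (norm (x (Suc j) - x j)) \<le> n / M y * (1/2)^j" for j
      using dist[of j] by (simp add: dist_norm norm_minus_commute)
  qed
  hence "summable (\<lambda>j. x (Suc j) - x j)" by (rule summable_norm_cancel)
  hence "convergent x" using telescope_summable' [of x] summable_iff_convergent
    by (simp add: summable_iff_convergent sum_lessThan_telescope convergent_diff_const_right_iff)
  then obtain l where l: "x \<longlonglongrightarrow> l" by (auto simp: convergent_def)
  have "isCont M l" using cont by (simp add: continuous_on_eq_continuous_at)
  hence lim: "(\<lambda>j. M (x j)) \<longlonglongrightarrow> M l" using l by (rule isCont_tendsto_compose)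
  have "filterlim (\<lambda>j. 2 ^ j * M y :: real) at_top sequentially"
    using y by real_asymp
  hence "filterlim (\<lambda>j. M (x j)) at_top sequentially"
    by (rule filterlim_at_top_mono) (use ge in auto)
  thus False using lim not_tendsto_and_filterlim_at_infinity filterlim_at_top_imp_at_infinity
    by (metis sequentially_bot)
qed

text \<open>Let x = |f z0| > 1. If |f| is at most 1 somewhere in the disc, the level set |f| = 1
  gives ln x \<le> 8 d, and \<open>log_deriv_bound\<close> gives |f'| \<le> (2 / d) x ln x \<le> 16
  x, against |f'| \<ge> 1 + x^2. If |f| > 1 throughout, then |f'| \<le> 2 x ln x \<le> x^2, which is
  impossible.\<close>

lemma norm_le_if_spherical_deriv_large:
  assumes hol: "f holomorphic_on ball z0 1"
    and le: "\<And>z. z \<in> ball z0 1 \<Longrightarrow> norm (deriv f z) \<le> 2 * (1 + (norm (f z))\<^sup>2)"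
    and ge: "1 + (norm (f z0))\<^sup>2 \<le> norm (deriv f z0)"
  shows "norm (f z0) \<le> 16"
proof (cases "norm (f z0) \<le> 1")
  case False
  define x where "x = norm (f z0)"
  have x: "x > 1" using False by (simp add: x_def)
  show ?thesis
  proof (cases "\<exists>w\<in>ball z0 1. norm (f w) \<le> 1")
    case True
    then obtain w where w: "w \<in> ball z0 1" "norm (f w) \<le> 1" by blast
    have "norm (deriv f p) \<le> 4" if "p \<in> ball z0 1" "norm (f p) = 1" for p
      using le[OF that(1)] that(2) by simp
    from holomorphic_growth_from_level_set[OF hol zero_less_one w x[unfolded x_def] this]
    obtain d where d: "0 < d" "d \<le> dist z0 w" "\<forall>z\<in>ball z0 d. 1 < norm (f z)"
      "ln (norm (f z0) / 1) \<le> 2 * 4 / 1 * d" by blast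
    have lnx: "ln x \<le> 8 * d" using d(4) by (simp add: x_def)
    have "ball z0 d \<subseteq> ball z0 1" using d w by auto
    hence "f holomorphic_on ball z0 d" using hol holomorphic_on_subset by blast
    from log_deriv_bound[OF this d(1) zero_less_one] d(3) ge
    have "1 + x\<^sup>2 \<le> 2 / d * x * ln (x / 1)" unfolding x_def by (meson order_trans)
    hence "1 + x\<^sup>2 \<le> 2 / d * x * ln x" by simp
    also have "\<dots> \<le> (2 / d * x) * (8 * d)" using d(1) lnx x by (intro mult_left_mono) auto
    also have "\<dots> = 16 * x" using d by simp
    finally have "x * x \<le> 16 * x" by (simp add: power2_eq_square)
    hence "x \<le> 16" using x by (intro mult_right_le_imp_le[of x x 16]) auto
    thus ?thesis by (simp add: x_def)
  next
    case False
    hence "\<And>z. z \<in> ball z0 1 \<Longrightarrow> 1 < norm (f z)" using not_le by blast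
    from log_deriv_bound[OF hol zero_less_one zero_less_one this] ge
    have "1 + x\<^sup>2 \<le> 2 / 1 * x * ln (x / 1)" unfolding x_def by (meson order_trans)
    hence 1: "1 + x\<^sup>2 \<le> 2 * x * ln x" by simp
    have "ln (x / 2) \<le> x / 2 - 1" using x by (intro ln_le_minus_one) auto
    moreover have "ln (2::real) \<le> 1" using ln_2_less_1 by simp
    ultimately have "ln x \<le> x / 2" using x by (simp add: ln_div)
    hence "2 * x * ln x \<le> 2 * x * (x / 2)" using x by (intro mult_left_mono) auto
    thus ?thesis using 1 by (simp add: power2_eq_square)
  qed
qed simp

text \<open>On the level set |g| = B a bound for the spherical derivative is an ordinary bound for
  g', which is all that \<open>holomorphic_growth_from_level_set\<close> asks for. The disc of
  radius 2 R leaves room for discs of radius R about the points z.\<close>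

lemma norm_le_from_spherical_deriv:
  assumes hol: "g holomorphic_on ball 0 (2 * R)"
    and le: "\<And>z. z \<in> ball 0 (2 * R) \<Longrightarrow> norm (deriv g z) \<le> 2 * (1 + (norm (g z))\<^sup>2)"
    and B: "1 \<le> B" "norm (g 0) \<le> B" and z: "z \<in> ball 0 R"
  shows "norm (g z) \<le> B * exp (4 * (1 + B\<^sup>2) / B * R)"
proof (cases "norm (g z) \<le> B")
  case True
  have "R > 0" using z by (auto simp: less_le_trans[OF le_less_trans[OF norm_ge_zero]])
  have "B * 1 \<le> B * exp (4 * (1 + B\<^sup>2) / B * R)"
    using B \<open>R > 0\<close> by (intro mult_left_mono) auto
  thus ?thesis using True by simp
next
  case False
  have sub: "ball z R \<subseteq> ball 0 (2 * R)"
  proof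
    fix w assume "w \<in> ball z R"
    thus "w \<in> ball 0 (2 * R)" using z norm_triangle_sub[of w z] by (auto simp: dist_norm norm_minus_commute)
  qed
  have K: "norm (deriv g p) \<le> 2 * (1 + B\<^sup>2)" if "p \<in> ball z R" "norm (g p) = B" for p
    using le[of p] that sub by auto
  have B0: "0 < B" and zB: "B < norm (g z)" and z0: "0 \<in> ball z R" using B z False by auto
  have "\<exists>d. 0 < d \<and> d \<le> dist z 0 \<and> (\<forall>w\<in>ball z d. B < norm (g w))
           \<and> ln (norm (g z) / B) \<le> 2 * (2 * (1 + B\<^sup>2)) / B * d"
    by (rule holomorphic_growth_from_level_set[OF holomorphic_on_subset[OF hol sub] B0 z0 B(2) zB K])
  then obtain d where d: "d \<le> dist z 0" "ln (norm (g z) / B) \<le> 2 * (2 * (1 + B\<^sup>2)) / B * d" by blast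
  have "2 * (2 * (1 + B\<^sup>2)) / B * d \<le> 2 * (2 * (1 + B\<^sup>2)) / B * R"
    using d z B by (intro mult_left_mono) auto
  hence "ln (norm (g z) / B) \<le> 4 * (1 + B\<^sup>2) / B * R" using d by simp
  hence "norm (g z) / B \<le> exp (4 * (1 + B\<^sup>2) / B * R)"
    using B False by (metis exp_le_cancel_iff exp_ln divide_pos_pos less_le_trans not_le zero_less_one order_less_trans)
  thus ?thesis using B by (simp add: field_simps)
qed

lemma entire_rescale:
  assumes hol: "f holomorphic_on UNIV"
  shows "(\<lambda>z. f (x + r * z)) holomorphic_on S"
    and "deriv (\<lambda>z. f (x + r * z)) z = r * deriv f (x + r * z)"
proof -
  have "f \<circ> (\<lambda>z. x + r * z) holomorphic_on S"
    by (rule holomorphic_on_compose_gen[OF _ hol]) (auto intro!: holomorphic_intros)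
  thus "(\<lambda>z. f (x + r * z)) holomorphic_on S" by (simp add: o_def)
  show "deriv (\<lambda>z. f (x + r * z)) z = r * deriv f (x + r * z)"
    using higher_deriv_compose_linear'[OF hol open_UNIV open_UNIV UNIV_I, where n = 1 and c = x]
    by (simp add: add.commute)
qed

text \<open>Zalcman's rescaling lemma. Every translate of an entire function is available, so no
  boundary has to be avoided, and the limit cannot be \<open>\<infinity>\<close> because the growth lemma bounds the
  rescaled functions on compact sets.\<close>

lemma Zalcman_entire:
  assumes hol: "f holomorphic_on UNIV"
    and unb: "\<And>C. \<exists>z. C * (1 + (norm (f z))\<^sup>2) < norm (deriv f z)"
  obtains x :: "nat \<Rightarrow> complex" and \<rho> :: "nat \<Rightarrow> real" and g
  where "\<And>n. 0 < \<rho> n" "\<rho> \<longlonglongrightarrow> 0" "g holomorphic_on UNIV" "\<not> g constant_on UNIV"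
    "\<And>z. norm (deriv g z) \<le> 2 * (1 + (norm (g z))\<^sup>2)"
    "\<And>K. compact K \<Longrightarrow> uniform_limit K (\<lambda>n z. f (x n + of_real (\<rho> n) * z)) g sequentially"
proof -
  define M where "M = (\<lambda>z. norm (deriv f z) / (1 + (norm (f z))\<^sup>2))"
  have pos: "0 < 1 + (norm (f z))\<^sup>2" for z by (simp add: add_pos_nonneg)
  have holD: "deriv f holomorphic_on UNIV" using hol by (simp add: holomorphic_deriv)
  have cM: "continuous_on UNIV M" unfolding M_def
    using pos by (intro continuous_intros holomorphic_on_imp_continuous_on hol holD) (auto simp: less_imp_neq[THEN not_sym])
  \<comment> \<open>Rescaling by 1 / M x turns a disc of radius (n + 1) / M x into one of radius n +
    1, so the discs on which the rescaled functions are controlled exhaust the plane.\<close>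
  have "\<exists>x. real (Suc n) \<le> M x \<and> (\<forall>z\<in>cball x (real (Suc n) / M x). M z \<le> 2 * M x)" for n
  proof -
    obtain y where "real (Suc n) * (1 + (norm (f y))\<^sup>2) < norm (deriv f y)" using unb by blast
    hence y: "real (Suc n) < M y" unfolding M_def using pos[of y] by (simp add: pos_less_divide_eq)
    hence "0 < M y" by linarith
    from doubling_point[OF cM this, of "real (Suc n)"] y show ?thesis by force
  qed
  then obtain x where x: "\<And>n. real (Suc n) \<le> M (x n)"
    "\<And>n z. z \<in> cball (x n) (real (Suc n) / M (x n)) \<Longrightarrow> M z \<le> 2 * M (x n)" by metis
  define \<rho> where "\<rho> = (\<lambda>n. 1 / M (x n))"
  have Mpos: "0 < M (x n)" for n using x(1)[of n] by linarith
  have \<rho>: "0 < \<rho> n" for n using Mpos by (simp add: \<rho>_def)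
  have \<rho>le: "\<rho> n \<le> 1 / real (Suc n)" for n unfolding \<rho>_def using x(1)[of n] by (intro divide_left_mono mult_pos_pos Mpos) auto
  have \<rho>0: "\<rho> \<longlonglongrightarrow> 0"
    by (rule real_tendsto_sandwich[OF _ _ tendsto_const LIMSEQ_inverse_real_of_nat])
       (use \<rho> \<rho>le in \<open>auto simp: less_imp_le inverse_eq_divide\<close>)
  define G where "G = (\<lambda>n z. f (x n + of_real (\<rho> n) * z))"
  have holG: "G n holomorphic_on UNIV"
    and dG: "deriv (G n) z = of_real (\<rho> n) * deriv f (x n + of_real (\<rho> n) * z)" for n z
    unfolding G_def by (rule entire_rescale[OF hol])+
  have ndG: "norm (deriv (G n) z) = M (x n + of_real (\<rho> n) * z) / M (x n) * (1 + (norm (G n z))\<^sup>2)" for n z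
  proof -
    have "norm (deriv f w) = M w * (1 + (norm (f w))\<^sup>2)" for w using pos[of w] by (simp add: M_def)
    thus ?thesis using \<rho>[of n] unfolding dG by (simp add: norm_mult G_def) (simp add: \<rho>_def)
  qed
  have dle: "norm (deriv (G n) z) \<le> 2 * (1 + (norm (G n z))\<^sup>2)" if "z \<in> ball 0 (real (Suc n))" for n z
  proof -
    have "\<rho> n * norm z \<le> \<rho> n * real (Suc n)" using that \<rho>[of n] by (intro mult_left_mono) auto
    hence "x n + of_real (\<rho> n) * z \<in> cball (x n) (real (Suc n) / M (x n))"
      using \<rho>[of n] by (simp add: dist_norm norm_mult norm_divide \<rho>_def)
    hence "M (x n + of_real (\<rho> n) * z) / M (x n) \<le> 2" using x(2) Mpos[of n] by (simp add: pos_divide_le_eq)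
    thus ?thesis unfolding ndG by (intro mult_right_mono) (auto intro: add_nonneg_nonneg)
  qed
  have d0: "norm (deriv (G n) 0) = 1 + (norm (G n 0))\<^sup>2" for n
    using Mpos[of n] by (simp add: ndG)
  have G0: "norm (G n 0) \<le> 16" for n
  proof (rule norm_le_if_spherical_deriv_large[of "G n" 0])
    show "G n holomorphic_on ball 0 1" using holG holomorphic_on_subset by blast
    show "norm (deriv (G n) z) \<le> 2 * (1 + (norm (G n z))\<^sup>2)" if "z \<in> ball 0 1" for z
      by (rule dle) (use that in auto)
  qed (simp add: d0)
  have bdd: "\<exists>B. \<forall>h\<in>range G. \<forall>z\<in>K. norm (h z) \<le> B" if K: "compact K" for K
  proof -
    obtain N :: nat where N: "K \<subseteq> ball 0 (real N)"
    proof -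
      obtain b where b: "\<And>z. z \<in> K \<Longrightarrow> norm z \<le> b" using compact_imp_bounded[OF K] bounded_iff by metis
      obtain N :: nat where N: "b < real N" using reals_Archimedean2 by blast
      have "K \<subseteq> ball 0 (real N)"
      proof
        fix z assume "z \<in> K"
        from b[OF this] N show "z \<in> ball 0 (real N)" by simp
      qed
      thus ?thesis by (rule that)
    qed
    have "\<exists>b. \<forall>z\<in>K. norm (G n z) \<le> b" for n
      using compact_imp_bounded[OF compact_continuous_image[OF _ K, of "G n"]] holG[of n]
      by (metis bounded_iff holomorphic_on_imp_continuous_on holomorphic_on_subset image_eqI subset_UNIV)
    then obtain b where b: "\<And>n z. z \<in> K \<Longrightarrow> norm (G n z) \<le> b n" by metis
    \<comment> \<open>From index 2 N on, the derivative bound holds on the disc of radius 2 N, and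
      16 bounds the value at 0. The finitely many earlier functions are covered by the sum of their
      own bounds.\<close>
    define B0 where "B0 = (16::real) * exp (4 * (1 + 16\<^sup>2) / 16 * real N)"
    have "norm (G n z) \<le> B0 + (\<Sum>i<2*N. \<bar>b i\<bar>)" if z: "z \<in> K" for n z
    proof (cases "n < 2 * N")
      case True
      have "norm (G n z) \<le> \<bar>b n\<bar>" using b[OF z, of n] by linarith
      also have "\<dots> \<le> (\<Sum>i<2*N. \<bar>b i\<bar>)" using True by (intro member_le_sum) auto
      finally show ?thesis by (simp add: B0_def add_increasing)
    next
      case False
      have sub: "ball 0 (2 * real N) \<subseteq> (ball 0 (real (Suc n)) :: complex set)" using False by auto
      have "norm (G n z) \<le> B0" unfolding B0_def
        by (rule norm_le_from_spherical_deriv[of "G n", OF _ _ _ G0])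
           (use dle sub z N in \<open>auto intro: holomorphic_on_subset[OF holG]\<close>)
      thus ?thesis by (simp add: add_increasing2 sum_nonneg)
    qed
    thus ?thesis by blast
  qed
  obtain g r where g: "g holomorphic_on UNIV" "strict_mono (r :: nat \<Rightarrow> nat)"
    "\<And>z. (\<lambda>n. G (r n) z) \<longlonglongrightarrow> g z"
    "\<And>K. compact K \<Longrightarrow> uniform_limit K (G \<circ> r) g sequentially"
  proof (rule Montel[of UNIV "range G" G])
    show "open (UNIV :: complex set)" "range G \<subseteq> range G" by auto
    show "h holomorphic_on UNIV" if "h \<in> range G" for h using that holG by auto
    show "\<exists>B. \<forall>h\<in>range G. \<forall>z\<in>K. norm (h z) \<le> B" if "compact K" for K using bdd[OF that] .
  qed (use that in auto)
  have derl: "(\<lambda>n. deriv (G (r n)) z) \<longlonglongrightarrow> deriv g z" for z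
  proof -
    have "uniform_limit (ball z 1) (G \<circ> r) g sequentially"
      using g(4)[of "cball z 1"] by (rule uniform_limit_on_subset) auto
    hence "(\<lambda>n. (deriv ^^ 1) ((G \<circ> r) n) z) \<longlonglongrightarrow> (deriv ^^ 1) g z"
      by (rule higher_deriv_complex_uniform_limit)
         (auto intro!: always_eventually holomorphic_on_subset[OF holG])
    thus ?thesis by simp
  qed
  have gsph: "norm (deriv g z) \<le> 2 * (1 + (norm (g z))\<^sup>2)" for z
  proof (rule tendsto_le[OF trivial_limit_sequentially])
    show "(\<lambda>n. 2 * (1 + (norm (G (r n) z))\<^sup>2)) \<longlonglongrightarrow> 2 * (1 + (norm (g z))\<^sup>2)"
      by (intro tendsto_intros g)
    show "(\<lambda>n. norm (deriv (G (r n)) z)) \<longlonglongrightarrow> norm (deriv g z)" by (intro tendsto_norm derl)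
    obtain N :: nat where N: "norm z < real N" using reals_Archimedean2 by blast
    show "\<forall>\<^sub>F n in sequentially. norm (deriv (G (r n)) z) \<le> 2 * (1 + (norm (G (r n) z))\<^sup>2)"
    proof (rule eventually_sequentiallyI[of N])
      fix n assume "N \<le> n"
      hence "N \<le> r n" using seq_suble[OF g(2), of n] by linarith
      thus "norm (deriv (G (r n)) z) \<le> 2 * (1 + (norm (G (r n) z))\<^sup>2)" using N by (intro dle) auto
    qed
  qed
  \<comment> \<open>The normalisation |G'(0)| = 1 + |G(0)|^2 passes to the limit and makes g
    non-constant.\<close>
  have "(\<lambda>n. norm (deriv (G (r n)) 0)) \<longlonglongrightarrow> 1 + (norm (g 0))\<^sup>2"
    unfolding d0 by (intro tendsto_intros g)
  moreover have "(\<lambda>n. norm (deriv (G (r n)) 0)) \<longlonglongrightarrow> norm (deriv g 0)" by (intro tendsto_norm derl)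
  ultimately have dg0: "norm (deriv g 0) = 1 + (norm (g 0))\<^sup>2" using LIMSEQ_unique by blast
  have nc: "\<not> g constant_on UNIV"
  proof
    assume "g constant_on UNIV"
    then obtain c where "g = (\<lambda>_. c)" by (auto simp: constant_on_def)
    hence "deriv g 0 = 0" by simp
    thus False using dg0 pos[of 0] by (smt (verit) norm_zero zero_le_power2)
  qed
  show thesis
  proof (rule that[of "\<rho> \<circ> r" g "x \<circ> r"])
    show "(\<rho> \<circ> r) \<longlonglongrightarrow> 0" using \<rho>0 g(2) by (rule LIMSEQ_subseq_LIMSEQ)
    show "uniform_limit K (\<lambda>n z. f ((x \<circ> r) n + of_real ((\<rho> \<circ> r) n) * z)) g sequentially" if "compact K" for K
      using g(4)[OF that] by (simp add: G_def o_def)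
  qed (use \<rho> g nc gsph in auto)
qed

section \<open>Totally ramified values\<close>

lemma isCont_entire: "f holomorphic_on UNIV \<Longrightarrow> isCont f z"
  by (metis holomorphic_on_imp_continuous_on continuous_on_eq_continuous_at open_UNIV UNIV_I)

lemma entire_nonconstant_avoids_finite:
  assumes "g holomorphic_on UNIV" "\<not> g constant_on UNIV" "finite S"
  shows "\<exists>w. g w \<notin> S"
proof (rule ccontr)
  assume "\<not> ?thesis"
  hence "range g \<subseteq> S" by blast
  hence "finite (range g)" by (rule finite_subset) fact
  hence "g constant_on UNIV"
    using continuous_finite_range_constant[of UNIV g] assms(1) holomorphic_on_imp_continuous_on by blast
  thus False using assms(2) by blast
qed

text \<open>The zeros of G are isolated, and \<open>bd\<close> makes F / G bounded near each of
  them, so the singularities are removable. Asking for an inequality instead of a comparison of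
  orders lets local estimates be plugged in directly.\<close>

lemma entire_quotient:
  assumes F: "F holomorphic_on UNIV" and G: "G holomorphic_on UNIV" and w0: "G w0 \<noteq> 0"
    and bd: "\<And>z. G z = 0 \<Longrightarrow> \<exists>C. \<forall>\<^sub>F w in at z. norm (F w) \<le> C * norm (G w)"
  obtains H where "H holomorphic_on UNIV" "\<And>z. F z = H z * G z"
proof -
  define q where "q = (\<lambda>z. F z / G z)"
  define H where "H = (\<lambda>z. if G z \<noteq> 0 then q z else Lim (at z) q)"
  have nzev: "\<forall>\<^sub>F w in at z. G w \<noteq> 0" for z
    using non_zero_neighbour_alt[OF G open_UNIV connected_UNIV UNIV_I UNIV_I w0, of z] by simp
  have loc: "\<exists>r>0. H holomorphic_on ball z r \<and> F z = H z * G z" for z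
  proof (cases "G z = 0")
    case False
    have "isCont G z" using G by (rule isCont_entire)
    then obtain r where r: "r > 0" "\<And>w. dist z w < r \<Longrightarrow> G w \<noteq> 0"
      using continuous_at_avoid[of z G 0] False by blast
    have "q holomorphic_on ball z r" unfolding q_def
      using r by (intro holomorphic_intros holomorphic_on_subset[OF F] holomorphic_on_subset[OF G]) auto
    moreover have "H w = q w" if "w \<in> ball z r" for w using r that by (simp add: H_def)
    ultimately have "H holomorphic_on ball z r" using holomorphic_transform[of q "ball z r" H] by simp
    moreover have "F z = H z * G z" using False by (simp add: H_def q_def)
    ultimately show ?thesis using r by blast
  next
    case True
    obtain r where r: "r > 0" "\<And>w. w \<in> ball z r - {z} \<Longrightarrow> G w \<noteq> 0"
      using nzev[of z] unfolding eventually_at by (auto simp: dist_commute)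
    have hq: "q holomorphic_on ball z r - {z}" unfolding q_def
      using r(2) by (intro holomorphic_intros holomorphic_on_subset[OF F] holomorphic_on_subset[OF G]) auto
    obtain C where "\<forall>\<^sub>F w in at z. norm (F w) \<le> C * norm (G w)" using bd[OF True] by blast
    hence C: "\<forall>\<^sub>F w in at z. norm (q w) \<le> C" using nzev[of z]
      by eventually_elim (simp add: q_def norm_divide pos_divide_le_eq)
    have zi: "z \<in> interior (ball z r)" using r by simp
    obtain k where k: "k holomorphic_on ball z r" "\<And>w. w \<in> ball z r - {z} \<Longrightarrow> k w = q w"
      using holomorphic_on_extend_bounded[OF hq zi] C by blast
    have "isCont k z" using k(1) r by (metis centre_in_ball continuous_on_eq_continuous_at holomorphic_on_imp_continuous_on open_ball)
    hence kl: "(k \<longlongrightarrow> k z) (at z)" by (simp add: isCont_def)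
    have evb: "\<forall>\<^sub>F w in at z. w \<in> ball z r - {z}"
      using eventually_at_ball[OF r(1), of z UNIV] eventually_neq_at_within[of z z UNIV] by eventually_elim auto
    have "(q \<longlongrightarrow> k z) (at z)"
      by (rule Lim_transform_eventually[OF kl]) (use evb k(2) in \<open>auto elim: eventually_mono\<close>)
    hence "Lim (at z) q = k z" by (intro tendsto_Lim) auto
    hence "H w = k w" if "w \<in> ball z r" for w using that r True k(2) by (cases "w = z") (auto simp: H_def)
    hence "H holomorphic_on ball z r" using k(1) holomorphic_transform[of k "ball z r" H] by simp
    \<comment> \<open>At a zero of G the identity F = H G claims that F vanishes too; this follows
      by continuity from the punctured neighbourhood.\<close>
    moreover have "F z = 0"
    proof -
      have cF: "isCont F z" and cG: "isCont G z" using F G by (auto intro: isCont_entire)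
      have "\<forall>\<^sub>F w in at z. F w = q w * G w" using nzev[of z] by eventually_elim (simp add: q_def)
      moreover have "((\<lambda>w. q w * G w) \<longlongrightarrow> k z * G z) (at z)"
        using \<open>(q \<longlongrightarrow> k z) (at z)\<close> cG[unfolded isCont_def] by (rule tendsto_mult)
      ultimately have "(F \<longlongrightarrow> k z * G z) (at z)" by (simp add: tendsto_cong)
      hence "F z = k z * G z" using cF LIM_unique by (auto simp: isCont_def)
      thus ?thesis using True by simp
    qed
    ultimately show ?thesis using r True by auto
  qed
  have "H holomorphic_on UNIV"
    unfolding holomorphic_on_open[OF open_UNIV]
  proof
    fix z obtain r where "r > 0" "H holomorphic_on ball z r" using loc by blast
    thus "\<exists>f'. (H has_field_derivative f') (at z)" by (metis centre_in_ball holomorphic_derivI open_ball)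
  qed
  thus thesis by (rule that) (use loc in blast)
qed

section \<open>Contact of order three in the limit\<close>

text \<open>Points at distance at least 3 R / 4 from z0 are at least R / 4 away from x, so the
  quotient is at most 4 M / R there. The maximum principle carries the bound inside.\<close>

lemma divide_out_zero_bounded:
  assumes h: "h holomorphic_on ball z0 R" and M: "\<And>z. z \<in> ball z0 R \<Longrightarrow> norm (h z) \<le> M"
    and x: "x \<in> ball z0 (R / 2)" "h x = 0"
  obtains k where "k holomorphic_on ball z0 R" "\<And>z. z \<in> ball z0 R \<Longrightarrow> h z = (z - x) * k z"
    "\<And>z. z \<in> ball z0 R \<Longrightarrow> norm (k z) \<le> 4 * M / R"
proof -
  have R: "R > 0" using x(1) by (metis ball_eq_empty empty_iff not_le half_gt_zero_iff)
  have xR: "x \<in> ball z0 R" using x(1) R by auto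
  define k where "k = (\<lambda>z. if z = x then deriv h x else (h z - h x) / (z - x))"
  have hk: "k holomorphic_on ball z0 R" unfolding k_def by (rule pole_lemma_open[OF h open_ball])
  have eq: "h z = (z - x) * k z" for z using x by (simp add: k_def)
  have M0: "M \<ge> 0" using M[OF xR] norm_ge_zero order_trans by blast
  have far: "norm (k z) \<le> 4 * M / R" if z: "z \<in> ball z0 R" "3 * R / 4 \<le> dist z0 z" for z
  proof -
    have d: "R / 4 \<le> norm (z - x)" using z x(1) dist_triangle[of z0 z x] by (simp add: dist_norm norm_minus_commute)
    have "R / 4 * norm (k z) \<le> norm (z - x) * norm (k z)" using d by (rule mult_right_mono) simp
    also have "\<dots> = norm (h z)" by (simp add: eq norm_mult)
    also have "\<dots> \<le> M" by (rule M[OF z(1)])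
    finally show ?thesis using R by (simp add: field_simps)
  qed
  have near: "norm (k z) \<le> 4 * M / R" if z: "dist z0 z < 3 * R / 4" for z
  proof (rule maximum_modulus_frontier[of k "cball z0 (3 * R / 4)"])
    show "k holomorphic_on interior (cball z0 (3 * R / 4))"
      using R by (intro holomorphic_on_subset[OF hk]) auto
    show "continuous_on (closure (cball z0 (3 * R / 4))) k"
      using R by (intro holomorphic_on_imp_continuous_on holomorphic_on_subset[OF hk]) auto
    show "norm (k w) \<le> 4 * M / R" if "w \<in> frontier (cball z0 (3 * R / 4))" for w
      using that R by (intro far) auto
  qed (use z in auto)
  show thesis by (rule that[OF hk]) (use eq far near in \<open>force+\<close>)
qed

text \<open>Each of the three zeros is divided out at the cost of a factor 4 / R.\<close>

lemma norm_le_three_zeros: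
  assumes h: "h holomorphic_on ball z0 R" and M: "\<And>z. z \<in> ball z0 R \<Longrightarrow> norm (h z) \<le> M"
    and x: "x \<in> ball z0 (R / 2)" "y \<in> ball z0 (R / 2)" "t \<in> ball z0 (R / 2)"
    and 0: "h x = 0" "h y = 0" "h t = 0" and ne: "x \<noteq> y" "y \<noteq> t" "x \<noteq> t"
    and z: "z \<in> ball z0 R"
  shows "norm (h z) \<le> norm (z - x) * norm (z - y) * norm (z - t) * (64 * M / R ^ 3)"
proof -
  have R: "R > 0" using x(1) by (metis ball_eq_empty empty_iff not_le half_gt_zero_iff)
  have sub: "ball z0 (R/2) \<subseteq> ball z0 R" using R by auto
  obtain h1 where h1: "h1 holomorphic_on ball z0 R" "\<And>z. z \<in> ball z0 R \<Longrightarrow> h z = (z - x) * h1 z"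
    "\<And>z. z \<in> ball z0 R \<Longrightarrow> norm (h1 z) \<le> 4 * M / R"
    using divide_out_zero_bounded[OF h M x(1) 0(1)] by blast
  have "h1 y = 0" using h1(2)[of y] x(2) sub 0 ne by auto
  from divide_out_zero_bounded[OF h1(1,3) x(2) this]
  obtain h2 where h2: "h2 holomorphic_on ball z0 R" "\<And>z. z \<in> ball z0 R \<Longrightarrow> h1 z = (z - y) * h2 z"
    "\<And>z. z \<in> ball z0 R \<Longrightarrow> norm (h2 z) \<le> 4 * (4 * M / R) / R" by blast
  have "h2 t = 0" using h1(2)[of t] h2(2)[of t] x(3) sub 0 ne by auto
  from divide_out_zero_bounded[OF h2(1,3) x(3) this]
  obtain h3 where "h3 holomorphic_on ball z0 R" and h3: "\<And>z. z \<in> ball z0 R \<Longrightarrow> h2 z = (z - t) * h3 z"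
    "\<And>z. z \<in> ball z0 R \<Longrightarrow> norm (h3 z) \<le> 4 * (4 * (4 * M / R) / R) / R" by blast
  have "norm (h z) = norm (z - x) * norm (z - y) * norm (z - t) * norm (h3 z)"
    using h1(2)[OF z] h2(2)[OF z] h3(1)[OF z] by (simp add: norm_mult)
  also have "\<dots> \<le> norm (z - x) * norm (z - y) * norm (z - t) * (64 * M / R ^ 3)"
    using h3(2)[OF z] R by (intro mult_left_mono) (auto simp: power3_eq_cube)
  finally show ?thesis .
qed

text \<open>\<open>norm_le_three_zeros\<close> bounds \<open>G n - s\<close> by a fixed constant
  times the product of the distances to three zeros that lie within \<epsilon> of z0. Let n tend to
  infinity and then \<epsilon> to 0. Distinct zeros take the place of a count with
  multiplicities.\<close>

lemma limit_cubic_contact: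
  fixes G :: "nat \<Rightarrow> complex \<Rightarrow> complex"
  assumes R: "0 < R" and hol: "\<And>n. G n holomorphic_on UNIV"
    and lim: "uniform_limit (cball z0 R) G g sequentially"
    and tri: "\<And>\<epsilon>. 0 < \<epsilon> \<Longrightarrow> \<forall>\<^sub>F n in sequentially. \<exists>x\<in>ball z0 \<epsilon>. \<exists>y\<in>ball z0 \<epsilon>. \<exists>t\<in>ball z0 \<epsilon>.
                x \<noteq> y \<and> y \<noteq> t \<and> x \<noteq> t \<and> G n x = s \<and> G n y = s \<and> G n t = s"
  shows "\<exists>K. \<forall>z\<in>ball z0 R. norm (g z - s) \<le> K * norm (z - z0) ^ 3"
proof -
  have contG: "continuous_on A (G n)" for n A
    using hol[of n] by (meson continuous_on_subset holomorphic_on_imp_continuous_on subset_UNIV)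
  have "continuous_on (cball z0 R) g"
    by (rule uniform_limit_theorem[OF _ lim]) (use contG in auto)
  then obtain M0 where M0: "\<And>z. z \<in> cball z0 R \<Longrightarrow> norm (g z) \<le> M0"
    using compact_imp_bounded[OF compact_continuous_image[OF _ compact_cball]] by (metis bounded_iff image_eqI)
  define M where "M = M0 + 1 + norm s"
  have ev: "\<forall>\<^sub>F n in sequentially. \<forall>z\<in>cball z0 R. dist (G n z) (g z) < 1"
    using lim by (auto simp: uniform_limit_iff)
  have evM: "\<forall>\<^sub>F n in sequentially. \<forall>z\<in>ball z0 R. norm (G n z - s) \<le> M"
    using ev
  proof eventually_elim
    case (elim n)
    show ?case
    proof
      fix z assume "z \<in> ball z0 R"
      hence "dist (G n z) (g z) < 1" "norm (g z) \<le> M0" using elim M0 by auto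
      thus "norm (G n z - s) \<le> M" unfolding M_def dist_norm
        using norm_triangle_ineq4[of "G n z" s] norm_triangle_sub[of "G n z" "g z"] by linarith
    qed
  qed
  define K where "K = 64 * M / R ^ 3"
  have M: "M \<ge> 0" using order_trans[OF norm_ge_zero M0[of z0]] R unfolding M_def by simp
  have K: "K \<ge> 0" using M R by (simp add: K_def)
  have "norm (g z - s) \<le> K * norm (z - z0) ^ 3" if z: "z \<in> ball z0 R" for z
  proof -
    have step: "norm (g z - s) \<le> (norm (z - z0) + \<epsilon>) ^ 3 * K" if e: "0 < \<epsilon>" "\<epsilon> < R / 2" for \<epsilon>
    proof (rule tendsto_upperbound[OF _ _ trivial_limit_sequentially])
      have "(\<lambda>n. G n z) \<longlonglongrightarrow> g z" using lim z by (intro tendsto_uniform_limitI) auto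
      thus "(\<lambda>n. norm (G n z - s)) \<longlonglongrightarrow> norm (g z - s)" by (intro tendsto_intros)
      show "\<forall>\<^sub>F n in sequentially. norm (G n z - s) \<le> (norm (z - z0) + \<epsilon>) ^ 3 * K"
        using evM tri[OF e(1)]
      proof eventually_elim
        case (elim n)
        then obtain x y t where xyt: "x \<in> ball z0 \<epsilon>" "y \<in> ball z0 \<epsilon>" "t \<in> ball z0 \<epsilon>" "x \<noteq> y" "y \<noteq> t" "x \<noteq> t"
          "G n x = s" "G n y = s" "G n t = s" by blast
        have hn: "(\<lambda>z. G n z - s) holomorphic_on ball z0 R"
          by (intro holomorphic_intros holomorphic_on_subset[OF hol]) auto
        have le: "norm (z - p) \<le> norm (z - z0) + \<epsilon>" if "p \<in> ball z0 \<epsilon>" for p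
          using that norm_triangle_ineq[of "z - z0" "z0 - p"] by (auto simp: dist_norm)
        have "norm (G n z - s) \<le> norm (z - x) * norm (z - y) * norm (z - t) * (64 * M / R ^ 3)"
          by (rule norm_le_three_zeros[OF hn]) (use elim(1) xyt e z in auto)
        also have "\<dots> \<le> ((norm (z - z0) + \<epsilon>) * (norm (z - z0) + \<epsilon>) * (norm (z - z0) + \<epsilon>)) * K"
          unfolding K_def[symmetric] using xyt le K e by (intro mult_mono mult_nonneg_nonneg add_nonneg_nonneg) auto
        finally show ?case by (simp add: power3_eq_cube)
      qed
    qed
    have "((\<lambda>\<epsilon>. (norm (z - z0) + \<epsilon>) ^ 3 * K) \<longlongrightarrow> (norm (z - z0) + 0) ^ 3 * K) (at_right 0)"
      by (intro tendsto_intros)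
    moreover have "\<forall>\<^sub>F \<epsilon> in at_right 0. norm (g z - s) \<le> (norm (z - z0) + \<epsilon>) ^ 3 * K"
      using eventually_at_right_real[of 0 "R/2"] R step by (auto elim!: eventually_mono)
    ultimately have "norm (g z - s) \<le> (norm (z - z0) + 0) ^ 3 * K"
      by (intro tendsto_lowerbound) auto
    thus ?thesis by (simp add: mult.commute)
  qed
  thus ?thesis by blast
qed

section \<open>From the spherical derivative to a linear bound\<close>

text \<open>Where |f| > 1, let d be the radius of the disc that reaches the level set |f| = 1. Then
  ln |f| \<le> 4 C' d and |f'| \<le> (2 / d) |f| ln |f|, so d cancels. A point with |f| \<le> 1
  exists by Liouville applied to 1 / f.\<close>

lemma deriv_le_of_spherical_deriv_le:
  assumes hol: "f holomorphic_on UNIV" and nc: "\<not> f constant_on UNIV"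
    and sp: "\<And>z. norm (deriv f z) \<le> C * (1 + (norm (f z))\<^sup>2)"
  obtains K where "0 < K" "\<And>z. norm (deriv f z) \<le> K * (1 + norm (f z))"
proof -
  obtain w where w: "norm (f w) \<le> 1"
  proof (rule ccontr)
    assume "\<not> thesis"
    hence big: "1 < norm (f z)" for z using that not_le by blast
    hence nz: "f z \<noteq> 0" for z by (metis norm_zero not_one_less_zero)
    have "(\<lambda>z. 1 / f z) constant_on UNIV"
    proof (rule Liouville_theorem)
      show "(\<lambda>z. 1 / f z) holomorphic_on UNIV" using nz by (intro holomorphic_intros hol) auto
      have "norm (1 / f z) \<le> 1" for z using big[of z] by (simp add: norm_divide divide_le_eq)
      thus "bounded (range (\<lambda>z. 1 / f z))" by (auto simp: bounded_iff)
    qed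
    then obtain c where "1 / f z = c" for z by (auto simp: constant_on_def)
    hence "f z = inverse c" for z by (metis inverse_eq_divide inverse_inverse_eq)
    thus False using nc by (auto simp: constant_on_def)
  qed
  define C' where "C' = \<bar>C\<bar> + 1"
  have sp': "norm (deriv f z) \<le> C' * (1 + (norm (f z))\<^sup>2)" for z
    using sp[of z] by (rule order_trans) (intro mult_right_mono; simp add: C'_def)
  have C': "C' > 0" by (simp add: C'_def)
  have "norm (deriv f z) \<le> 8 * C' * (1 + norm (f z))" for z
  proof (cases "norm (f z) \<le> 1")
    case True
    have "(norm (f z))\<^sup>2 \<le> 1" using True by (simp add: power_le_one)
    hence "1 + (norm (f z))\<^sup>2 \<le> 8 * (1 + norm (f z))" by (smt (verit) norm_ge_zero)
    hence "C' * (1 + (norm (f z))\<^sup>2) \<le> C' * (8 * (1 + norm (f z)))"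
      using C' by (intro mult_left_mono) auto
    also have "\<dots> = 8 * C' * (1 + norm (f z))" by simp
    finally show ?thesis using sp'[of z] by simp
  next
    case False
    hence z: "1 < norm (f z)" by simp
    have hb: "f holomorphic_on ball z r" for r using hol holomorphic_on_subset by blast
    have "norm (deriv f p) \<le> 2 * C'" if "norm (f p) = 1" for p using sp'[of p] that by simp
    hence K: "\<And>p. p \<in> ball z (dist z w + 1) \<Longrightarrow> norm (f p) = 1 \<Longrightarrow> norm (deriv f p) \<le> 2 * C'" by blast
    have wb: "w \<in> ball z (dist z w + 1)" by simp
    obtain d where d: "0 < d" "\<forall>w\<in>ball z d. 1 < norm (f w)" "ln (norm (f z) / 1) \<le> 2 * (2 * C') / 1 * d"
      using holomorphic_growth_from_level_set[OF hb zero_less_one wb w z K] by blast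
    have "norm (deriv f z) \<le> 2 / d * norm (f z) * ln (norm (f z) / 1)"
      by (rule log_deriv_bound[OF hb d(1)]) (use d in auto)
    also have "\<dots> \<le> 2 / d * norm (f z) * (2 * (2 * C') / 1 * d)"
      by (rule mult_left_mono[OF d(3)]) (use d(1) in simp)
    also have "\<dots> = 8 * C' * norm (f z)" using d by simp
    also have "\<dots> \<le> 8 * C' * (1 + norm (f z))" using C' by (intro mult_left_mono) auto
    finally show ?thesis .
  qed
  thus thesis using that[of "8 * C'"] C' by simp
qed

section \<open>Small solutions of u'^3 = Q u^2\<close>

lemma Cauchy_bound_sub:
  assumes hol: "f holomorphic_on S" and sub: "cball z r \<subseteq> S" and r: "0 < r"
    and B: "\<And>w. w \<in> S \<Longrightarrow> norm (f w) \<le> B"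
  shows "norm ((deriv ^^ n) f z) \<le> fact n * B / r ^ n"
proof (rule Cauchy_inequality)
  show "f holomorphic_on ball z r" using hol sub ball_subset_cball holomorphic_on_subset by blast
  show "continuous_on (cball z r) f" using hol sub holomorphic_on_imp_continuous_on holomorphic_on_subset by blast
  show "norm (f w) \<le> B" if "norm (z - w) = r" for w
    using B[of w] sub that by (auto simp: dist_norm)
qed (rule r)

text \<open>For \<open>u = v\<^sup>3\<close> the equation \<open>u'\<^sup>3 = Q u\<^sup>2\<close> says \<open>27 v'\<^sup>3 = Q\<close>, so \<open>u\<close> cannot be small on a disc
  where \<open>Q\<close> is not. Avoiding the cube root, \<open>u\<close> is eliminated from the first two derivatives of
  the equation by means of \<open>t = u / u'\<close>.\<close>

lemma cube_ode_algebra: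
  fixes u p p1 p2 Q Q1 Q2 :: complex
  assumes e0: "p^3 = Q * u^2"
    and e1: "3 * p^2 * p1 = Q1 * u^2 + 2 * Q * u * p"
    and e2: "6 * p * p1^2 + 3 * p^2 * p2 = Q2 * u^2 + 4 * Q1 * u * p + 2 * Q * (p^2 + u * p1)"
    and p: "p \<noteq> 0" and Q: "Q \<noteq> 0"
  shows "\<exists>t. p = Q * t^2 \<and> 2 * Q^2 = 9 * Q * p2 - 3 * Q2 * Q * t^2 - 6 * Q1 * Q * t + 2 * Q1^2 * t^2"
proof -
  define t where "t = u / p"
  have u: "u = t * p" using p by (simp add: t_def)
  have "p^2 * p = p^2 * (Q * t^2)" using e0 unfolding u by algebra
  hence a: "p = Q * t^2" using p by simp
  hence t: "t \<noteq> 0" using p by auto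
  have "p^2 * (3 * p1) = p^2 * (Q1 * t^2 + 2 * Q * t)" using e1 unfolding u by algebra
  hence b: "3 * p1 = Q1 * t^2 + 2 * Q * t" using p by simp
  have "p * (6 * p1^2 + 3 * p * p2) = p * (Q2 * t^2 * p + 4 * Q1 * t * p + 2 * Q * (p + t * p1))"
    using e2 unfolding u by algebra
  hence c: "6 * p1^2 + 3 * p * p2 = Q2 * t^2 * p + 4 * Q1 * t * p + 2 * Q * (p + t * p1)" using p by simp
  have "t^2 * (2 * Q^2) = t^2 * (9 * Q * p2 - 3 * Q2 * Q * t^2 - 6 * Q1 * Q * t + 2 * Q1^2 * t^2)"
    using a b c by algebra
  hence "2 * Q^2 = 9 * Q * p2 - 3 * Q2 * Q * t^2 - 6 * Q1 * Q * t + 2 * Q1^2 * t^2" using t by simp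
  thus ?thesis using a by blast
qed

text \<open>At a point with u' \<noteq> 0, \<open>cube_ode_algebra\<close> writes 2 Q^2 as a sum
  whose terms contain u''', t or t^2. Cauchy's estimate gives |u'''| \<le> 6 \<delta>, and p = Q t^2
  gives |t|^2 \<le> \<delta> / q0. The sum is therefore at most E \<delta>, which tends to 0 with
  \<delta>, whereas |2 Q^2| \<ge> 2 q0^2. Passing from radius 2 to radius 1 leaves room for the
  Cauchy estimates.\<close>

lemma cube_ode_small:
  fixes q0 q1 :: real
  assumes q: "0 < q0" "0 < q1"
  shows "\<exists>\<delta>>0. \<forall>u Q. u holomorphic_on ball 0 2 \<longrightarrow> Q holomorphic_on ball 0 2
       \<longrightarrow> (\<forall>z\<in>ball 0 2. (deriv u z)^3 = Q z * (u z)^2)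
       \<longrightarrow> (\<forall>z\<in>ball 0 2. norm (u z) \<le> \<delta>)
       \<longrightarrow> (\<forall>z\<in>ball 0 2. norm (Q z) \<le> q1)
       \<longrightarrow> (\<forall>z\<in>ball 0 1. q0 \<le> norm (Q z))
       \<longrightarrow> (\<forall>z\<in>ball (0::complex) 1. deriv u z = 0)"
proof -
  define E where "E = (\<lambda>\<delta>. 54 * q1 * \<delta> + 6 * q1\<^sup>2 * (\<delta> / q0) + 6 * q1\<^sup>2 * sqrt (\<delta> / q0) + 2 * q1\<^sup>2 * (\<delta> / q0))"
  have "isCont E 0" unfolding E_def using q by (intro continuous_intros) auto
  hence "(E \<longlongrightarrow> E 0) (at_right 0)" by (simp add: continuous_at_imp_continuous_at_within flip: continuous_within)
  hence "(E \<longlongrightarrow> 0) (at_right 0)" by (simp add: E_def)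
  hence "\<forall>\<^sub>F \<delta> in at_right 0. E \<delta> < 2 * q0\<^sup>2" using q by (intro order_tendstoD) auto
  moreover have "\<forall>\<^sub>F \<delta> in at_right (0::real). 0 < \<delta>" by (rule eventually_at_right_less)
  ultimately have "\<forall>\<^sub>F \<delta> in at_right (0::real). 0 < \<delta> \<and> E \<delta> < 2 * q0\<^sup>2" by eventually_elim simp
  then obtain \<delta> where \<delta>: "0 < \<delta>" "E \<delta> < 2 * q0\<^sup>2"
    using eventually_happens'[of "at_right (0::real)"] trivial_limit_at_right_real by blast
  show ?thesis
  proof (rule exI[of _ \<delta>], rule conjI[OF \<delta>(1)], intro allI impI ballI)
    fix u Q z
    assume hu: "u holomorphic_on ball 0 2" and hQ: "Q holomorphic_on ball 0 2"
      and eq': "\<forall>z\<in>ball 0 2. (deriv u z)^3 = Q z * (u z)^2"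
      and ub': "\<forall>z\<in>ball 0 2. norm (u z) \<le> \<delta>"
      and Qb': "\<forall>z\<in>ball 0 2. norm (Q z) \<le> q1"
      and Qlow': "\<forall>z\<in>ball 0 1. q0 \<le> norm (Q z)"
      and z: "z \<in> ball (0::complex) 1"
    note eq = bspec[OF eq'] and ub = bspec[OF ub'] and Qb = bspec[OF Qb'] and Qlow = bspec[OF Qlow']
    let ?u = "\<lambda>j. (deriv ^^ j) u" and ?Q = "\<lambda>j. (deriv ^^ j) Q"
    have du: "(?u j has_field_derivative ?u (Suc j) w) (at w)" if "w \<in> ball 0 2" for j w
      using has_field_derivative_higher_deriv[OF hu open_ball that] .
    have dQ: "(?Q j has_field_derivative ?Q (Suc j) w) (at w)" if "w \<in> ball 0 2" for j w
      using has_field_derivative_higher_deriv[OF hQ open_ball that] .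
    have uniq: "a = b" if "(F has_field_derivative a) (at w)" "(G has_field_derivative b) (at w)"
      "\<And>w. w \<in> ball 0 2 \<Longrightarrow> F w = G w" "w \<in> ball 0 2" for F G :: "complex \<Rightarrow> complex" and a b w
    proof -
      have "(G has_field_derivative a) (at w)"
        using has_field_derivative_transform_within_open[OF that(1) open_ball that(4), of G] that(3) by blast
      thus ?thesis using that(2) DERIV_unique by blast
    qed
    have e0: "(?u 1 w)^3 = ?Q 0 w * (?u 0 w)^2" if "w \<in> ball 0 2" for w using eq[OF that] by simp
    have e1: "3 * (?u 1 w)^2 * ?u 2 w = ?Q 1 w * (?u 0 w)^2 + 2 * ?Q 0 w * ?u 0 w * ?u 1 w"
      if w: "w \<in> ball 0 2" for w
    proof (rule uniq[OF _ _ e0 w])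
      show "((\<lambda>w. (?u 1 w)^3) has_field_derivative 3 * (?u 1 w)^2 * ?u 2 w) (at w)"
        by (rule derivative_eq_intros du[OF w] refl)+ (simp add: numeral_2_eq_2)
      show "((\<lambda>w. ?Q 0 w * (?u 0 w)^2) has_field_derivative ?Q 1 w * (?u 0 w)^2 + 2 * ?Q 0 w * ?u 0 w * ?u 1 w) (at w)"
        by (rule derivative_eq_intros du[OF w] dQ[OF w] refl)+ (simp add: algebra_simps)
    qed
    have e2: "6 * ?u 1 w * (?u 2 w)^2 + 3 * (?u 1 w)^2 * ?u 3 w
        = ?Q 2 w * (?u 0 w)^2 + 4 * ?Q 1 w * ?u 0 w * ?u 1 w + 2 * ?Q 0 w * ((?u 1 w)^2 + ?u 0 w * ?u 2 w)"
      if w: "w \<in> ball 0 2" for w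
    proof (rule uniq[OF _ _ e1 w])
      show "((\<lambda>w. 3 * (?u 1 w)^2 * ?u 2 w) has_field_derivative
          6 * ?u 1 w * (?u 2 w)^2 + 3 * (?u 1 w)^2 * ?u 3 w) (at w)"
        by (rule derivative_eq_intros du[OF w] refl)+ (simp add: numeral_2_eq_2 numeral_3_eq_3 algebra_simps)
      show "((\<lambda>w. ?Q 1 w * (?u 0 w)^2 + 2 * ?Q 0 w * ?u 0 w * ?u 1 w) has_field_derivative
          ?Q 2 w * (?u 0 w)^2 + 4 * ?Q 1 w * ?u 0 w * ?u 1 w + 2 * ?Q 0 w * ((?u 1 w)^2 + ?u 0 w * ?u 2 w)) (at w)"
        by (rule derivative_eq_intros du[OF w] dQ[OF w] refl)+
           (simp add: numeral_2_eq_2 power2_eq_square algebra_simps)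
    qed
    show "deriv u z = 0"
    proof (rule ccontr)
      assume "deriv u z \<noteq> 0"
      hence p: "?u 1 z \<noteq> 0" by simp
      have z2: "z \<in> ball 0 2" using z by auto
      have Q0: "?Q 0 z \<noteq> 0" using Qlow[OF z] q by auto
      obtain t where t: "?u 1 z = ?Q 0 z * t^2"
        "2 * (?Q 0 z)^2 = 9 * ?Q 0 z * ?u 3 z - 3 * ?Q 2 z * ?Q 0 z * t^2 - 6 * ?Q 1 z * ?Q 0 z * t + 2 * (?Q 1 z)^2 * t^2"
        using cube_ode_algebra[OF e0[OF z2] e1[OF z2] e2[OF z2] p Q0] by blast
      have sub: "cball z 1 \<subseteq> ball 0 2"
      proof
        fix w assume "w \<in> cball z 1"
        thus "w \<in> ball 0 2" using z norm_triangle_sub[of w z] by (auto simp: dist_norm norm_minus_commute)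
      qed
      have cu: "norm (?u j z) \<le> fact j * \<delta>" and cQ: "norm (?Q j z) \<le> fact j * q1" for j
        using Cauchy_bound_sub[OF hu sub zero_less_one ub, of j] Cauchy_bound_sub[OF hQ sub zero_less_one Qb, of j] by auto
      have u1: "norm (?u 1 z) \<le> \<delta>" and u3: "norm (?u 3 z) \<le> 6 * \<delta>"
        and Q0b: "norm (?Q 0 z) \<le> q1" and Q1: "norm (?Q 1 z) \<le> q1" and Q2: "norm (?Q 2 z) \<le> 2 * q1"
        using cu[of 1] cu[of 3] cQ[of 0] cQ[of 1] cQ[of 2] by (simp_all add: fact_numeral)
      define \<tau> where "\<tau> = norm t"
      have "q0 * \<tau>\<^sup>2 \<le> norm (?Q 0 z) * \<tau>\<^sup>2" using Qlow[OF z] by (intro mult_right_mono) auto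
      also have "\<dots> = norm (?u 1 z)" by (simp only: t(1) \<tau>_def norm_mult norm_power)
      finally have "q0 * \<tau>\<^sup>2 \<le> \<delta>" using u1 by linarith
      hence \<tau>2: "\<tau>\<^sup>2 \<le> \<delta> / q0" using q by (simp add: field_simps)
      hence \<tau>1: "\<tau> \<le> sqrt (\<delta> / q0)" by (simp add: real_le_rsqrt)
      have \<tau>0: "0 \<le> \<tau>" by (simp add: \<tau>_def)
      have "q0\<^sup>2 \<le> (norm (?Q 0 z))\<^sup>2" using Qlow[OF z] q by (intro power_mono) auto
      hence "2 * q0\<^sup>2 \<le> norm (2 * (?Q 0 z)^2)" by (simp add: norm_mult norm_power)
      also have "\<dots> \<le> norm (9 * ?Q 0 z * ?u 3 z) + norm (3 * ?Q 2 z * ?Q 0 z * t^2)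
          + norm (6 * ?Q 1 z * ?Q 0 z * t) + norm (2 * (?Q 1 z)^2 * t^2)"
        unfolding t(2) by (intro order_trans[OF norm_triangle_ineq] add_mono order_trans[OF norm_triangle_ineq4] order_refl)
      also have "norm (9 * ?Q 0 z * ?u 3 z) \<le> 9 * q1 * (6 * \<delta>)"
        unfolding norm_mult using Q0b u3 q by (intro mult_mono) auto
      also have "norm (3 * ?Q 2 z * ?Q 0 z * t^2) \<le> 3 * (2 * q1) * q1 * (\<delta> / q0)"
        unfolding norm_mult norm_power \<tau>_def[symmetric] using Q0b Q2 \<tau>2 q by (intro mult_mono) auto
      also have "norm (6 * ?Q 1 z * ?Q 0 z * t) \<le> 6 * q1 * q1 * sqrt (\<delta> / q0)"
        unfolding norm_mult norm_power \<tau>_def[symmetric] using Q0b Q1 \<tau>1 \<tau>0 q by (intro mult_mono) auto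
      also have "norm (2 * (?Q 1 z)^2 * t^2) \<le> 2 * q1\<^sup>2 * (\<delta> / q0)"
        unfolding norm_mult norm_power \<tau>_def[symmetric] using Q1 \<tau>2 q by (intro mult_mono power_mono) auto
      finally have "2 * q0\<^sup>2 \<le> E \<delta>" unfolding E_def by (simp add: power2_eq_square algebra_simps)
      thus False using \<delta>(2) by linarith
    qed
  qed
qed

section \<open>The cubic and the quotient g'^3 / P(g)^2\<close>

definition cubic :: "complex \<Rightarrow> complex \<Rightarrow> complex \<Rightarrow> complex \<Rightarrow> complex" where
  "cubic a b c x = (x - a) * (x - b) * (x - c)"

lemma cubic_eq_0_iff: "cubic a b c x = 0 \<longleftrightarrow> x \<in> {a, b, c}"
  by (simp add: cubic_def)

lemma cubic_factor:
  assumes "a \<noteq> b" "b \<noteq> c" "a \<noteq> c" "s \<in> {a, b, c}"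
  obtains s1 s2 where "s1 \<in> {a, b, c}" "s2 \<in> {a, b, c}" "s1 \<noteq> s" "s2 \<noteq> s"
    "\<And>x. cubic a b c x = (x - s) * ((x - s1) * (x - s2))"
proof -
  consider "s = a" | "s = b" | "s = c" using assms by blast
  thus thesis
    by cases (rule that[of b c] that[of a c] that[of a b];
              use assms in \<open>simp add: cubic_def algebra_simps\<close>)+
qed

lemma cubic_lower:
  assumes x: "2 * norm a + 2 * norm b + 2 * norm c + 1 \<le> norm x"
  shows "norm x ^ 3 \<le> 8 * norm (cubic a b c x)"
proof -
  have *: "norm x / 2 \<le> norm (x - s)" if "s \<in> {a, b, c}" for s
  proof -
    have "norm s \<le> norm a + norm b + norm c" using that by auto
    thus ?thesis using norm_triangle_ineq2[of x s] x by linarith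
  qed
  have "norm x / 2 * (norm x / 2) * (norm x / 2) \<le> norm (x - a) * norm (x - b) * norm (x - c)"
    using *[of a] *[of b] *[of c] by (intro mult_mono) auto
  thus ?thesis by (simp add: cubic_def norm_mult power3_eq_cube)
qed

text \<open>Numerator and denominator of |P(w)|^2 / (1 + |w|^2)^3 both have degree six, so the
  quotient stays away from 0 near infinity and can only be small near a root. The constant 1 / 1024
  settles large w, where the losses are 64 and 8; the other bound settles |w| < R, where |P| \<ge>
  \<delta>^3 away from the roots.\<close>

lemma cubic_small_near_root:
  assumes \<delta>: "0 < \<delta>"
  obtains \<epsilon> where "0 < \<epsilon>"
    "\<And>w. (norm (cubic a b c w))\<^sup>2 \<le> \<epsilon> * (1 + (norm w)\<^sup>2) ^ 3 \<Longrightarrow> \<exists>s\<in>{a, b, c}. norm (w - s) < \<delta>"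
proof -
  define R where "R = 2 * norm a + 2 * norm b + 2 * norm c + 1"
  have R: "1 \<le> R" by (simp add: R_def)
  define \<epsilon> where "\<epsilon> = min (1 / 1024) (\<delta> ^ 6 / (2 * (1 + R\<^sup>2) ^ 3))"
  have pR: "0 < (1 + R\<^sup>2) ^ 3" by (intro zero_less_power) (simp add: add_pos_nonneg)
  have \<epsilon>: "0 < \<epsilon>" using \<delta> pR by (simp add: \<epsilon>_def)
  show thesis
  proof (rule that[OF \<epsilon>], rule ccontr)
    fix w assume le: "(norm (cubic a b c w))\<^sup>2 \<le> \<epsilon> * (1 + (norm w)\<^sup>2) ^ 3"
      and far: "\<not> (\<exists>s\<in>{a, b, c}. norm (w - s) < \<delta>)"
    show False
    proof (cases "R \<le> norm w")
      case True
      hence w1: "1 \<le> norm w" using R by linarith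
      have "norm w ^ 3 \<le> 8 * norm (cubic a b c w)" using True by (intro cubic_lower) (simp add: R_def)
      hence "(norm w ^ 3)\<^sup>2 \<le> (8 * norm (cubic a b c w))\<^sup>2" by (rule power_mono) simp
      hence 1: "norm w ^ 6 \<le> 64 * (norm (cubic a b c w))\<^sup>2"
        by (simp add: power_mult_distrib flip: power_mult)
      have "1 \<le> (norm w)\<^sup>2" using w1 by simp
      hence "(1 + (norm w)\<^sup>2) ^ 3 \<le> (2 * (norm w)\<^sup>2) ^ 3" by (intro power_mono) auto
      also have "\<dots> = 8 * norm w ^ 6" by (simp add: power_mult_distrib flip: power_mult)
      finally have 2: "(1 + (norm w)\<^sup>2) ^ 3 \<le> 8 * norm w ^ 6" .
      have "\<epsilon> * (1 + (norm w)\<^sup>2) ^ 3 \<le> (1 / 1024) * (8 * norm w ^ 6)"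
        using 2 \<epsilon> by (intro mult_mono) (auto simp: \<epsilon>_def)
      hence "norm w ^ 6 \<le> norm w ^ 6 / 2" using 1 le by linarith
      moreover have "0 < norm w ^ 6" using w1 by (intro zero_less_power) linarith
      ultimately show False by linarith
    next
      case False
      have "(1 + (norm w)\<^sup>2) ^ 3 \<le> (1 + R\<^sup>2) ^ 3"
        using False by (intro power_mono add_mono) auto
      hence "\<epsilon> * (1 + (norm w)\<^sup>2) ^ 3 \<le> \<delta> ^ 6 / (2 * (1 + R\<^sup>2) ^ 3) * (1 + R\<^sup>2) ^ 3"
        using \<epsilon> \<delta> pR by (intro mult_mono) (auto simp: \<epsilon>_def)
      also have "\<dots> = \<delta> ^ 6 / 2" using pR by (simp add: field_simps)
      finally have 1: "(norm (cubic a b c w))\<^sup>2 \<le> \<delta> ^ 6 / 2" using le by linarith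
      have "\<delta> * \<delta> * \<delta> \<le> norm (w - a) * norm (w - b) * norm (w - c)"
        using far \<delta> by (intro mult_mono) (auto simp: not_less)
      hence "(\<delta> ^ 3)\<^sup>2 \<le> (norm (cubic a b c w))\<^sup>2"
        using \<delta> by (intro power_mono) (auto simp: cubic_def norm_mult power3_eq_cube)
      hence "\<delta> ^ 6 \<le> (norm (cubic a b c w))\<^sup>2" by (simp flip: power_mult)
      moreover have "0 < \<delta> ^ 6" using \<delta> by simp
      ultimately show False using 1 by linarith
    qed
  qed
qed

text \<open>If g - g z has a zero of order n at z, then g'^3 vanishes to order 3 (n - 1) and (g - g
  z)^2 to order 2 n. The inequality 3 (n - 1) \<ge> 2 n is exactly n \<ge> 3, which the cubic
  contact provides.\<close>

lemma ramified_deriv_bound: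
  assumes hol: "g holomorphic_on UNIV" and nc: "\<not> g constant_on UNIV"
    and ram: "0 < r" "\<And>w. w \<in> ball z r \<Longrightarrow> norm (g w - g z) \<le> K * norm (w - z) ^ 3"
  shows "\<exists>C>0. \<forall>\<^sub>F w in at z. norm (deriv g w) ^ 3 \<le> C * norm (g w - g z) ^ 2"
proof -
  obtain h r' n where n: "0 < n" and r': "0 < r'" and hh: "h holomorphic_on ball z r'"
    and eq: "\<And>w. w \<in> ball z r' \<Longrightarrow> g w - g z = (w - z) ^ n * h w"
    and hnz: "\<And>w. w \<in> ball z r' \<Longrightarrow> h w \<noteq> 0"
  proof -
    have 1: "(\<lambda>w. g w - g z) holomorphic_on UNIV" by (intro holomorphic_intros hol)
    have 2: "\<not> (\<lambda>w. g w - g z) constant_on UNIV"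
    proof
      assume "(\<lambda>w. g w - g z) constant_on UNIV"
      then obtain y where "g w - g z = y" for w by (auto simp: constant_on_def)
      hence "g w = y + g z" for w by (metis diff_add_cancel)
      thus False using nc unfolding constant_on_def by blast
    qed
    have 3: "(\<lambda>w. g w - g z) z = 0" by simp
    show thesis
      by (rule holomorphic_factor_zero_nonconstant[OF 1 open_UNIV connected_UNIV UNIV_I 3 2]) (rule that; assumption)
  qed
  have zb: "z \<in> ball z r'" using r' by simp
  have isch: "isCont h z"
    using hh r' by (metis centre_in_ball continuous_on_eq_continuous_at holomorphic_on_imp_continuous_on open_ball)
  have "deriv h holomorphic_on ball z r'" using hh by (intro holomorphic_deriv) auto
  hence isch': "isCont (deriv h) z"
    using r' by (metis centre_in_ball continuous_on_eq_continuous_at holomorphic_on_imp_continuous_on open_ball)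
  define \<eta> where "\<eta> = norm (h z) / 2"
  have \<eta>: "0 < \<eta>" using hnz[OF zb] by (simp add: \<eta>_def)
  have "((\<lambda>w. norm (h w)) \<longlongrightarrow> norm (h z)) (at z)" using isch by (intro tendsto_norm) (simp add: isCont_def)
  hence ev1: "\<forall>\<^sub>F w in at z. \<eta> < norm (h w)" by (rule order_tendstoD) (use \<eta> in \<open>simp add: \<eta>_def\<close>)
  define k where "k = (\<lambda>w. of_nat n * h w + (w - z) * deriv h w)"
  define Kb where "Kb = norm (k z) + 1"
  have "isCont k z" unfolding k_def using isch isch' by (intro continuous_intros)
  hence "((\<lambda>w. norm (k w)) \<longlongrightarrow> norm (k z)) (at z)" by (intro tendsto_norm) (simp add: isCont_def)
  hence ev2: "\<forall>\<^sub>F w in at z. norm (k w) < Kb" by (rule order_tendstoD) (simp add: Kb_def)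
  have ev3: "\<forall>\<^sub>F w in at z. w \<in> ball z (min r' (min r 1)) \<and> w \<noteq> z"
    using eventually_at_ball'[of "min r' (min r 1)" z UNIV] r' ram by (auto elim: eventually_mono)
  have n3: "3 \<le> n"
  proof (rule ccontr)
    assume "\<not> 3 \<le> n"
    hence n2: "n + 1 \<le> 3" by simp
    have "((\<lambda>w. \<bar>K\<bar> * norm (w - z)) \<longlongrightarrow> \<bar>K\<bar> * norm (z - z)) (at z)" by (intro tendsto_intros)
    hence ev4: "\<forall>\<^sub>F w in at z. \<bar>K\<bar> * norm (w - z) < \<eta>" using \<eta> by (intro order_tendstoD) auto
    have "\<forall>\<^sub>F w in at z. False"
      using ev1 ev3 ev4
    proof eventually_elim
      case (elim w)
      define \<tau> where "\<tau> = norm (w - z)"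
      have \<tau>: "0 < \<tau>" "\<tau> \<le> 1" using elim by (auto simp: \<tau>_def dist_norm norm_minus_commute)
      have "\<tau> ^ n * norm (h w) = norm (g w - g z)" using eq[of w] elim by (simp add: \<tau>_def norm_mult norm_power)
      also have "\<dots> \<le> K * \<tau> ^ 3" using ram(2)[of w] elim by (simp add: \<tau>_def)
      also have "\<dots> \<le> \<bar>K\<bar> * \<tau> ^ 3" using \<tau> by (intro mult_right_mono) auto
      also have "\<dots> \<le> \<bar>K\<bar> * \<tau> ^ (n + 1)" using \<tau> n2 by (intro mult_left_mono power_decreasing) auto
      finally have "\<tau> ^ n * norm (h w) \<le> \<tau> ^ n * (\<bar>K\<bar> * \<tau>)" by (simp add: mult_ac)
      hence "norm (h w) \<le> \<bar>K\<bar> * \<tau>" using \<tau> by simp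
      thus False using elim by (simp add: \<tau>_def)
    qed
    thus False by simp
  qed
  have dg: "deriv g w = (w - z) ^ (n - 1) * k w" if w: "w \<in> ball z r'" for w
  proof -
    obtain m where m: "n = Suc m" using n by (cases n) auto
    have hd: "(h has_field_derivative deriv h w) (at w)" using hh w by (metis holomorphic_derivI open_ball)
    have pd: "((\<lambda>w. (w - z) ^ Suc m) has_field_derivative of_nat (Suc m) * (w - z) ^ m) (at w)"
      by (auto intro!: derivative_eq_intros simp del: power_Suc)
    have "((\<lambda>w. g z + (w - z) ^ n * h w) has_field_derivative (w - z) ^ (n - 1) * k w) (at w)"
      unfolding k_def m by (rule derivative_eq_intros pd hd refl)+ (simp add: algebra_simps)
    moreover have "g z + (w - z) ^ n * h w = g w" if "w \<in> ball z r'" for w using eq[OF that] by (simp add: algebra_simps)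
    ultimately have "(g has_field_derivative (w - z) ^ (n - 1) * k w) (at w)"
      using has_field_derivative_transform_within_open[OF _ open_ball w, of _ _ g] by blast
    thus ?thesis by (rule DERIV_imp_deriv)
  qed
  have "\<forall>\<^sub>F w in at z. norm (deriv g w) ^ 3 \<le> Kb ^ 3 / \<eta>\<^sup>2 * norm (g w - g z) ^ 2"
    using ev1 ev2 ev3
  proof eventually_elim
    case (elim w)
    define \<tau> where "\<tau> = norm (w - z)"
    have \<tau>: "0 < \<tau>" "\<tau> \<le> 1" using elim by (auto simp: \<tau>_def dist_norm norm_minus_commute)
    have wr: "w \<in> ball z r'" using elim by auto
    have "norm (deriv g w) ^ 3 = \<tau> ^ (3 * (n - 1)) * norm (k w) ^ 3"
      by (simp add: dg[OF wr] norm_mult norm_power \<tau>_def power_mult_distrib mult.commute flip: power_mult)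
    also have "\<dots> \<le> \<tau> ^ (2 * n) * Kb ^ 3"
    proof (rule mult_mono)
      show "\<tau> ^ (3 * (n - 1)) \<le> \<tau> ^ (2 * n)"
        by (rule power_decreasing) (use \<tau> n3 in linarith)+
    qed (use elim \<tau> in \<open>auto intro: power_mono\<close>)
    also have "\<dots> = Kb ^ 3 / \<eta>\<^sup>2 * (\<tau> ^ (2 * n) * \<eta>\<^sup>2)" using \<eta> by simp
    also have "\<dots> \<le> Kb ^ 3 / \<eta>\<^sup>2 * (\<tau> ^ (2 * n) * (norm (h w))\<^sup>2)"
      using elim \<eta> \<tau> by (intro mult_left_mono power_mono) (auto simp: Kb_def)
    also have "\<tau> ^ (2 * n) * (norm (h w))\<^sup>2 = norm (g w - g z) ^ 2"
      by (simp add: eq[OF wr] norm_mult norm_power \<tau>_def power_mult_distrib mult.commute flip: power_mult)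
    finally show ?case .
  qed
  moreover have "0 < Kb ^ 3 / \<eta>\<^sup>2" using \<eta> by (simp add: Kb_def add_nonneg_pos)
  ultimately show ?thesis by blast
qed

text \<open>Near a point where g takes one of the three values, the other two factors of the cubic
  are bounded away from 0, so \<open>ramified_deriv_bound\<close> is the boundedness that
  \<open>entire_quotient\<close> requires.\<close>

lemma totally_ramified_quotient:
  assumes hol: "g holomorphic_on UNIV" and nc: "\<not> g constant_on UNIV"
    and dist: "a \<noteq> b" "b \<noteq> c" "a \<noteq> c"
    and ram: "\<And>z. g z \<in> {a, b, c} \<Longrightarrow> \<exists>K r. 0 < r \<and> (\<forall>w\<in>ball z r. norm (g w - g z) \<le> K * norm (w - z) ^ 3)"
  obtains H where "H holomorphic_on UNIV" "\<And>z. (deriv g z) ^ 3 = H z * (cubic a b c (g z)) ^ 2"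
proof -
  have cub: "(\<lambda>z. cubic a b c (g z)) holomorphic_on UNIV" unfolding cubic_def by (intro holomorphic_intros hol)
  have "\<exists>w0. g w0 \<notin> {a, b, c}" by (rule entire_nonconstant_avoids_finite[OF hol nc]) simp
  then obtain w0 where w0: "g w0 \<notin> {a, b, c}" by blast
  show thesis
  proof (rule entire_quotient[of "\<lambda>z. (deriv g z) ^ 3" "\<lambda>z. (cubic a b c (g z)) ^ 2" w0])
    show "(\<lambda>z. (deriv g z) ^ 3) holomorphic_on UNIV" by (intro holomorphic_intros holomorphic_deriv hol) auto
    show "(\<lambda>z. (cubic a b c (g z)) ^ 2) holomorphic_on UNIV" by (intro holomorphic_intros cub)
    show "(cubic a b c (g w0)) ^ 2 \<noteq> 0" using w0 by (simp add: cubic_eq_0_iff)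
    fix z assume "(cubic a b c (g z)) ^ 2 = 0"
    hence gz: "g z \<in> {a, b, c}" using cubic_eq_0_iff[of a b c "g z"] by simp
    obtain K r where "0 < r" "\<And>w. w \<in> ball z r \<Longrightarrow> norm (g w - g z) \<le> K * norm (w - z) ^ 3"
      using ram[OF gz] by blast
    from ramified_deriv_bound[OF hol nc this] obtain C where C: "C > 0"
      "\<forall>\<^sub>F w in at z. norm (deriv g w) ^ 3 \<le> C * norm (g w - g z) ^ 2" by blast
    obtain s1 s2 where s: "s1 \<noteq> g z" "s2 \<noteq> g z" "\<And>x. cubic a b c x = (x - g z) * ((x - s1) * (x - s2))"
      by (rule cubic_factor[OF dist gz]) blast
    define \<eta> where "\<eta> = norm ((g z - s1) * (g z - s2)) / 2"
    have \<eta>: "0 < \<eta>" using s by (simp add: \<eta>_def)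
    have "(\<lambda>w. norm ((g w - s1) * (g w - s2))) \<midarrow>z\<rightarrow> norm ((g z - s1) * (g z - s2))"
      using isCont_entire[OF hol, of z] unfolding isCont_def by (intro tendsto_intros)
    hence "\<forall>\<^sub>F w in at z. \<eta> < norm ((g w - s1) * (g w - s2))"
      by (rule order_tendstoD) (use \<eta> in \<open>simp add: \<eta>_def\<close>)
    with C(2) have "\<forall>\<^sub>F w in at z. norm ((deriv g w) ^ 3) \<le> C / \<eta>\<^sup>2 * norm ((cubic a b c (g w)) ^ 2)"
    proof eventually_elim
      case (elim w)
      have "\<eta>\<^sup>2 \<le> (norm ((g w - s1) * (g w - s2)))\<^sup>2" using elim \<eta> by (intro power_mono) auto
      hence "C / \<eta>\<^sup>2 * (norm (g w - g z) ^ 2 * \<eta>\<^sup>2) \<le> C / \<eta>\<^sup>2 * (norm (g w - g z) ^ 2 * (norm ((g w - s1) * (g w - s2)))\<^sup>2)"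
        using C(1) by (intro mult_left_mono) auto
      also have "\<dots> = C / \<eta>\<^sup>2 * norm ((cubic a b c (g w)) ^ 2)"
        by (simp add: s(3) norm_mult norm_power power_mult_distrib)
      finally show ?case using elim \<eta> by (simp add: norm_power)
    qed
    thus "\<exists>C. \<forall>\<^sub>F w in at z. norm ((deriv g w) ^ 3) \<le> C * norm ((cubic a b c (g w)) ^ 2)" by blast
  qed (rule that; assumption)
qed

lemma constant_on_if_deriv_0_on_ball:
  assumes hol: "g holomorphic_on UNIV" and r: "0 < r" and z: "\<And>z. z \<in> ball x r \<Longrightarrow> deriv g z = 0"
  shows "g constant_on UNIV"
proof -
  have hd: "deriv g holomorphic_on UNIV" by (intro holomorphic_deriv hol) auto
  have "deriv g z = 0" for z
    by (rule analytic_continuation_open[of "ball x r" UNIV "deriv g" "\<lambda>_. 0"]) (use r z hd in auto)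
  hence "(g has_field_derivative 0) (at z within UNIV)" for z
    using holomorphic_derivI[OF hol open_UNIV UNIV_I, of z] by simp
  hence "\<exists>c. \<forall>x\<in>UNIV. g x = c"
    by (intro has_field_derivative_zero_constant) auto
  thus ?thesis unfolding constant_on_def .
qed

text \<open>Rescaling g by a small \<rho> at a doubling point of |H|^(1/3) gives G'^3 = HH P(G)^2
  with |HH| between 1/2 and 8 on the unit disc, while the spherical derivative of G is O(\<rho>).
  The equation at 0 then makes P(G 0) small, so G stays near one root s. Now u = G - s is a small
  solution of u'^3 = Q u^2 with Q bounded from both sides, hence constant.\<close>

lemma totally_ramified_quotient_bounded:
  assumes hol: "g holomorphic_on UNIV" and nc: "\<not> g constant_on UNIV"
    and dist: "a \<noteq> b" "b \<noteq> c" "a \<noteq> c"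
    and sp: "\<And>z. norm (deriv g z) \<le> 2 * (1 + (norm (g z))\<^sup>2)"
    and H: "H holomorphic_on UNIV" "\<And>z. (deriv g z) ^ 3 = H z * (cubic a b c (g z)) ^ 2"
  shows "bounded (range H)"
proof (rule ccontr)
  assume unb: "\<not> bounded (range H)"
  define m where "m = min (norm (a - b)) (min (norm (b - c)) (norm (a - c)))"
  define D where "D = norm (a - b) + norm (b - c) + norm (a - c)"
  have m: "0 < m" using dist by (simp add: m_def)
  have "m \<le> norm (a - b)" by (simp add: m_def)
  hence D: "m \<le> D" unfolding D_def using norm_ge_zero[of "b - c"] norm_ge_zero[of "a - c"] by linarith
  have sep: "m \<le> norm (s - s')" "norm (s - s') \<le> D" if "s \<in> {a, b, c}" "s' \<in> {a, b, c}" "s \<noteq> s'" for s s'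
    using that by (auto simp: m_def D_def norm_minus_commute)
  \<comment> \<open>Bounds for Q = HH (G - s1)^2 (G - s2)^2: |HH| lies between 1/2 and 8, and G
    keeps a distance between m / 2 and 2 D from the two roots other than s.\<close>
  define q0 where "q0 = (1/2) * (m / 2) ^ 4"
  define q1 where "q1 = 8 * (2 * D) ^ 4"
  have q0: "0 < q0" and q1: "0 < q1" using m D by (auto simp: q0_def q1_def)
  obtain \<delta>0 where \<delta>0: "0 < \<delta>0"
    "\<forall>u Q. u holomorphic_on ball 0 2 \<longrightarrow> Q holomorphic_on ball 0 2
       \<longrightarrow> (\<forall>z\<in>ball 0 2. (deriv u z)^3 = Q z * (u z)^2)
       \<longrightarrow> (\<forall>z\<in>ball 0 2. norm (u z) \<le> \<delta>0)
       \<longrightarrow> (\<forall>z\<in>ball 0 2. norm (Q z) \<le> q1)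
       \<longrightarrow> (\<forall>z\<in>ball 0 1. q0 \<le> norm (Q z))
       \<longrightarrow> (\<forall>z\<in>ball (0::complex) 1. deriv u z = 0)"
    using cube_ode_small[OF q0 q1] by (elim exE conjE) (rule that)
  note cube = \<delta>0(2)[rule_format]
  define \<delta> where "\<delta> = min \<delta>0 (m / 2)"
  have \<delta>: "0 < \<delta>" "\<delta> \<le> \<delta>0" "\<delta> \<le> m / 2" using \<delta>0(1) m by (auto simp: \<delta>_def)
  obtain \<epsilon> where \<epsilon>: "0 < \<epsilon>"
    "\<And>w. (norm (cubic a b c w))\<^sup>2 \<le> \<epsilon> * (1 + (norm w)\<^sup>2) ^ 3 \<Longrightarrow> \<exists>s\<in>{a, b, c}. norm (w - s) < \<delta> / 2"
    using cubic_small_near_root[of "\<delta> / 2" a b c] \<delta> by (metis half_gt_zero)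
  define B1 where "B1 = 1 + norm a + norm b + norm c + \<delta>"
  define B2 where "B2 = B1 * exp (4 * (1 + B1\<^sup>2) / B1 * 2)"
  \<comment> \<open>The bound \<epsilon> / 8 forces \<open>G 0\<close> to lie near a root; the last
    bound lets G move by at most \<delta> / 2 on the disc of radius 2, where \<open>B2\<close>
    bounds it.\<close>
  define \<rho>0 where "\<rho>0 = min 1 (min (\<epsilon> / 8) (\<delta> / (8 * (1 + B2\<^sup>2))))"
  have pB2: "0 < 1 + B2\<^sup>2" by (simp add: add_pos_nonneg)
  have \<rho>0: "0 < \<rho>0" using \<epsilon> \<delta> pB2 by (simp add: \<rho>0_def)
  \<comment> \<open>H is multiplied by \<rho>^3 under z -> x + \<rho> z, so its cube root scales
    like an inverse length, as \<open>doubling_point\<close> presupposes.\<close>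
  define M where "M = (\<lambda>z. root 3 (norm (H z)))"
  have M3: "M z ^ 3 = norm (H z)" and M0: "0 \<le> M z" for z by (simp_all add: M_def odd_real_root_pow)
  have cM: "continuous_on UNIV M" unfolding M_def
    by (intro continuous_intros holomorphic_on_imp_continuous_on H)
  obtain y where y: "(1 / \<rho>0) ^ 3 < norm (H y)" using unb unfolding bounded_iff by (metis not_le rangeE)
  have My: "1 / \<rho>0 < M y"
    using y M0[of y] \<rho>0 by (metis M3 power_less_imp_less_base)
  have "0 < M y" using My \<rho>0 by (meson order_less_trans zero_less_divide_1_iff)
  \<comment> \<open>The radius 18 contains all discs of radius 16 about points of the unit disc.
    With |HH| \<le> 8, Cauchy's estimate gives |HH'| \<le> 1/2 on the unit disc, and |HH 0| = 1
    leaves |HH| \<ge> 1/2.\<close>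
  from doubling_point[OF cM this, of 18] obtain x where x: "M y \<le> M x"
    "\<And>z. z \<in> cball x (18 / M x) \<Longrightarrow> M z \<le> 2 * M x" by auto
  have Mx: "0 < M x" using \<open>0 < M y\<close> x by linarith
  define \<rho> where "\<rho> = 1 / M x"
  have \<rho>: "0 < \<rho>" using Mx by (simp add: \<rho>_def)
  have "1 / \<rho>0 < M x" using My x by linarith
  hence \<rho>le: "\<rho> \<le> \<rho>0" using \<rho>0 Mx by (simp add: \<rho>_def field_simps)
  have \<rho>1: "\<rho> \<le> 1" "\<rho> \<le> \<epsilon> / 8" "\<rho> \<le> \<delta> / (8 * (1 + B2\<^sup>2))" using \<rho>le by (auto simp: \<rho>0_def)
  define G where "G = (\<lambda>z. g (x + of_real \<rho> * z))"
  define HH where "HH = (\<lambda>z. of_real (\<rho> ^ 3) * H (x + of_real \<rho> * z))"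
  have holG: "G holomorphic_on S" and dG: "deriv G z = of_real \<rho> * deriv g (x + of_real \<rho> * z)" for S z
    unfolding G_def by (rule entire_rescale[OF hol])+
  have holHH: "HH holomorphic_on S" for S
    unfolding HH_def by (intro holomorphic_on_mult holomorphic_on_const entire_rescale(1)[OF H(1)])
  have fdG: "(G has_field_derivative deriv G z) (at z within S)" for z S
    by (rule has_field_derivative_at_within[OF holomorphic_derivI[OF holG open_UNIV UNIV_I]])
  have fdHH: "(HH has_field_derivative deriv HH z) (at z within S)" for z S
    by (rule has_field_derivative_at_within[OF holomorphic_derivI[OF holHH open_UNIV UNIV_I]])
  have eqG: "(deriv G z) ^ 3 = HH z * (cubic a b c (G z)) ^ 2" for z
    unfolding dG using H(2)[of "x + of_real \<rho> * z"] by (simp add: HH_def G_def power_mult_distrib)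
  have spG: "norm (deriv G z) \<le> \<rho> * (2 * (1 + (norm (G z))\<^sup>2))" for z
    unfolding dG norm_mult using sp[of "x + of_real \<rho> * z"] \<rho> by (intro mult_mono) (auto simp: G_def)
  have HH8: "norm (HH z) \<le> 8" if z: "z \<in> ball 0 18" for z
  proof -
    have "x + of_real \<rho> * z \<in> cball x (18 / M x)"
      using z \<rho> Mx by (simp add: dist_norm norm_mult norm_divide \<rho>_def divide_right_mono)
    hence "M (x + of_real \<rho> * z) ^ 3 \<le> (2 * M x) ^ 3" using x(2) M0 by (intro power_mono) auto
    hence "norm (H (x + of_real \<rho> * z)) \<le> 8 * M x ^ 3" by (simp add: M3 power_mult_distrib)
    hence "\<rho> ^ 3 * norm (H (x + of_real \<rho> * z)) \<le> \<rho> ^ 3 * (8 * M x ^ 3)" using \<rho> by (intro mult_left_mono) auto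
    thus ?thesis using Mx \<rho> by (simp add: HH_def norm_mult norm_divide norm_power \<rho>_def power_divide)
  qed
  have "norm (HH 0) = \<rho> ^ 3 * M x ^ 3" using \<rho> by (simp add: HH_def norm_mult norm_power M3)
  hence HH0: "norm (HH 0) = 1" using Mx by (simp add: \<rho>_def power_divide)
  have HHlow: "1 / 2 \<le> norm (HH z)" if z: "z \<in> ball 0 1" for z
  proof -
    have dHH: "norm (deriv HH w) \<le> 1 / 2" if w: "w \<in> ball 0 1" for w
    proof -
      have "cball w 16 \<subseteq> ball 0 18"
      proof
        fix v assume "v \<in> cball w 16"
        thus "v \<in> ball 0 18" using w norm_triangle_sub[of v w] by (auto simp: dist_norm norm_minus_commute)
      qed
      from Cauchy_bound_sub[OF holHH this _ HH8, of 1] show ?thesis by simp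
    qed
    have "norm (HH z - HH 0) \<le> 1 / 2 * norm (z - 0)"
    proof (rule field_differentiable_bound[of "ball 0 1" HH "deriv HH"])
      show "(HH has_field_derivative deriv HH w) (at w within ball 0 1)" if "w \<in> ball 0 1" for w
        by (rule fdHH)
    qed (use z dHH in auto)
    also have "\<dots> \<le> 1 / 2" using z by simp
    finally show ?thesis using HH0 norm_triangle_ineq2[of "HH 0" "HH z"] by (simp add: norm_minus_commute)
  qed
  have "(norm (cubic a b c (G 0)))\<^sup>2 = norm (deriv G 0) ^ 3"
    using arg_cong[OF eqG[of 0], of norm] by (simp add: norm_mult norm_power HH0)
  also have "\<dots> \<le> (\<rho> * (2 * (1 + (norm (G 0))\<^sup>2))) ^ 3" by (intro power_mono spG) auto
  also have "\<dots> = (8 * \<rho> ^ 3) * (1 + (norm (G 0))\<^sup>2) ^ 3" by algebra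
  also have "\<dots> \<le> \<epsilon> * (1 + (norm (G 0))\<^sup>2) ^ 3"
  proof (rule mult_right_mono)
    have "\<rho> ^ 3 \<le> \<rho> ^ 1" using \<rho> \<rho>1 by (intro power_decreasing) auto
    thus "8 * \<rho> ^ 3 \<le> \<epsilon>" using \<rho>1 by simp
  qed simp
  finally obtain s where s: "s \<in> {a, b, c}" "norm (G 0 - s) < \<delta> / 2" using \<epsilon>(2) by blast
  have ns: "norm s \<le> norm a + norm b + norm c" using s(1) by auto
  have G0: "norm (G 0) \<le> B1" using norm_triangle_sub[of "G 0" s] s(2) ns \<delta> by (simp add: B1_def)
  have B1: "1 \<le> B1" using \<delta> by (simp add: B1_def)
  have GB2: "norm (G z) \<le> B2" if z: "z \<in> ball 0 2" for z
    unfolding B2_def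
  proof (rule norm_le_from_spherical_deriv[OF holG _ B1 G0 z])
    fix w
    have "\<rho> * (2 * (1 + (norm (G w))\<^sup>2)) \<le> 1 * (2 * (1 + (norm (G w))\<^sup>2))" using \<rho>1 by (intro mult_right_mono) auto
    thus "norm (deriv G w) \<le> 2 * (1 + (norm (G w))\<^sup>2)" using spG[of w] by simp
  qed
  have Gs: "norm (G z - s) \<le> \<delta>" if z: "z \<in> ball 0 2" for z
  proof -
    have "norm (G z - G 0) \<le> \<delta> / 4 * norm (z - 0)"
    proof (rule field_differentiable_bound[of "ball 0 2" G "deriv G"])
      show "(G has_field_derivative deriv G w) (at w within ball 0 2)" if "w \<in> ball 0 2" for w
        by (rule fdG)
      fix w :: complex assume w: "w \<in> ball 0 2"
      have "norm (deriv G w) \<le> \<rho> * (2 * (1 + (norm (G w))\<^sup>2))" by (rule spG)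
      also have "\<dots> \<le> \<rho> * (2 * (1 + B2\<^sup>2))" using GB2[OF w] \<rho> by (intro mult_left_mono add_mono power_mono) auto
      also have "\<dots> \<le> \<delta> / (8 * (1 + B2\<^sup>2)) * (2 * (1 + B2\<^sup>2))" using \<rho>1 pB2 by (intro mult_right_mono) auto
      also have "\<dots> = \<delta> / 4" using pB2 by (simp add: field_simps)
      finally show "norm (deriv G w) \<le> \<delta> / 4" .
    qed (use z in auto)
    also have "\<dots> \<le> \<delta> / 4 * 2" using z \<delta> by (intro mult_left_mono) auto
    finally show ?thesis using s(2) norm_triangle_ineq[of "G z - G 0" "G 0 - s"] by simp
  qed
  obtain s1 s2 where s12: "s1 \<in> {a, b, c}" "s2 \<in> {a, b, c}" "s1 \<noteq> s" "s2 \<noteq> s"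
    "\<And>x. cubic a b c x = (x - s) * ((x - s1) * (x - s2))"
    by (rule cubic_factor[OF dist s(1)]) blast
  have other: "m / 2 \<le> norm (G z - s')" "norm (G z - s') \<le> 2 * D"
    if "z \<in> ball 0 2" "s' \<in> {a, b, c}" "s' \<noteq> s" for z s'
  proof -
    have 1: "m \<le> norm (s - s')" "norm (s - s') \<le> D" using sep[OF s(1) that(2)] that(3) by auto
    have 2: "norm (G z - s) \<le> m / 2" using Gs[OF that(1)] \<delta> by linarith
    show "m / 2 \<le> norm (G z - s')" using norm_triangle_ineq2[of "s - s'" "s - G z"] 1 2 by (simp add: norm_minus_commute)
    show "norm (G z - s') \<le> 2 * D" using norm_triangle_ineq[of "G z - s" "s - s'"] 1 2 D m by simp
  qed
  have dG0: "deriv (\<lambda>z. G z - s) z = 0" if z: "z \<in> ball 0 1" for z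
  proof (rule cube[of "\<lambda>z. G z - s" "\<lambda>z. HH z * ((G z - s1) * (G z - s2)) ^ 2"])
    show "(\<lambda>z. G z - s) holomorphic_on ball 0 2" by (intro holomorphic_intros holG)
    show "(\<lambda>z. HH z * ((G z - s1) * (G z - s2)) ^ 2) holomorphic_on ball 0 2"
      by (intro holomorphic_intros holG holHH)
    show "(deriv (\<lambda>z. G z - s) w) ^ 3 = HH w * ((G w - s1) * (G w - s2)) ^ 2 * (G w - s) ^ 2" for w
    proof -
      have "((\<lambda>z. G z - s) has_field_derivative deriv G w - 0) (at w)" by (rule DERIV_diff[OF fdG DERIV_const])
      hence "((\<lambda>z. G z - s) has_field_derivative deriv G w) (at w)" by simp
      hence "deriv (\<lambda>z. G z - s) w = deriv G w" by (rule DERIV_imp_deriv)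
      thus ?thesis using eqG[of w] by (simp add: s12(5) power_mult_distrib mult_ac)
    qed
    show "norm (G w - s) \<le> \<delta>0" if "w \<in> ball 0 2" for w using Gs[OF that] \<delta> by linarith
    show "norm (HH w * ((G w - s1) * (G w - s2)) ^ 2) \<le> q1" if w: "w \<in> ball 0 2" for w
    proof -
      have "norm (HH w) * (norm (G w - s1) * norm (G w - s2)) ^ 2 \<le> 8 * ((2 * D) * (2 * D)) ^ 2"
        using other[OF w s12(1,3)] other[OF w s12(2,4)] HH8[of w] w D m
        by (intro mult_mono power_mono) auto
      also have "\<dots> = q1" unfolding q1_def by (simp add: power_mult_distrib flip: power_add)
      finally show ?thesis by (simp add: norm_mult norm_power)
    qed
    show "q0 \<le> norm (HH w * ((G w - s1) * (G w - s2)) ^ 2)" if w: "w \<in> ball 0 1" for w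
    proof -
      have w2: "w \<in> ball 0 2" using w by auto
      have "q0 = 1 / 2 * ((m / 2) * (m / 2)) ^ 2" unfolding q0_def by (simp add: power2_eq_square power4_eq_xxxx)
      also have "\<dots> \<le> norm (HH w) * (norm (G w - s1) * norm (G w - s2)) ^ 2"
        using other[OF w2 s12(1,3)] other[OF w2 s12(2,4)] HHlow[OF w] m
        by (intro mult_mono power_mono) auto
      finally show ?thesis by (simp add: norm_mult norm_power)
    qed
  qed (use z in auto)
  have "deriv g z = 0" if z: "z \<in> ball x \<rho>" for z
  proof -
    define w where "w = (z - x) / of_real \<rho>"
    have w: "w \<in> ball 0 1" using z \<rho> by (simp add: w_def norm_divide dist_norm norm_minus_commute)
    have zw: "x + of_real \<rho> * w = z" using \<rho> by (simp add: w_def)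
    have "((\<lambda>z. G z - s) has_field_derivative deriv G w - 0) (at w)" by (rule DERIV_diff[OF fdG DERIV_const])
    hence "((\<lambda>z. G z - s) has_field_derivative deriv G w) (at w)" by simp
    hence "deriv G w = 0" using dG0[OF w] DERIV_imp_deriv by metis
    thus ?thesis using \<rho> by (simp add: dG zw)
  qed
  with constant_on_if_deriv_0_on_ball[OF hol \<rho>] nc show False by blast
qed

text \<open>The quotient \<open>H = g'\<^sup>3 / ((g - a)(g - b)(g - c))\<^sup>2\<close> comes from the flat metric with cone angle
  \<open>2\<pi>/3\<close> at \<open>a\<close>, \<open>b\<close>, \<open>c\<close>, which is smooth at infinity.\<close>

lemma totally_ramified_constant:
  assumes hol: "g holomorphic_on UNIV"
    and dist: "a \<noteq> b" "b \<noteq> c" "a \<noteq> c"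
    and sp: "\<And>z. norm (deriv g z) \<le> 2 * (1 + (norm (g z))\<^sup>2)"
    and ram: "\<And>z. g z \<in> {a, b, c} \<Longrightarrow> \<exists>K r. 0 < r \<and> (\<forall>w\<in>ball z r. norm (g w - g z) \<le> K * norm (w - z) ^ 3)"
  shows "g constant_on UNIV"
proof (rule ccontr)
  assume nc: "\<not> g constant_on UNIV"
  obtain H where H: "H holomorphic_on UNIV" "\<And>z. (deriv g z) ^ 3 = H z * (cubic a b c (g z)) ^ 2"
    using totally_ramified_quotient[OF hol nc dist ram] by blast
  have "H constant_on UNIV"
    by (rule Liouville_theorem[OF H(1) totally_ramified_quotient_bounded[OF hol nc dist sp H]])
  then obtain \<gamma> where \<gamma>: "\<And>z. H z = \<gamma>" by (auto simp: constant_on_def)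
  obtain K where K: "0 < K" "\<And>z. norm (deriv g z) \<le> K * (1 + norm (g z))"
    using deriv_le_of_spherical_deriv_le[OF hol nc sp] by blast
  define R where "R = 2 * norm a + 2 * norm b + 2 * norm c + 1"
  have R: "1 \<le> R" by (simp add: R_def)
  \<comment> \<open>Where |g| = y is large, |P(g)|^2 is at least y^6 / 64 and |g'|^3 is at most (2 K
    y)^3. Since g is unbounded by Liouville, y may exceed any X, which forces \<gamma> = 0.\<close>
  have *: "norm \<gamma> * X ^ 3 \<le> 512 * K ^ 3" if X: "R \<le> X" for X
  proof -
    have "\<not> bounded (range g)" using Liouville_theorem[OF hol] nc by blast
    then obtain z where z: "X < norm (g z)" unfolding bounded_iff by (metis not_le rangeE)
    define y where "y = norm (g z)"
    have y: "X < y" "1 \<le> y" using z X R by (auto simp: y_def)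
    have "y ^ 3 \<le> 8 * norm (cubic a b c (g z))" unfolding y_def
      by (rule cubic_lower) (use z X in \<open>simp add: R_def\<close>)
    hence "(y ^ 3)\<^sup>2 \<le> (8 * norm (cubic a b c (g z)))\<^sup>2" using y by (intro power_mono) auto
    hence "norm \<gamma> * (y ^ 3)\<^sup>2 \<le> norm \<gamma> * (8 * norm (cubic a b c (g z)))\<^sup>2" by (intro mult_left_mono) auto
    also have "\<dots> = 64 * norm (deriv g z) ^ 3"
      using arg_cong[OF H(2)[of z], of norm] by (simp add: \<gamma> norm_mult norm_power power_mult_distrib)
    also have "\<dots> \<le> 64 * (K * (2 * y)) ^ 3"
    proof -
      have "norm (deriv g z) \<le> K * (1 + y)" using K(2)[of z] by (simp add: y_def)
      also have "\<dots> \<le> K * (2 * y)" using K y by (intro mult_left_mono) auto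
      finally show ?thesis by (intro mult_left_mono power_mono) auto
    qed
    finally have "y ^ 3 * (norm \<gamma> * y ^ 3) \<le> y ^ 3 * (512 * K ^ 3)"
      by (simp add: power_mult_distrib power2_eq_square mult_ac)
    hence "norm \<gamma> * y ^ 3 \<le> 512 * K ^ 3" using y by (subst (asm) mult_le_cancel_left_pos) auto
    moreover have "norm \<gamma> * X ^ 3 \<le> norm \<gamma> * y ^ 3" using y X R by (intro mult_left_mono power_mono) auto
    ultimately show ?thesis by linarith
  qed
  have "\<gamma> = 0"
  proof (rule ccontr)
    assume "\<gamma> \<noteq> 0"
    hence g0: "0 < norm \<gamma>" by simp
    define X where "X = max R (512 * K ^ 3 / norm \<gamma> + 1)"
    have X: "R \<le> X" "512 * K ^ 3 / norm \<gamma> < X" by (auto simp: X_def)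
    have "512 * K ^ 3 < norm \<gamma> * X" using X(2) g0 by (simp add: field_simps)
    also have "\<dots> \<le> norm \<gamma> * X ^ 3" using X R g0 by (intro mult_left_mono) (auto intro: self_le_power)
    finally show False using *[OF X(1)] by simp
  qed
  hence "deriv g z = 0" for z using H(2)[of z] by (simp add: \<gamma>)
  with constant_on_if_deriv_0_on_ball[OF hol zero_less_one] nc show False by blast
qed

section \<open>Growth of the function\<close>

text \<open>If m is the order of the first non-zero derivative, then \<open>zorder\<close> equals m.
  Arguing from an assumed non-zero derivative excludes the case of an identically vanishing f, where
  \<open>zorder\<close> is unspecified.\<close>

lemma higher_deriv_eq_0_if_zorder_ge:
  assumes hol: "f holomorphic_on UNIV" and z: "f z = 0" and k: "int k \<le> zorder f z" and j: "j < k"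
  shows "(deriv ^^ j) f z = 0"
proof (rule ccontr)
  assume "(deriv ^^ j) f z \<noteq> 0"
  define m where "m = (LEAST j. (deriv ^^ j) f z \<noteq> 0)"
  have m: "(deriv ^^ m) f z \<noteq> 0" unfolding m_def by (rule LeastI) fact
  have less: "(deriv ^^ i) f z = 0" if "i < m" for i using not_less_Least[of i] that unfolding m_def by blast
  have "m \<le> j" unfolding m_def by (rule Least_le) fact
  have "0 < m" using m z by (cases m) auto
  obtain g r where g: "0 < r" "g holomorphic_on ball z r"
    "\<And>w. w \<in> ball z r \<Longrightarrow> f w - f z = (w - z) ^ m * g w" "\<And>w. w \<in> ball z r \<Longrightarrow> g w \<noteq> 0"
    by (rule holomorphic_factor_order_of_zero[OF hol open_UNIV UNIV_I \<open>0 < m\<close> m]) (auto simp: less)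
  have "zorder f z = int m"
    by (rule zorder_eqI[of "ball z r" z g]) (use g z in \<open>auto simp: power_int_def\<close>)
  thus False using k \<open>m \<le> j\<close> j by simp
qed

lemma entire_eq_Taylor_polynomial:
  assumes hol: "g holomorphic_on UNIV" and 0: "\<And>z. (deriv ^^ Suc n) g z = 0"
  shows "g z = (\<Sum>i\<le>n. (deriv ^^ i) g w * (z - w) ^ i / fact i)"
proof -
  have "norm ((deriv ^^ 0) g z - (\<Sum>i\<le>n. (deriv ^^ i) g w * (z - w) ^ i / fact i)) \<le> 0 * norm (z - w) ^ Suc n / fact n"
  proof (rule complex_Taylor[of UNIV])
    show "((deriv ^^ i) g has_field_derivative (deriv ^^ Suc i) g x) (at x within UNIV)" for i x
      using has_field_derivative_higher_deriv[OF hol open_UNIV UNIV_I] by simp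
    show "norm ((deriv ^^ Suc n) g x) \<le> 0" for x unfolding 0 by simp
  qed auto
  thus ?thesis by simp
qed

text \<open>Cauchy's estimate on unit discs, which costs 1 in the radius.\<close>

lemma uniform_limit_higher_deriv:
  fixes G :: "nat \<Rightarrow> complex \<Rightarrow> complex"
  assumes holG: "\<And>n. G n holomorphic_on UNIV" and hol: "g holomorphic_on UNIV"
    and lim: "uniform_limit (cball z0 (R + 1)) G g sequentially"
  shows "uniform_limit (cball z0 R) (\<lambda>n. (deriv ^^ j) (G n)) ((deriv ^^ j) g) sequentially"
  unfolding uniform_limit_iff
proof (intro allI impI)
  fix e :: real assume e: "e > 0"
  define e' where "e' = e / (2 * fact j)"
  have e': "e' > 0" using e by (simp add: e'_def)
  have "\<forall>\<^sub>F n in sequentially. \<forall>z\<in>cball z0 (R + 1). dist (G n z) (g z) < e'"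
    by (rule uniform_limitD[OF lim e'])
  thus "\<forall>\<^sub>F n in sequentially. \<forall>z\<in>cball z0 R. dist ((deriv ^^ j) (G n) z) ((deriv ^^ j) g z) < e"
  proof eventually_elim
    case (elim n)
    show ?case
    proof
      fix z assume z: "z \<in> cball z0 R"
      have sub: "cball z 1 \<subseteq> cball z0 (R + 1)"
      proof
        fix w assume "w \<in> cball z 1"
        thus "w \<in> cball z0 (R + 1)" using z dist_triangle[of z0 w z] by simp
      qed
      have h: "(\<lambda>w. G n w - g w) holomorphic_on A" for A
        by (intro holomorphic_intros holomorphic_on_subset[OF holG] holomorphic_on_subset[OF hol]) auto
      have "norm ((deriv ^^ j) (\<lambda>w. G n w - g w) z) \<le> fact j * e' / 1 ^ j"
        by (rule Cauchy_bound_sub[OF h sub]) (use elim in \<open>auto simp: dist_norm less_imp_le\<close>)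
      moreover have "(deriv ^^ j) (\<lambda>w. G n w - g w) z = (deriv ^^ j) (G n) z - (deriv ^^ j) g z"
        by (rule higher_deriv_diff[OF holG hol open_UNIV]) auto
      ultimately have "dist ((deriv ^^ j) (G n) z) ((deriv ^^ j) g z) \<le> e / 2"
        by (simp add: dist_norm e'_def)
      thus "dist ((deriv ^^ j) (G n) z) ((deriv ^^ j) g z) < e" using e by simp
    qed
  qed
qed

text \<open>On a small circle about z0 the limit is at least \<mu> in modulus, so for large n the
  function \<open>G n\<close> is smaller at the centre than on the circle, and the minimum principle
  yields a zero. Existence suffices: the three zeros wanted later come from three different
  equations.\<close>

lemma Hurwitz_zero_exists:
  fixes G :: "nat \<Rightarrow> complex \<Rightarrow> complex"
  assumes holG: "\<And>n. G n holomorphic_on UNIV" and hol: "g holomorphic_on UNIV" and R: "0 < R"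
    and lim: "uniform_limit (cball z0 R) G g sequentially"
    and z0: "g z0 = 0" and w0: "g w0 \<noteq> 0" and e: "0 < e"
  shows "\<forall>\<^sub>F n in sequentially. \<exists>z\<in>ball z0 e. G n z = 0"
proof -
  have "\<forall>\<^sub>F w in at z0. g w \<noteq> 0"
    using non_zero_neighbour_alt[OF hol open_UNIV connected_UNIV UNIV_I UNIV_I w0, of z0] by simp
  then obtain d where d: "d > 0" "\<And>w. w \<noteq> z0 \<Longrightarrow> dist w z0 < d \<Longrightarrow> g w \<noteq> 0"
    unfolding eventually_at by blast
  define r where "r = min e (min d R) / 2"
  have r: "0 < r" "r < e" "r < d" "r < R" using d e R by (auto simp: r_def min_def)
  have cont: "continuous_on A g" "continuous_on A (G n)" for A n
    using holG[of n] hol by (meson continuous_on_subset holomorphic_on_imp_continuous_on subset_UNIV)+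
  have "\<exists>y\<in>sphere z0 r. \<forall>z\<in>sphere z0 r. norm (g y) \<le> norm (g z)"
    by (rule continuous_attains_inf) (use r cont in \<open>auto intro!: continuous_intros\<close>)
  then obtain y where y: "y \<in> sphere z0 r" "\<And>z. z \<in> sphere z0 r \<Longrightarrow> norm (g y) \<le> norm (g z)" by blast
  define \<mu> where "\<mu> = norm (g y)"
  have "y \<noteq> z0" "dist y z0 < d" using y(1) r by (auto simp: dist_commute)
  hence \<mu>: "0 < \<mu>" using d(2) by (simp add: \<mu>_def)
  have "\<forall>\<^sub>F n in sequentially. \<forall>z\<in>cball z0 R. dist (G n z) (g z) < \<mu> / 2"
    by (rule uniform_limitD[OF lim]) (use \<mu> in simp)
  thus ?thesis
  proof eventually_elim
    case (elim n)
    obtain z where "z \<in> ball z0 r" "G n z = 0"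
    proof (rule holomorphic_contract_to_zero[of z0 r "G n"])
      show "continuous_on (cball z0 r) (G n)" by (rule cont)
      show "G n holomorphic_on ball z0 r" using holG holomorphic_on_subset by blast
      show "norm (G n z0) < norm (G n z)" if "norm (z0 - z) = r" for z
      proof -
        have z: "z \<in> sphere z0 r" using that by (simp add: dist_norm)
        have "norm (G n z0) < \<mu> / 2" using bspec[OF elim, of z0] z0 R by (simp add: dist_norm)
        moreover have "norm (G n z - g z) < \<mu> / 2" using bspec[OF elim, of z] z r by (simp add: dist_norm)
        moreover have "\<mu> \<le> norm (g z)" using y(2)[OF z] by (simp add: \<mu>_def)
        ultimately show ?thesis using norm_triangle_ineq2[of "g z" "G n z"] by (simp add: norm_minus_commute)
      qed
    qed (use r in auto)
    thus ?case using r by force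
  qed
qed

text \<open>This transfers smallness at moving points to the limit. It is applied with \<tau> = 0 to
  derivatives at zeros of f, and with \<tau> of order \<rho>^k to the k-th derivative at shared
  points.\<close>

lemma limit_vanishes_if_small_nearby:
  fixes \<Phi> :: "nat \<Rightarrow> complex \<Rightarrow> complex"
  assumes R: "0 < R" and lim: "uniform_limit (cball z0 R) \<Phi> \<phi> sequentially" and cont: "isCont \<phi> z0"
    and \<tau>: "\<tau> \<longlonglongrightarrow> (0::real)"
    and small: "\<And>e. 0 < e \<Longrightarrow> \<forall>\<^sub>F n in sequentially. \<exists>z\<in>ball z0 e. norm (\<Phi> n z) \<le> \<tau> n"
  shows "\<phi> z0 = 0"
proof (rule ccontr)
  assume "\<phi> z0 \<noteq> 0"
  define \<eta> where "\<eta> = norm (\<phi> z0) / 3"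
  have \<eta>: "0 < \<eta>" using \<open>\<phi> z0 \<noteq> 0\<close> by (simp add: \<eta>_def)
  obtain d where d: "d > 0" "\<And>z. dist z z0 < d \<Longrightarrow> dist (\<phi> z) (\<phi> z0) < \<eta>"
    using cont \<eta> unfolding continuous_at_eps_delta by blast
  have e: "0 < min d R" using d R by simp
  have ev1: "\<forall>\<^sub>F n in sequentially. \<forall>z\<in>cball z0 R. dist (\<Phi> n z) (\<phi> z) < \<eta>"
    by (rule uniform_limitD[OF lim \<eta>])
  have ev2: "\<forall>\<^sub>F n in sequentially. \<tau> n < \<eta>" using \<tau> \<eta> by (rule order_tendstoD)
  have "\<forall>\<^sub>F n in sequentially. False"
    using ev1 ev2 small[OF e]
  proof eventually_elim
    case (elim n)
    then obtain z where z: "z \<in> ball z0 (min d R)" "norm (\<Phi> n z) \<le> \<tau> n" by blast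
    have 1: "norm (\<Phi> n z - \<phi> z) < \<eta>" using elim z by (auto simp: dist_norm)
    have 2: "norm (\<phi> z - \<phi> z0) < \<eta>" using d(2)[of z] z by (simp add: dist_norm norm_minus_commute)
    have "norm (\<phi> z0) \<le> norm (\<Phi> n z) + norm (\<Phi> n z - \<phi> z) + norm (\<phi> z - \<phi> z0)"
      using norm_triangle_ineq4[of "\<Phi> n z" "\<Phi> n z - \<phi> z"] norm_triangle_ineq4[of "\<phi> z" "\<phi> z - \<phi> z0"] by simp
    thus False using 1 2 z(2) elim(2) by (simp add: \<eta>_def)
  qed
  thus False by simp
qed

text \<open>Rescaling multiplies the k-th derivative by \<rho>^k, which tends to 0, so in the limit
  the values a, b, c of W all collapse to 0. This collapse turns one point where g takes a value in
  S into three nearby shared points.\<close>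

lemma sharing_spherical_deriv_bounded:
  assumes hol: "f holomorphic_on UNIV" and k: "0 < k"
    and zeros: "\<And>z. f z = 0 \<Longrightarrow> int k \<le> zorder f z"
    and dist: "a \<noteq> b" "b \<noteq> c" "a \<noteq> c"
    and share: "\<And>z. f z \<in> {a, b, c} \<longleftrightarrow> (deriv ^^ k) f z \<in> {a, b, c}"
  shows "\<exists>C. \<forall>z. norm (deriv f z) \<le> C * (1 + (norm (f z))\<^sup>2)"
proof (rule ccontr)
  assume "\<not> ?thesis"
  hence unb: "\<exists>z. C * (1 + (norm (f z))\<^sup>2) < norm (deriv f z)" for C by (meson not_le)
  show False
  proof (rule Zalcman_entire[OF hol unb])
    fix x :: "nat \<Rightarrow> complex" and \<rho> :: "nat \<Rightarrow> real" and g
    assume \<rho>: "\<And>n. 0 < \<rho> n" "\<rho> \<longlonglongrightarrow> 0" and g: "g holomorphic_on UNIV" "\<not> g constant_on UNIV"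
      "\<And>z. norm (deriv g z) \<le> 2 * (1 + (norm (g z))\<^sup>2)"
      and lim: "\<And>K. compact K \<Longrightarrow> uniform_limit K (\<lambda>n z. f (x n + of_real (\<rho> n) * z)) g sequentially"
    define G where "G = (\<lambda>n z. f (of_real (\<rho> n) * z + x n))"
    have holG: "G n holomorphic_on UNIV" for n
      using entire_rescale(1)[OF hol, of "x n" "of_real (\<rho> n)" UNIV] by (simp add: G_def add.commute)
    have limG: "uniform_limit (cball z0 R) G g sequentially" for z0 R
      using lim[of "cball z0 R"] by (simp add: G_def add.commute)
    have dG: "(deriv ^^ j) (G n) z = of_real (\<rho> n) ^ j * (deriv ^^ j) f (of_real (\<rho> n) * z + x n)" for j n z
      unfolding G_def by (rule higher_deriv_compose_linear'[OF hol open_UNIV open_UNIV]) auto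
    have limD: "uniform_limit (cball z0 R) (\<lambda>n. (deriv ^^ j) (G n)) ((deriv ^^ j) g) sequentially" for j z0 R
      by (rule uniform_limit_higher_deriv[OF holG g(1) limG])
    have holD: "(deriv ^^ j) g holomorphic_on UNIV" "(deriv ^^ j) (G n) holomorphic_on UNIV" for j n
      by (intro holomorphic_higher_deriv g holG open_UNIV)+
    \<comment> \<open>Otherwise g is a non-constant polynomial of degree below k. By Hurwitz its
      zero is approached by zeros of the rescaled functions, where all derivatives of order below k
      vanish; the Taylor expansion of g at its zero would then be 0.\<close>
    have "\<exists>w0. (deriv ^^ k) g w0 \<noteq> 0"
    proof (rule ccontr)
      assume "\<not> ?thesis"
      hence "(deriv ^^ Suc (k - 1)) g z = 0" for z using k by simp
      note Taylor = entire_eq_Taylor_polynomial[OF g(1) this]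
      have "\<exists>i\<in>{1..k - 1}. (deriv ^^ i) g 0 / fact i \<noteq> 0"
      proof (rule ccontr)
        assume 0: "\<not> ?thesis"
        have "g z = g 0" for z
        proof -
          have "g z = (\<Sum>i\<le>k - 1. (deriv ^^ i) g 0 * (z - 0) ^ i / fact i)" by (rule Taylor)
          also have "\<dots> = (\<Sum>i\<le>k - 1. if i = 0 then g 0 else 0)"
          proof (rule sum.cong)
            fix i assume "i \<in> {..k - 1}"
            thus "(deriv ^^ i) g 0 * (z - 0) ^ i / fact i = (if i = 0 then g 0 else 0)"
              using 0 by (cases "i = 0") auto
          qed simp
          finally show ?thesis by simp
        qed
        thus False using g(2) unfolding constant_on_def by blast
      qed
      then obtain z0 where "(\<Sum>i\<le>k - 1. (deriv ^^ i) g 0 / fact i * z0 ^ i) = 0"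
        using fundamental_theorem_of_algebra[of "\<lambda>i. (deriv ^^ i) g 0 / fact i" "k - 1"] by blast
      hence z0: "g z0 = 0" using Taylor[of z0 0] by simp
      obtain w1 where w1: "g w1 \<noteq> 0" using g(2) unfolding constant_on_def by blast
      have "(deriv ^^ j) g z0 = 0" if j: "j < k" for j
      proof (rule limit_vanishes_if_small_nearby[OF zero_less_one limD isCont_entire[OF holD(1)] tendsto_const])
        fix e :: real assume "0 < e"
        from Hurwitz_zero_exists[OF holG g(1) zero_less_one limG z0 w1 this]
        show "\<forall>\<^sub>F n in sequentially. \<exists>z\<in>ball z0 e. norm ((deriv ^^ j) (G n) z) \<le> 0"
        proof eventually_elim
          case (elim n)
          then obtain z where z: "z \<in> ball z0 e" "f (of_real (\<rho> n) * z + x n) = 0" by (auto simp: G_def)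
          have "(deriv ^^ j) f (of_real (\<rho> n) * z + x n) = 0"
            by (rule higher_deriv_eq_0_if_zorder_ge[OF hol z(2) zeros[OF z(2)] j])
          thus ?case using z(1) by (intro bexI[of _ z]) (simp_all add: dG)
        qed
      qed
      hence "g w1 = 0" using Taylor[of w1 z0] k by simp
      thus False using w1 by blast
    qed
    then obtain w0 where w0: "(deriv ^^ k) g w0 \<noteq> 0" by blast
    define m where "m = min (norm (a - b)) (min (norm (b - c)) (norm (a - c)))"
    have m: "0 < m" using dist by (simp add: m_def)
    have sep: "m \<le> norm (s - s')" if "s \<in> {a, b, c}" "s' \<in> {a, b, c}" "s \<noteq> s'" for s s'
      using that by (auto simp: m_def norm_minus_commute)
    define \<sigma> where "\<sigma> = norm a + norm b + norm c"
    have \<sigma>: "norm s \<le> \<sigma>" if "s \<in> {a, b, c}" for s using that by (auto simp: \<sigma>_def)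
    have \<rho>k: "(\<lambda>n. \<rho> n ^ k) \<longlonglongrightarrow> 0" using tendsto_power[OF \<rho>(2), of k] by (simp only: zero_power[OF k])
    have "g constant_on UNIV"
    proof (rule totally_ramified_constant[OF g(1) dist g(3)])
      fix z0 assume gz0: "g z0 \<in> {a, b, c}"
      define s where "s = g z0"
      obtain w1 where "g w1 \<noteq> g z0" using g(2) unfolding constant_on_def by blast
      hence w1: "g w1 - s \<noteq> 0" by (simp add: s_def)
      \<comment> \<open>Near z0 there are points with \<open>G n = s\<close>. There W lies in S,
        hence is bounded by \<sigma>, and the k-th derivative of \<open>G n\<close> is at most
        \<rho>^k \<sigma>.\<close>
      have gk0: "(deriv ^^ k) g z0 = 0"
      proof (rule limit_vanishes_if_small_nearby[OF zero_less_one limD isCont_entire[OF holD(1)]])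
        show "(\<lambda>n. \<rho> n ^ k * \<sigma>) \<longlonglongrightarrow> 0" by (rule tendsto_mult_left_zero[OF \<rho>k])
        fix e :: real assume e: "0 < e"
        have "\<forall>\<^sub>F n in sequentially. \<exists>z\<in>ball z0 e. G n z - s = 0"
        proof (rule Hurwitz_zero_exists[of "\<lambda>n z. G n z - s" "\<lambda>z. g z - s" 1 z0 w1 e])
          show "uniform_limit (cball z0 1) (\<lambda>n z. G n z - s) (\<lambda>z. g z - s) sequentially"
            by (intro uniform_limit_intros limG)
        qed (use w1 e in \<open>auto intro!: holomorphic_intros holG g simp: s_def\<close>)
        thus "\<forall>\<^sub>F n in sequentially. \<exists>z\<in>ball z0 e. norm ((deriv ^^ k) (G n) z) \<le> \<rho> n ^ k * \<sigma>"
        proof eventually_elim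
          case (elim n)
          then obtain z where z: "z \<in> ball z0 e" "f (of_real (\<rho> n) * z + x n) = s" by (auto simp: G_def)
          hence "(deriv ^^ k) f (of_real (\<rho> n) * z + x n) \<in> {a, b, c}"
            using share[of "of_real (\<rho> n) * z + x n"] gz0 by (simp add: s_def)
          from \<sigma>[OF this] show ?case using z(1) \<rho>(1)[of n]
            by (intro bexI[of _ z]) (auto simp: dG norm_mult norm_power intro!: mult_left_mono)
        qed
      qed
      have "isCont g z0" by (rule isCont_entire[OF g(1)])
      then obtain d where d: "d > 0" "\<And>z. dist z z0 < d \<Longrightarrow> dist (g z) (g z0) < m / 2"
        using m unfolding continuous_at_eps_delta by (metis half_gt_zero)
      have tri: "\<forall>\<^sub>F n in sequentially. \<exists>y\<in>ball z0 e. \<exists>u\<in>ball z0 e. \<exists>t\<in>ball z0 e.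
                  y \<noteq> u \<and> u \<noteq> t \<and> y \<noteq> t \<and> G n y = s \<and> G n u = s \<and> G n t = s" if e0: "0 < e" for e
      proof -
        define e' where "e' = min e (min d 1)"
        have e': "0 < e'" "e' \<le> e" "e' \<le> d" "e' \<le> 1" using e0 d by (auto simp: e'_def)
        \<comment> \<open>The targets \<rho>^k s' tend to 0, so each equation has the zero z0 of the
          k-th derivative of g as limiting solution. Taking s' = a, b, c gives three points,
          distinct because W differs there.\<close>
        have hit: "\<forall>\<^sub>F n in sequentially. \<exists>z\<in>ball z0 e'. (deriv ^^ k) (G n) z - of_real (\<rho> n ^ k) * s' = 0" for s'
        proof (rule Hurwitz_zero_exists[of "\<lambda>n z. (deriv ^^ k) (G n) z - of_real (\<rho> n ^ k) * s'" "(deriv ^^ k) g" 1 z0 w0 e'])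
          have "(\<lambda>n. of_real (\<rho> n ^ k) * s') \<longlonglongrightarrow> of_real 0 * s'"
            by (intro tendsto_mult tendsto_of_real \<rho>k tendsto_const)
          hence "uniform_limit (cball z0 1) (\<lambda>n z. of_real (\<rho> n ^ k) * s') (\<lambda>z. 0) sequentially"
            by (auto simp: uniform_limit_iff dist_norm tendsto_iff elim!: allE eventually_mono)
          hence "uniform_limit (cball z0 1) (\<lambda>n z. (deriv ^^ k) (G n) z - of_real (\<rho> n ^ k) * s')
             (\<lambda>z. (deriv ^^ k) g z - 0) sequentially"
            by (intro uniform_limit_intros limD)
          thus "uniform_limit (cball z0 1) (\<lambda>n z. (deriv ^^ k) (G n) z - of_real (\<rho> n ^ k) * s')
             ((deriv ^^ k) g) sequentially" by simp
        qed (use gk0 w0 e'(1) in \<open>auto intro!: holomorphic_on_diff holomorphic_on_const holD\<close>)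
        have ev: "\<forall>\<^sub>F n in sequentially. \<forall>z\<in>cball z0 1. dist (G n z) (g z) < m / 2"
          by (rule uniform_limitD[OF limG]) (use m in simp)
        show ?thesis
          using hit[of a] hit[of b] hit[of c] ev
        proof eventually_elim
          case (elim n)
          \<comment> \<open>By sharing, \<open>G n z\<close> lies in S. It is also within m of s,
            and m is the least distance between two of the values, so it equals s.\<close>
          have pt: "G n z = s \<and> (deriv ^^ k) f (of_real (\<rho> n) * z + x n) = s'"
            if "z \<in> ball z0 e'" "(deriv ^^ k) (G n) z - of_real (\<rho> n ^ k) * s' = 0" "s' \<in> {a, b, c}" for z s'
          proof
            have "of_real (\<rho> n) ^ k * ((deriv ^^ k) f (of_real (\<rho> n) * z + x n) - s') = 0"
              using that(2) by (simp add: dG algebra_simps)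
            thus eq: "(deriv ^^ k) f (of_real (\<rho> n) * z + x n) = s'" using \<rho>(1)[of n] by simp
            hence Gz: "G n z \<in> {a, b, c}" using share[of "of_real (\<rho> n) * z + x n"] that(3) by (simp add: G_def)
            have "norm (G n z - g z) < m / 2" using elim(4) that(1) e' by (auto simp: dist_norm)
            moreover have "norm (g z - s) < m / 2" using d(2)[of z] that(1) e' by (auto simp: dist_norm norm_minus_commute s_def)
            ultimately have "norm (G n z - s) < m" using norm_triangle_ineq[of "G n z - g z" "g z - s"] by simp
            thus "G n z = s" using sep[OF Gz, of s] gz0 by (force simp: s_def)
          qed
          obtain y where y: "y \<in> ball z0 e'" "(deriv ^^ k) (G n) y - of_real (\<rho> n ^ k) * a = 0" using elim(1) by blast
          obtain u where u: "u \<in> ball z0 e'" "(deriv ^^ k) (G n) u - of_real (\<rho> n ^ k) * b = 0" using elim(2) by blast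
          obtain t where t: "t \<in> ball z0 e'" "(deriv ^^ k) (G n) t - of_real (\<rho> n ^ k) * c = 0" using elim(3) by blast
          note P = pt[OF y] pt[OF u] pt[OF t]
          have "y \<noteq> u" "u \<noteq> t" "y \<noteq> t" using P dist by auto
          moreover have "y \<in> ball z0 e" "u \<in> ball z0 e" "t \<in> ball z0 e" using y u t e' by auto
          ultimately show ?case using P by blast
        qed
      qed
      show "\<exists>K r. 0 < r \<and> (\<forall>w\<in>ball z0 r. norm (g w - g z0) \<le> K * norm (w - z0) ^ 3)"
        using limit_cubic_contact[OF zero_less_one holG limG tri] zero_less_one unfolding s_def by blast
    qed
    thus False using g(2) by blast
  qed
qed

section \<open>Exponential type\<close>

text \<open>A discrete Gronwall argument: on a disc of radius 1 / (2 K), f varies by at most half of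
  max (1 + |f|), so 1 + |f| at most doubles. The number of steps from w to z is 2 K
  \<open>dist w z\<close> rounded up, whence the + 1 in the exponent. Exchanging w and z turns the
  estimate into a lower bound.\<close>

lemma growth_of_deriv_le:
  assumes hol: "f holomorphic_on UNIV" and K: "0 < K"
    and le: "\<And>z. norm (deriv f z) \<le> K * (1 + norm (f z))"
  shows "1 + norm (f z) \<le> exp (2 * K * dist w z + 1) * (1 + norm (f w))"
proof -
  define h where "h = 1 / (2 * K)"
  have h: "0 < h" using K by (simp add: h_def)
  have step: "1 + norm (f z) \<le> 2 * (1 + norm (f w))" if zw: "dist w z \<le> h" for z w
  proof -
    have cont: "continuous_on (cball w h) (\<lambda>z. norm (f z))"
      by (intro continuous_intros holomorphic_on_imp_continuous_on holomorphic_on_subset[OF hol]) auto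
    obtain v where v: "v \<in> cball w h" "\<And>z. z \<in> cball w h \<Longrightarrow> norm (f z) \<le> norm (f v)"
      using continuous_attains_sup[OF compact_cball _ cont] h by (auto simp: less_imp_le)
    have "norm (f v - f w) \<le> K * (1 + norm (f v)) * norm (v - w)"
    proof (rule field_differentiable_bound[of "cball w h" f "deriv f"])
      show "(f has_field_derivative deriv f z) (at z within cball w h)" for z
        by (rule has_field_derivative_at_within[OF holomorphic_derivI[OF hol open_UNIV UNIV_I]])
      show "norm (deriv f z) \<le> K * (1 + norm (f v))" if "z \<in> cball w h" for z
        using le[of z] v(2)[OF that] K by (meson add_left_mono mult_left_mono order_trans less_imp_le)
    qed (use v h in auto)
    also have "\<dots> \<le> K * (1 + norm (f v)) * h"
      using v K by (intro mult_left_mono) (auto simp: dist_norm norm_minus_commute)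
    also have "\<dots> = (1 + norm (f v)) / 2" using K by (simp add: h_def)
    finally have "1 + norm (f v) \<le> 2 * (1 + norm (f w))" using norm_triangle_ineq2[of "f v" "f w"] by simp
    thus ?thesis using v(2)[of z] zw by simp
  qed
  have iter: "dist w z \<le> real N * h \<Longrightarrow> 1 + norm (f z) \<le> 2 ^ N * (1 + norm (f w))" for N z
  proof (induction N arbitrary: z)
    case (Suc N)
    define z' where "z' = w + of_real (real N / real (Suc N)) * (z - w)"
    have d: "dist w z \<le> real (Suc N) * h" by (rule Suc.prems)
    have "dist w z' = real N / real (Suc N) * dist w z"
      by (simp add: z'_def dist_norm norm_mult norm_divide norm_minus_commute del: of_nat_Suc of_real_divide)
    also have "\<dots> \<le> real N / real (Suc N) * (real (Suc N) * h)" using d by (intro mult_left_mono) auto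
    finally have 1: "dist w z' \<le> real N * h" by simp
    have "z - z' = of_real (1 - real N / real (Suc N)) * (z - w)"
      by (simp only: z'_def of_real_diff of_real_1 left_diff_distrib mult_1) simp
    hence "dist z' z = \<bar>1 - real N / real (Suc N)\<bar> * dist w z"
      by (simp only: dist_norm norm_minus_commute[of z' z] norm_mult norm_of_real norm_minus_commute[of w z])
    also have "1 - real N / real (Suc N) = 1 / real (Suc N)" by (simp add: field_simps)
    also have "\<bar>1 / real (Suc N)\<bar> * dist w z \<le> 1 / real (Suc N) * (real (Suc N) * h)"
      using d by (simp only: abs_of_nonneg zero_le_divide_1_iff of_nat_0_le_iff) (intro mult_left_mono; simp)
    finally have "dist z' z \<le> h" by simp
    from step[OF this] Suc.IH[OF 1] show ?case by simp
  qed (use h in auto)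
  define N where "N = nat \<lceil>dist w z / h\<rceil>"
  have q: "0 \<le> dist w z / h" using h by simp
  have N: "dist w z / h \<le> real N" "real N \<le> dist w z / h + 1" using q unfolding N_def by linarith+
  have "dist w z \<le> real N * h" using N(1) h by (simp add: field_simps)
  from iter[OF this] have "1 + norm (f z) \<le> 2 ^ N * (1 + norm (f w))" .
  also have "(2::real) ^ N \<le> exp 1 ^ N" using exp_ge_add_one_self[of 1] by (intro power_mono) auto
  also have "exp (1::real) ^ N = exp (real N)" by (simp add: exp_of_nat_mult[of N 1, simplified])
  also have "\<dots> \<le> exp (2 * K * dist w z + 1)" using N(2) by (simp add: h_def mult_ac)
  finally show ?thesis by (simp add: mult_right_mono)
qed

lemma higher_deriv_le_of_growth:
  assumes hol: "f holomorphic_on UNIV"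
    and gr: "\<And>w z. 1 + norm (f z) \<le> exp (K * dist w z + 1) * (1 + norm (f w))" and K: "0 < K"
  shows "norm ((deriv ^^ n) f z) \<le> fact n * exp (K + 1) * (1 + norm (f z))"
proof -
  have "norm ((deriv ^^ n) f z) \<le> fact n * (exp (K + 1) * (1 + norm (f z))) / 1 ^ n"
  proof (rule Cauchy_bound_sub[of f "cball z 1"])
    show "f holomorphic_on cball z 1" using hol holomorphic_on_subset by blast
    fix w assume "w \<in> cball z 1"
    hence "K * dist z w + 1 \<le> K * 1 + 1" using K by (intro add_mono mult_left_mono) auto
    hence "exp (K * dist z w + 1) * (1 + norm (f z)) \<le> exp (K + 1) * (1 + norm (f z))"
      by (intro mult_right_mono) auto
    thus "norm (f w) \<le> exp (K + 1) * (1 + norm (f z))" using gr[of w z] by linarith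
  qed auto
  thus ?thesis by simp
qed

section \<open>The exponential factor\<close>

text \<open>At half the radius Schwarz gives D \<le> (D + 2 Re (h z0)) / 2 for D = |h z - h
  z0|.\<close>

lemma Borel_Caratheodory_half:
  assumes hol: "h holomorphic_on ball z0 d"
    and pos: "\<And>z. z \<in> ball z0 d \<Longrightarrow> 0 < Re (h z)" and d: "0 < d" and z: "dist z0 z \<le> d / 2"
  shows "norm (h z - h z0) \<le> 2 * Re (h z0)"
proof -
  define D where "D = norm (h z - h z0)"
  have zb: "z \<in> ball z0 d" using z d by simp
  have z0p: "0 < Re (h z0)" using pos[of z0] d by simp
  have "h z + cnj (h z0) = (h z - h z0) + of_real (2 * Re (h z0))" by (simp add: complex_eq_iff)
  hence "norm (h z + cnj (h z0)) \<le> D + norm (of_real (2 * Re (h z0)) :: complex)"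
    unfolding D_def by (metis norm_triangle_ineq)
  also have "norm (of_real (2 * Re (h z0)) :: complex) = 2 * Re (h z0)" using z0p by (simp del: of_real_mult)
  finally have 1: "norm (h z + cnj (h z0)) \<le> D + 2 * Re (h z0)" .
  have "d * D \<le> norm (z - z0) * norm (h z + cnj (h z0))"
    unfolding D_def by (rule Schwarz_halfplane[OF hol pos zb])
  also have "\<dots> \<le> d / 2 * (D + 2 * Re (h z0))"
    using 1 z d by (intro mult_mono) (auto simp: dist_norm norm_minus_commute)
  also have "\<dots> = d * (D / 2 + Re (h z0))" by (simp add: algebra_simps)
  finally have "D \<le> D / 2 + Re (h z0)" using d by (simp only: mult_le_cancel_left_pos)
  thus ?thesis by (simp add: D_def)
qed

text \<open>Dividing out a zero \<open>p\<close> with \<open>|p| \<le> r\<close> by its Blaschke factor for the disc of radius \<open>2r\<close>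
  keeps the modulus on the circle of radius \<open>2r\<close> and at least doubles the modulus at the origin,
  which bounds the number of such divisions.\<close>

lemma Blaschke_divide_zeros:
  assumes G: "G holomorphic_on UNIV" and G0: "G 0 \<noteq> 0" and r: "0 < r"
  obtains G1 where "G1 holomorphic_on UNIV" "\<And>z. norm z = 2 * r \<Longrightarrow> norm (G1 z) = norm (G z)"
    "norm (G 0) \<le> norm (G1 0)" "\<And>z. norm z \<le> r \<Longrightarrow> G1 z \<noteq> 0"
proof (rule ccontr)
  assume nt: "\<not> thesis"
  note obt = that
  have none: "\<exists>z. norm z \<le> r \<and> G1 z = 0" if "G1 holomorphic_on UNIV"
    "\<And>z. norm z = 2 * r \<Longrightarrow> norm (G1 z) = norm (G z)" "norm (G 0) \<le> norm (G1 0)" for G1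
    using obt[OF that] nt by blast
  have it: "\<exists>G1. G1 holomorphic_on UNIV \<and> (\<forall>z. norm z = 2 * r \<longrightarrow> norm (G1 z) = norm (G z))
      \<and> 2 ^ n * norm (G 0) \<le> norm (G1 0)" for n :: nat
  proof (induction n)
    case 0 show ?case using G by (intro exI[of _ G]) auto
  next
    case (Suc n)
    then obtain G1 where G1: "G1 holomorphic_on UNIV" "\<And>z. norm z = 2 * r \<Longrightarrow> norm (G1 z) = norm (G z)"
      "2 ^ n * norm (G 0) \<le> norm (G1 0)" by blast
    have "1 * norm (G 0) \<le> 2 ^ n * norm (G 0)" by (intro mult_right_mono) auto
    hence "norm (G 0) \<le> norm (G1 0)" using G1(3) by linarith
    from none[OF G1(1,2) this] obtain p where p: "norm p \<le> r" "G1 p = 0" by blast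
    define k where "k = (\<lambda>z. if z = p then deriv G1 p else (G1 z - G1 p) / (z - p))"
    have hk: "k holomorphic_on UNIV" unfolding k_def by (rule pole_lemma_open[OF G1(1) open_UNIV])
    have G1k: "G1 z = (z - p) * k z" for z using p by (simp add: k_def)
    \<comment> \<open>The factor replacing z - p has modulus |z - p| on the circle |z| = 2 r, since
      4 r^2 = z \<open>cnj z\<close> there, and modulus 2 r \<ge> 2 |p| at 0.\<close>
    define G2 where "G2 = (\<lambda>z. (of_real (4 * r\<^sup>2) - cnj p * z) / of_real (2 * r) * k z)"
    have "G2 holomorphic_on UNIV" unfolding G2_def using r by (intro holomorphic_intros hk) auto
    moreover have "norm (G2 z) = norm (G z)" if z: "norm z = 2 * r" for z
    proof -
      have "of_real (4 * r\<^sup>2) = z * cnj z" using z by (simp add: complex_norm_square[symmetric] power_mult_distrib)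
      hence "norm (of_real (4 * r\<^sup>2) - cnj p * z) = norm (z * cnj (z - p))" by (simp add: algebra_simps)
      also have "\<dots> = 2 * r * norm (z - p)" using z by (simp only: norm_mult complex_mod_cnj)
      finally have "norm (G2 z) = norm (z - p) * norm (k z)" using r by (simp add: G2_def norm_mult norm_divide)
      also have "\<dots> = norm (G z)" using G1(2)[OF z] by (simp add: G1k norm_mult)
      finally show ?thesis .
    qed
    moreover have "2 ^ Suc n * norm (G 0) \<le> norm (G2 0)"
    proof -
      have "2 * norm (G1 0) = 2 * (norm p * norm (k 0))" by (simp add: G1k norm_mult)
      also have "\<dots> \<le> 2 * (r * norm (k 0))" using p by (intro mult_left_mono mult_right_mono) auto
      also have "\<dots> = norm (G2 0)" using r by (simp add: G2_def norm_mult norm_divide norm_power power2_eq_square)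
      finally show ?thesis using G1(3) by simp
    qed
    ultimately show ?case by blast
  qed
  have "continuous_on (cball 0 (2 * r)) G" using G holomorphic_on_imp_continuous_on holomorphic_on_subset by blast
  then obtain E where E: "\<And>z. z \<in> cball 0 (2 * r) \<Longrightarrow> norm (G z) \<le> E"
    using compact_imp_bounded[OF compact_continuous_image[OF _ compact_cball]] by (metis bounded_iff image_eqI)
  obtain n where "E / norm (G 0) < 2 ^ n" using real_arch_pow[of 2 "E / norm (G 0)"] by auto
  hence n: "E < 2 ^ n * norm (G 0)" using G0 by (simp add: field_simps)
  obtain G1 where G1: "G1 holomorphic_on UNIV" "\<forall>z. norm z = 2 * r \<longrightarrow> norm (G1 z) = norm (G z)"
    "2 ^ n * norm (G 0) \<le> norm (G1 0)" using it by blast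
  have "norm (G1 0) \<le> E"
  proof (rule maximum_modulus_frontier[of G1 "cball 0 (2 * r)"])
    show "G1 holomorphic_on interior (cball 0 (2 * r))" using G1(1) holomorphic_on_subset by blast
    show "continuous_on (closure (cball 0 (2 * r))) G1"
      using G1(1) holomorphic_on_imp_continuous_on holomorphic_on_subset by blast
    show "norm (G1 z) \<le> E" if "z \<in> frontier (cball 0 (2 * r))" for z
      using that r G1(2) E[of z] by auto
  qed (use r in auto)
  thus False using G1(3) n by linarith
qed

text \<open>A linear bound for \<alpha> is needed although G may have zeros. After the Blaschke
  division G1 and exp \<alpha> G1 are both zero-free on the disc of radius r and bounded by exp M,
  so they have logarithms \<beta> and \<alpha> + \<beta> with real part at most M.
  Borel-Caratheodory bounds the variation of each, and \<alpha> is their difference.\<close>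

lemma exp_quotient_linear_at_0:
  assumes G: "G holomorphic_on UNIV" and \<alpha>: "\<alpha> holomorphic_on UNIV" and G0: "G 0 \<noteq> 0"
    and A: "0 \<le> A"
    and Gb: "\<And>z. norm (G z) \<le> exp (A * norm z + A')"
    and Fb: "\<And>z. norm (exp (\<alpha> z) * G z) \<le> exp (A * norm z + A')"
  shows "\<exists>c d. \<forall>z. \<alpha> z = c * z + d"
proof -
  define C where "C = 4 * (A' + 1) - 4 * ln (norm (G 0)) - 2 * Re (\<alpha> 0)"
  have key: "norm (\<alpha> z - \<alpha> 0) \<le> 16 * A * norm z + C" if z: "z \<noteq> 0" for z
  proof -
    \<comment> \<open>With r = 2 |z| the point z lies in the half-size disc; the bounds on G are
      used on the circle of radius 2 r = 4 |z|.\<close>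
    define r where "r = 2 * norm z"
    have r: "0 < r" using z by (simp add: r_def)
    define M where "M = 2 * A * r + A'"
    obtain G1 where G1: "G1 holomorphic_on UNIV" "\<And>z. norm z = 2 * r \<Longrightarrow> norm (G1 z) = norm (G z)"
      "norm (G 0) \<le> norm (G1 0)" "\<And>z. norm z \<le> r \<Longrightarrow> G1 z \<noteq> 0"
      by (rule Blaschke_divide_zeros[OF G G0 r]) blast
    have maxm: "norm (\<phi> w) \<le> exp M"
      if \<phi>: "\<phi> holomorphic_on UNIV" "\<And>w. norm w = 2 * r \<Longrightarrow> norm (\<phi> w) \<le> exp M" and w: "norm w \<le> r" for \<phi> w
    proof (rule maximum_modulus_frontier[of \<phi> "cball 0 (2 * r)"])
      show "\<phi> holomorphic_on interior (cball 0 (2 * r))" using \<phi>(1) holomorphic_on_subset by blast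
      show "continuous_on (closure (cball 0 (2 * r))) \<phi>"
        using \<phi>(1) holomorphic_on_imp_continuous_on holomorphic_on_subset by blast
      show "norm (\<phi> w) \<le> exp M" if "w \<in> frontier (cball 0 (2 * r))" for w
        using that r \<phi>(2) by auto
    qed (use w r in auto)
    have ME: "exp (A * norm w + A') = exp M" if "norm w = 2 * r" for w using that by (simp add: M_def mult_ac)
    have G1M: "norm (G1 w) \<le> exp M" if "norm w \<le> r" for w
    proof (rule maxm[OF G1(1) _ that])
      fix w :: complex assume w: "norm w = 2 * r"
      show "norm (G1 w) \<le> exp M" using Gb[of w] unfolding G1(2)[OF w] ME[OF w] .
    qed
    have F1M: "norm (exp (\<alpha> w) * G1 w) \<le> exp M" if "norm w \<le> r" for w
    proof (rule maxm[OF _ _ that])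
      show "(\<lambda>w. exp (\<alpha> w) * G1 w) holomorphic_on UNIV" by (intro holomorphic_intros \<alpha> G1)
      fix w :: complex assume w: "norm w = 2 * r"
      show "norm (exp (\<alpha> w) * G1 w) \<le> exp M" using Fb[of w] unfolding norm_mult G1(2)[OF w] ME[OF w] .
    qed
    have hG1: "G1 holomorphic_on ball 0 r" using G1(1) holomorphic_on_subset by blast
    have h\<alpha>: "\<alpha> holomorphic_on ball 0 r" using \<alpha> holomorphic_on_subset by blast
    have nz: "G1 w \<noteq> 0" if "w \<in> ball 0 r" for w using G1(4)[of w] that by auto
    obtain \<beta> where \<beta>: "\<beta> holomorphic_on ball 0 r" "\<And>w. w \<in> ball 0 r \<Longrightarrow> G1 w = exp (\<beta> w)"
      using contractible_imp_holomorphic_log[OF hG1 convex_imp_contractible[OF convex_ball] nz] by blast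
    \<comment> \<open>The + 1 makes the real parts strictly positive.\<close>
    define h1 where "h1 = (\<lambda>w. of_real (M + 1) - \<beta> w)"
    define h2 where "h2 = (\<lambda>w. of_real (M + 1) - (\<alpha> w + \<beta> w))"
    have pos1: "0 < Re (h1 w)" if w: "w \<in> ball 0 r" for w
    proof -
      have "exp (Re (\<beta> w)) \<le> exp M" using G1M[of w] w by (simp add: \<beta>(2)[OF w])
      thus ?thesis by (simp add: h1_def)
    qed
    have pos2: "0 < Re (h2 w)" if w: "w \<in> ball 0 r" for w
    proof -
      have "exp (Re (\<alpha> w + \<beta> w)) \<le> exp M"
        using F1M[of w] w by (simp add: \<beta>(2)[OF w] norm_mult exp_add)
      thus ?thesis by (simp add: h2_def)
    qed
    have zr: "dist 0 z \<le> r / 2" by (simp add: r_def)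
    have b1: "norm (h1 z - h1 0) \<le> 2 * Re (h1 0)"
      by (rule Borel_Caratheodory_half[OF _ pos1 r zr]) (auto simp: h1_def intro!: holomorphic_intros \<beta>)
    have b2: "norm (h2 z - h2 0) \<le> 2 * Re (h2 0)"
      by (rule Borel_Caratheodory_half[OF _ pos2 r zr]) (auto simp: h2_def intro!: holomorphic_intros \<beta> h\<alpha>)
    have "ln (norm (G 0)) \<le> ln (norm (G1 0))" using G1(3) G0 G1(4)[of 0] r by simp
    also have "norm (G1 0) = exp (Re (\<beta> 0))" using \<beta>(2)[of 0] r by simp
    finally have \<beta>0: "ln (norm (G 0)) \<le> Re (\<beta> 0)" by simp
    have "norm (\<alpha> z - \<alpha> 0) = norm ((h1 z - h1 0) - (h2 z - h2 0))" by (simp add: h1_def h2_def)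
    also have "\<dots> \<le> 2 * Re (h1 0) + 2 * Re (h2 0)" using norm_triangle_ineq4 b1 b2 by (smt (verit))
    also have "\<dots> = 4 * (M + 1) - 4 * Re (\<beta> 0) - 2 * Re (\<alpha> 0)" by (simp add: h1_def h2_def)
    also have "\<dots> \<le> 16 * A * norm z + C" using \<beta>0 by (simp add: C_def M_def r_def)
    finally show ?thesis .
  qed
  define B where "B = 16 * A + \<bar>C\<bar> + norm (\<alpha> 0)"
  have lin: "\<alpha> z = (\<Sum>k\<le>1. (deriv ^^ k) \<alpha> 0 / fact k * z ^ k)" for z
  proof (rule Liouville_polynomial[OF \<alpha>, of 1 B])
    fix z :: complex assume z: "1 \<le> norm z"
    have "norm (\<alpha> z) \<le> norm (\<alpha> z - \<alpha> 0) + norm (\<alpha> 0)" using norm_triangle_ineq[of "\<alpha> z - \<alpha> 0" "\<alpha> 0"] by simp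
    also have "\<dots> \<le> 16 * A * norm z + \<bar>C\<bar> * 1 + norm (\<alpha> 0) * 1" using key[of z] z abs_ge_self[of C] by (cases "z = 0") auto
    also have "\<dots> \<le> 16 * A * norm z + \<bar>C\<bar> * norm z + norm (\<alpha> 0) * norm z"
      using mult_left_mono[OF z, of "\<bar>C\<bar>"] mult_left_mono[OF z, of "norm (\<alpha> 0)"] by simp
    finally show "norm (\<alpha> z) \<le> B * norm z ^ 1" by (simp add: B_def algebra_simps)
  qed
  have "\<alpha> z = deriv \<alpha> 0 * z + \<alpha> 0" for z using lin[of z] by simp
  thus ?thesis by blast
qed

lemma exp_quotient_linear:
  assumes G: "G holomorphic_on UNIV" and \<alpha>: "\<alpha> holomorphic_on UNIV" and w: "G w \<noteq> 0"
    and A: "0 \<le> A"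
    and Gb: "\<And>z. norm (G z) \<le> exp (A * norm z + A')"
    and Fb: "\<And>z. norm (exp (\<alpha> z) * G z) \<le> exp (A * norm z + A')"
  shows "\<exists>c d. \<forall>z. \<alpha> z = c * z + d"
proof -
  have sh: "(\<lambda>z. \<phi> (z + w)) holomorphic_on UNIV" if "\<phi> holomorphic_on UNIV" for \<phi> :: "complex \<Rightarrow> complex"
    using entire_rescale(1)[OF that, of w 1 UNIV] by (simp add: add.commute)
  have le: "exp (A * norm (z + w) + A') \<le> exp (A * norm z + (A * norm w + A'))" for z
    using mult_left_mono[OF norm_triangle_ineq[of z w] A] by (simp add: algebra_simps)
  have "\<exists>c d. \<forall>z. \<alpha> (z + w) = c * z + d"
  proof (rule exp_quotient_linear_at_0[OF sh[OF G] sh[OF \<alpha>] _ A, of "A * norm w + A'"])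
    show "norm (G (z + w)) \<le> exp (A * norm z + (A * norm w + A'))" for z using Gb le order_trans by blast
    show "norm (exp (\<alpha> (z + w)) * G (z + w)) \<le> exp (A * norm z + (A * norm w + A'))" for z
      using Fb le order_trans by blast
  qed (use w in simp)
  then obtain c d where cd: "\<And>z. \<alpha> (z + w) = c * z + d" by blast
  have "\<alpha> z = c * z + (d - c * w)" for z using cd[of "z - w"] by (simp add: algebra_simps)
  thus ?thesis by blast
qed

section \<open>Shared multiplicities and the zero-free quotient of the cubics\<close>

lemma entire_mult_eq_0:
  assumes f: "f holomorphic_on UNIV" and g: "g holomorphic_on UNIV"
    and 0: "\<And>z. f z * g z = (0::complex)" and w: "g w \<noteq> 0"
  shows "f z = 0"
proof -
  obtain r where r: "r > 0" "\<And>z. dist w z < r \<Longrightarrow> g z \<noteq> 0"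
    using continuous_at_avoid[OF isCont_entire[OF g] w] by blast
  have fz: "f z = 0" if "z \<in> ball w r" for z using 0[of z] r(2)[of z] that by simp
  show ?thesis
    by (rule analytic_continuation_open[of "ball w r" UNIV f "\<lambda>_. 0"]) (use r(1) f fz in auto)
qed

text \<open>With equal orders the powers of w - z cancel, and the quotient of the two non-vanishing
  cofactors is continuous at z.\<close>

lemma same_zorder_bound:
  assumes f: "f holomorphic_on UNIV" and g: "g holomorphic_on UNIV"
    and fn: "f w1 \<noteq> 0" and gn: "g w2 \<noteq> 0" and 0: "f z = 0" "g z = 0" and eq: "zorder f z = zorder g z"
  shows "\<exists>C>0. \<forall>\<^sub>F w in at z. norm (g w) \<le> C * norm (f w)"
proof -
  define n where "n = nat (zorder f z)"
  obtain r1 where r1: "r1 > 0" "zor_poly f z holomorphic_on cball z r1"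
    "\<And>w. w \<in> cball z r1 \<Longrightarrow> f w = zor_poly f z w * (w - z) ^ n \<and> zor_poly f z w \<noteq> 0"
    using zorder_exist_zero[OF f open_UNIV connected_UNIV UNIV_I, of z] fn unfolding n_def by blast
  obtain r2 where r2: "r2 > 0" "zor_poly g z holomorphic_on cball z r2"
    "\<And>w. w \<in> cball z r2 \<Longrightarrow> g w = zor_poly g z w * (w - z) ^ n \<and> zor_poly g z w \<noteq> 0"
    using zorder_exist_zero[OF g open_UNIV connected_UNIV UNIV_I, of z] gn unfolding n_def eq by blast
  have isC: "isCont h z" if "h holomorphic_on cball z r" "r > 0" for h r
    using that by (metis centre_in_ball continuous_on_interior holomorphic_on_imp_continuous_on interior_cball)
  define q where "q = (\<lambda>w. zor_poly g z w / zor_poly f z w)"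
  have "isCont q z" unfolding q_def using isC r1 r2 by (intro continuous_intros) auto
  hence "((\<lambda>w. norm (q w)) \<longlongrightarrow> norm (q z)) (at z)" by (intro tendsto_norm) (simp add: isCont_def)
  hence ev: "\<forall>\<^sub>F w in at z. norm (q w) < norm (q z) + 1" by (rule order_tendstoD) simp
  have "\<forall>\<^sub>F w in at z. w \<in> ball z (min r1 r2)" 
    using eventually_at_ball[of "min r1 r2" z UNIV] r1(1) r2(1) by (auto elim: eventually_mono)
  with ev have "\<forall>\<^sub>F w in at z. norm (g w) \<le> (norm (q z) + 1) * norm (f w)"
  proof eventually_elim
    case (elim w)
    have 1: "f w = zor_poly f z w * (w - z) ^ n" "zor_poly f z w \<noteq> 0" "g w = zor_poly g z w * (w - z) ^ n"
      using r1(3)[of w] r2(3)[of w] elim by auto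
    have "g w = q w * f w" using 1 by (simp add: q_def)
    hence "norm (g w) = norm (q w) * norm (f w)" by (simp add: norm_mult)
    also have "\<dots> \<le> (norm (q z) + 1) * norm (f w)" using elim by (intro mult_right_mono) auto
    finally show ?case .
  qed
  moreover have "0 < norm (q z) + 1" by (simp add: add_nonneg_pos)
  ultimately show ?thesis by blast
qed

lemma share_CM_sym: "share_CM f g S \<Longrightarrow> share_CM g f S"
  by (simp add: share_CM_def)

lemma E_set_zorder_mem:
  assumes f: "f holomorphic_on UNIV" "\<not> f constant_on UNIV" and z: "f z \<in> S"
  shows "0 < zorder (\<lambda>w. f w - f z) z" "(z, nat (zorder (\<lambda>w. f w - f z) z)) \<in> E_set f S"
proof -
  have h: "(\<lambda>w. f w - f z) holomorphic_on UNIV" by (intro holomorphic_intros f)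
  obtain w1 where w1: "f w1 \<noteq> f z" using f(2) unfolding constant_on_def by blast
  have "\<forall>\<^sub>F w in at z. f w - f z \<noteq> 0"
    using non_zero_neighbour_alt[OF h open_UNIV connected_UNIV UNIV_I UNIV_I, of w1 z] w1 by simp
  hence fr: "\<exists>\<^sub>F w in at z. f w \<noteq> f z" by (intro eventually_frequently) auto
  show "0 < zorder (\<lambda>w. f w - f z) z"
    using zorder_exist_zero[OF h open_UNIV connected_UNIV UNIV_I, of z] w1 by auto
  thus "(z, nat (zorder (\<lambda>w. f w - f z) z)) \<in> E_set f S" using z fr unfolding E_set_def by force
qed

lemma share_CM_zorder:
  assumes f: "f holomorphic_on UNIV" "\<not> f constant_on UNIV" and sh: "share_CM f g S" and z: "f z \<in> S"
  shows "g z \<in> S \<and> zorder (\<lambda>w. f w - f z) z = zorder (\<lambda>w. g w - g z) z"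
proof -
  have "(z, nat (zorder (\<lambda>w. f w - f z) z)) \<in> E_set g S"
    using E_set_zorder_mem(2)[OF f z] sh by (simp add: share_CM_def)
  then obtain s where "s \<in> S" "g z = s" "zorder (\<lambda>w. g w - s) z = int (nat (zorder (\<lambda>w. f w - f z) z))"
    unfolding E_set_def by blast
  thus ?thesis using E_set_zorder_mem(1)[OF f z] by auto
qed

text \<open>For a constant g the frequently-condition fails everywhere, so its \<open>E_set\<close>
  is empty; f would then omit two values, against little Picard. This is how W is seen to be
  non-constant.\<close>

lemma share_CM_constant:
  assumes f: "f holomorphic_on UNIV" "\<not> f constant_on UNIV" and sh: "share_CM f g S"
    and a: "a \<in> S" "b \<in> S" "a \<noteq> b"
  shows "\<not> g constant_on UNIV"
proof
  assume "g constant_on UNIV"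
  then obtain d where "g = (\<lambda>_. d)" by (auto simp: constant_on_def)
  hence "E_set g S = {}" by (auto simp: E_set_def)
  hence "f z \<notin> S" for z using E_set_zorder_mem(2)[OF f, of z S] sh by (auto simp: share_CM_def)
  hence "range f \<inter> {a, b} = {}" using a by auto
  then obtain e where "f = (\<lambda>x. e)" using little_Picard[OF f(1) a(3)] by blast
  thus False using f(2) by (simp add: constant_on_def)
qed

text \<open>The roots f z and g z may differ; only the orders agree. The two remaining factors of
  P(f) do not vanish at z, and those of P(g) are continuous.\<close>

lemma cubic_ratio_bound:
  assumes f: "f holomorphic_on UNIV" "\<not> f constant_on UNIV"
    and g: "g holomorphic_on UNIV" "\<not> g constant_on UNIV"
    and dist: "a \<noteq> b" "b \<noteq> c" "a \<noteq> c" and sh: "share_CM f g {a, b, c}" and z: "f z \<in> {a, b, c}"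
  shows "\<exists>C. \<forall>\<^sub>F w in at z. norm (cubic a b c (g w)) \<le> C * norm (cubic a b c (f w))"
proof -
  have gz: "g z \<in> {a, b, c}" and eq: "zorder (\<lambda>w. f w - f z) z = zorder (\<lambda>w. g w - g z) z"
    using share_CM_zorder[OF f sh z] by auto
  obtain w1 w2 where "f w1 \<noteq> f z" "g w2 \<noteq> g z" using f(2) g(2) unfolding constant_on_def by blast
  hence w: "f w1 - f z \<noteq> 0" "g w2 - g z \<noteq> 0" by auto
  have "\<exists>C>0. \<forall>\<^sub>F w in at z. norm (g w - g z) \<le> C * norm (f w - f z)"
    by (rule same_zorder_bound[OF _ _ w _ _ eq]) (auto intro!: holomorphic_intros f g)
  then obtain C where C: "C > 0" "\<forall>\<^sub>F w in at z. norm (g w - g z) \<le> C * norm (f w - f z)" by blast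
  obtain s1 s2 where s: "s1 \<noteq> f z" "s2 \<noteq> f z" "\<And>x. cubic a b c x = (x - f z) * ((x - s1) * (x - s2))"
    by (rule cubic_factor[OF dist z]) blast
  obtain t1 t2 where t: "\<And>x. cubic a b c x = (x - g z) * ((x - t1) * (x - t2))"
    by (rule cubic_factor[OF dist gz]) blast
  define q where "q = (\<lambda>w. ((g w - t1) * (g w - t2)) / ((f w - s1) * (f w - s2)))"
  have "isCont q z" unfolding q_def
    using s isCont_entire[OF f(1)] isCont_entire[OF g(1)] by (intro continuous_intros) auto
  hence "((\<lambda>w. norm (q w)) \<longlongrightarrow> norm (q z)) (at z)" by (intro tendsto_norm) (simp add: isCont_def)
  hence ev: "\<forall>\<^sub>F w in at z. norm (q w) < norm (q z) + 1" by (rule order_tendstoD) simp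
  have "((\<lambda>w. (f w - s1) * (f w - s2)) \<longlongrightarrow> (f z - s1) * (f z - s2)) (at z)"
    using isCont_entire[OF f(1), of z] unfolding isCont_def by (intro tendsto_intros)
  hence "\<forall>\<^sub>F w in at z. (f w - s1) * (f w - s2) \<noteq> 0" by (rule tendsto_imp_eventually_ne) (use s in simp)
  with ev C(2) have "\<forall>\<^sub>F w in at z. norm (cubic a b c (g w)) \<le> (C * (norm (q z) + 1)) * norm (cubic a b c (f w))"
  proof eventually_elim
    case (elim w)
    have "(g w - t1) * (g w - t2) = q w * ((f w - s1) * (f w - s2))" using elim by (simp add: q_def)
    hence "norm (cubic a b c (g w)) = norm (g w - g z) * (norm (q w) * norm ((f w - s1) * (f w - s2)))"
      by (simp only: t norm_mult)
    also have "\<dots> \<le> (C * norm (f w - f z)) * ((norm (q z) + 1) * norm ((f w - s1) * (f w - s2)))"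
      using elim C(1) by (intro mult_mono) auto
    also have "\<dots> = (C * (norm (q z) + 1)) * norm (cubic a b c (f w))" by (simp only: s(3) norm_mult mult_ac)
    finally show ?case .
  qed
  thus ?thesis by blast
qed

text \<open>The argument is symmetric: both quotients of the cubics are entire and their product is
  1, so the quotient is zero-free and has an entire logarithm.\<close>

lemma share_CM_imp_exp_relation:
  assumes f: "f holomorphic_on UNIV" "\<not> f constant_on UNIV"
    and g: "g holomorphic_on UNIV" "\<not> g constant_on UNIV"
    and dist: "a \<noteq> b" "b \<noteq> c" "a \<noteq> c" and sh: "share_CM f g {a, b, c}"
  obtains \<alpha> where "\<alpha> holomorphic_on UNIV" "\<And>z. cubic a b c (g z) = exp (\<alpha> z) * cubic a b c (f z)"
proof -
  have hf: "(\<lambda>z. cubic a b c (f z)) holomorphic_on UNIV" unfolding cubic_def by (intro holomorphic_intros f)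
  have hg: "(\<lambda>z. cubic a b c (g z)) holomorphic_on UNIV" unfolding cubic_def by (intro holomorphic_intros g)
  obtain w1 where w1: "cubic a b c (f w1) \<noteq> 0"
    using entire_nonconstant_avoids_finite[OF f, of "{a, b, c}"] by (auto simp: cubic_eq_0_iff)
  obtain w2 where w2: "cubic a b c (g w2) \<noteq> 0"
    using entire_nonconstant_avoids_finite[OF g, of "{a, b, c}"] by (auto simp: cubic_eq_0_iff)
  obtain H where H: "H holomorphic_on UNIV" "\<And>z. cubic a b c (g z) = H z * cubic a b c (f z)"
    by (rule entire_quotient[OF hg hf w1])
       (use cubic_ratio_bound[OF f g dist sh] in \<open>auto simp: cubic_eq_0_iff\<close>)
  obtain H' where H': "H' holomorphic_on UNIV" "\<And>z. cubic a b c (f z) = H' z * cubic a b c (g z)"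
    by (rule entire_quotient[OF hf hg w2])
       (use cubic_ratio_bound[OF g f dist share_CM_sym[OF sh]] in \<open>auto simp: cubic_eq_0_iff\<close>)
  have "H z * H' z - 1 = 0" for z
  proof (rule entire_mult_eq_0[of "\<lambda>z. H z * H' z - 1" "\<lambda>z. cubic a b c (f z)" w1])
    show "(H z * H' z - 1) * cubic a b c (f z) = 0" for z
    proof -
      have "cubic a b c (f z) = H' z * (H z * cubic a b c (f z))" using H(2)[of z] H'(2)[of z] by simp
      thus ?thesis by (simp add: algebra_simps)
    qed
  qed (use w1 in \<open>auto intro!: holomorphic_intros H H' hf\<close>)
  hence nz: "H z \<noteq> 0" for z by (metis mult_zero_left diff_0 neg_equal_0_iff_equal zero_neq_one)
  show thesis
  proof (rule contractible_imp_holomorphic_log[OF H(1) convex_imp_contractible[OF convex_UNIV] nz])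
    fix \<alpha> assume "\<alpha> holomorphic_on UNIV" and \<alpha>: "\<And>z. z \<in> UNIV \<Longrightarrow> H z = exp (\<alpha> z)"
    thus thesis using H(2) by (intro that[of \<alpha>]) auto
  qed
qed

lemma cubic_upper: "norm (cubic a b c x) \<le> (1 + norm a) * (1 + norm b) * (1 + norm c) * (1 + norm x) ^ 3"
proof -
  have *: "norm (x - s) \<le> (1 + norm s) * (1 + norm x)" for s
  proof -
    have "(1 + norm s) * (1 + norm x) = 1 + norm s + norm x + norm s * norm x" by (simp add: algebra_simps)
    moreover have "0 \<le> norm s * norm x" by simp
    ultimately show ?thesis using norm_triangle_ineq4[of x s] by linarith
  qed
  have "norm (cubic a b c x) \<le> ((1 + norm a) * (1 + norm x)) * ((1 + norm b) * (1 + norm x)) * ((1 + norm c) * (1 + norm x))"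
    unfolding cubic_def norm_mult using * by (intro mult_mono mult_nonneg_nonneg) auto
  thus ?thesis by (simp add: power3_eq_cube mult_ac)
qed

lemma power_le_fact_exp: "0 \<le> x \<Longrightarrow> x ^ n \<le> fact n * exp (x::real)"
proof -
  assume x: "0 \<le> x"
  have "(\<Sum>i\<in>{n}. x ^ i /\<^sub>R fact i) \<le> (\<Sum>i. x ^ i /\<^sub>R fact i)"
    by (rule sum_le_suminf[OF summable_exp_generic]) (use x in auto)
  hence "x ^ n / fact n \<le> exp x" by (simp add: exp_def divide_inverse mult.commute)
  thus ?thesis by (simp add: field_simps)
qed

section \<open>A non-constant linear exponent is impossible\<close>

lemma polynomial_growth_deriv_constant:
  assumes f: "f holomorphic_on UNIV" and b: "\<And>z. norm (f z) \<le> B * (1 + norm z) ^ k"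
  shows "(deriv ^^ k) f constant_on UNIV"
proof (rule Liouville_theorem)
  show "(deriv ^^ k) f holomorphic_on UNIV" by (rule holomorphic_higher_deriv[OF f open_UNIV])
  have B0: "0 \<le> B" using order_trans[OF norm_ge_zero b[of 0]] by simp
  have "norm ((deriv ^^ k) f z) \<le> fact k * B * 2 ^ k" for z
  proof -
    define r where "r = 1 + norm z"
    have r: "0 < r" by (simp add: r_def add_pos_nonneg)
    have "norm ((deriv ^^ k) f z) \<le> fact k * (B * (2 * r) ^ k) / r ^ k"
    proof (rule Cauchy_bound_sub[of f "cball z r" z r])
      show "f holomorphic_on cball z r" using f holomorphic_on_subset by blast
      fix w assume "w \<in> cball z r"
      hence "norm w \<le> norm z + r" using norm_triangle_sub[of w z] by (simp add: dist_norm norm_minus_commute)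
      hence "1 + norm w \<le> 2 * r" by (simp add: r_def)
      hence "B * (1 + norm w) ^ k \<le> B * (2 * r) ^ k" using B0 by (intro mult_left_mono power_mono) auto
      thus "norm (f w) \<le> B * (2 * r) ^ k" using b[of w] by linarith
    qed (use r in auto)
    also have "\<dots> = fact k * B * 2 ^ k" using r by (simp add: power_mult_distrib)
    finally show ?thesis .
  qed
  thus "bounded (range ((deriv ^^ k) f))" unfolding bounded_iff by blast
qed

text \<open>For W known to be non-constant this forces \<gamma> = 0. The plane is divided by the
  size of x = Re (\<gamma> z + d): a right half-plane where f is bounded, a strip that is crossed
  with the growth estimate, and a left half-plane where W is small compared with f.\<close>

lemma exp_relation_nonconstant_imp_deriv_constant:
  assumes f: "f holomorphic_on UNIV" and k: "0 < k" and K: "0 < K"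
    and gr: "\<And>w z. 1 + norm (f z) \<le> exp (K * dist w z + 1) * (1 + norm (f w))"
    and \<gamma>: "\<gamma> \<noteq> 0"
    and rel: "\<And>z. cubic a b c ((deriv ^^ k) f z) = exp (\<gamma> * z + d) * cubic a b c (f z)"
  shows "(deriv ^^ k) f constant_on UNIV"
proof -
  define W where "W = (deriv ^^ k) f"
  define C where "C = (\<lambda>n. fact n * exp (K + 1))"
  have derb: "norm ((deriv ^^ n) f z) \<le> C n * (1 + norm (f z))" for n z
    unfolding C_def by (rule higher_deriv_le_of_growth[OF f gr K])
  define x where "x = (\<lambda>z. Re (\<gamma> * z + d))"
  define l where "l = norm \<gamma>"
  have l: "0 < l" using \<gamma> by (simp add: l_def)
  \<comment> \<open>The unit direction of steepest increase of \<open>x\<close>, which grows at rate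
    \<open>l\<close> along it.\<close>
  define e where "e = cnj \<gamma> / of_real l"
  have ne: "norm e = 1" using l by (simp add: e_def norm_divide l_def)
  have "\<gamma> * e = of_real (l\<^sup>2) / of_real l"
    by (simp only: e_def l_def complex_norm_square times_divide_eq_right)
  hence ge: "\<gamma> * e = of_real l" using l by (simp add: power2_eq_square)
  have xe: "x (z + of_real t * e) = x z + t * l" for z t
  proof -
    have "\<gamma> * (z + of_real t * e) + d = (\<gamma> * z + d) + of_real t * (\<gamma> * e)" by (simp add: algebra_simps)
    thus ?thesis unfolding x_def ge by simp
  qed
  define R where "R = 2 * norm a + 2 * norm b + 2 * norm c + 1"
  have R: "1 \<le> R" by (simp add: R_def)
  define \<sigma> where "\<sigma> = (1 + norm a) * (1 + norm b) * (1 + norm c)"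
  have \<sigma>: "0 < \<sigma>" by (auto simp: \<sigma>_def intro!: mult_pos_pos add_pos_nonneg)
  have up: "norm (cubic a b c y) \<le> \<sigma> * (1 + norm y) ^ 3" for y unfolding \<sigma>_def by (rule cubic_upper)
  have low: "norm y ^ 3 \<le> 8 * norm (cubic a b c y)" if "R \<le> norm y" for y
    by (rule cubic_lower) (use that in \<open>simp add: R_def\<close>)
  have nrel: "norm (cubic a b c (W z)) = exp (x z) * norm (cubic a b c (f z))" for z
    using arg_cong[OF rel[of z], of norm] by (simp add: norm_mult x_def W_def)
  define A where "A = ln (8 * \<sigma> * (1 + 2 * C k) ^ 3)"
  have Ck: "0 < C k" by (simp add: C_def)
  \<comment> \<open>Where |f| \<ge> R, |P(f)| is at least |f|^3 / 8, while |W| = O(|f|) makes P(W)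
    at most a fixed multiple of |f|^3; so exp x is at most exp A there.\<close>
  have right: "norm (f z) < R" if xz: "A < x z" for z
  proof (rule ccontr)
    assume "\<not> norm (f z) < R"
    hence big: "R \<le> norm (f z)" by simp
    define y where "y = norm (f z)"
    have y: "1 \<le> y" using big R by (simp add: y_def)
    have W1: "1 + norm (W z) \<le> (1 + 2 * C k) * y"
    proof -
      have "norm (W z) \<le> C k * (1 + y)" using derb[of k z] by (simp add: W_def y_def)
      also have "\<dots> \<le> C k * (2 * y)" using Ck y by (intro mult_left_mono) auto
      finally show ?thesis using y by (simp add: algebra_simps)
    qed
    have "exp (x z) * y ^ 3 \<le> exp (x z) * (8 * norm (cubic a b c (f z)))"
      using low[OF big] by (intro mult_left_mono) (auto simp: y_def)
    also have "\<dots> = 8 * norm (cubic a b c (W z))" by (simp add: nrel)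
    also have "\<dots> \<le> 8 * (\<sigma> * (1 + norm (W z)) ^ 3)" using up by simp
    also have "\<dots> \<le> 8 * (\<sigma> * ((1 + 2 * C k) * y) ^ 3)"
      using W1 \<sigma> by (intro mult_left_mono power_mono) auto
    also have "\<dots> = (8 * \<sigma> * (1 + 2 * C k) ^ 3) * y ^ 3" by (simp add: power_mult_distrib)
    also have "8 * \<sigma> * (1 + 2 * C k) ^ 3 = exp A"
      unfolding A_def using \<sigma> Ck by (subst exp_ln) (auto intro!: mult_pos_pos zero_less_power add_pos_nonneg)
    finally have "exp (x z) \<le> exp A" using y by (simp add: mult_le_cancel_right)
    thus False using xz by simp
  qed
  \<comment> \<open>The 2 is the cube root of the 8 in \<open>cubic_lower\<close>, and 1 + \<sigma>
    dominates the cube root of \<sigma>.\<close>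
  define C1 where "C1 = 2 * (1 + \<sigma>)"
  have C1: "0 < C1" using \<sigma> by (simp add: C1_def)
  have Wle: "norm (W z) \<le> R + C1 * exp (x z / 3) * (1 + norm (f z))" for z
  proof (cases "R \<le> norm (W z)")
    case True
    have s3: "\<sigma> \<le> (1 + \<sigma>) ^ 3"
      using \<sigma> self_le_power[of "1 + \<sigma>" 3] by simp
    have "norm (W z) ^ 3 \<le> 8 * norm (cubic a b c (W z))" by (rule low[OF True])
    also have "\<dots> = 8 * (exp (x z) * norm (cubic a b c (f z)))" by (simp add: nrel)
    also have "\<dots> \<le> 8 * (exp (x z) * (\<sigma> * (1 + norm (f z)) ^ 3))" using up by (intro mult_left_mono) auto
    also have "\<dots> \<le> 8 * (exp (x z) * ((1 + \<sigma>) ^ 3 * (1 + norm (f z)) ^ 3))"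
      using s3 by (intro mult_left_mono mult_right_mono) auto
    also have "exp (x z) = exp (x z / 3) ^ 3" by (simp flip: exp_of_nat_mult)
    also have "8 * (exp (x z / 3) ^ 3 * ((1 + \<sigma>) ^ 3 * (1 + norm (f z)) ^ 3)) = (C1 * exp (x z / 3) * (1 + norm (f z))) ^ 3"
      unfolding C1_def by algebra
    finally have "norm (W z) ^ 3 \<le> (C1 * exp (x z / 3) * (1 + norm (f z))) ^ 3" .
    moreover have "0 \<le> C1 * exp (x z / 3) * (1 + norm (f z))" using C1 by (intro mult_nonneg_nonneg) auto
    ultimately have "norm (W z) \<le> C1 * exp (x z / 3) * (1 + norm (f z))"
      by (subst (asm) power_mono_iff) auto
    thus ?thesis using R by simp
  next
    case False
    have "0 \<le> C1 * exp (x z / 3) * (1 + norm (f z))" using C1 by (intro mult_nonneg_nonneg) auto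
    thus ?thesis using False by simp
  qed
  define Bk where "Bk = fact k * (3 / l) ^ k * exp (l / 3)"
  have Bk: "0 < Bk" using l by (simp add: Bk_def)
  have expk: "(1 + s) ^ k \<le> Bk * exp (l * s / 3)" if s: "0 \<le> s" for s
  proof -
    have "(l / 3 * (1 + s)) ^ k \<le> fact k * exp (l / 3 * (1 + s))" by (rule power_le_fact_exp) (use l s in simp)
    hence "(3 / l) ^ k * (l / 3 * (1 + s)) ^ k \<le> (3 / l) ^ k * (fact k * exp (l / 3 * (1 + s)))"
      using l by (intro mult_left_mono) auto
    also have "(3 / l) ^ k * (l / 3 * (1 + s)) ^ k = (3 / l * (l / 3 * (1 + s))) ^ k" by (simp only: power_mult_distrib)
    also have "3 / l * (l / 3 * (1 + s)) = 1 + s" using l by (simp add: field_simps)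
    also have "(3 / l) ^ k * (fact k * exp (l / 3 * (1 + s))) = Bk * exp (l * s / 3)"
      by (simp add: Bk_def distrib_left exp_add)
    finally show ?thesis .
  qed
  \<comment> \<open>At depth s to the left of the line x = - T, the factor of 1 + |f| in
    \<open>Wle\<close> is to be at most 1 / 2 even after multiplication by (1 + s)^k. The decay exp
    (- l s / 3) absorbs this weight at the cost of the constant \<open>Bk\<close>, and exp (- T / 3)
    absorbs the constants.\<close>
  define T where "T = \<bar>A\<bar> + 1 + 3 * \<bar>ln (2 * C1 * Bk)\<bar>"
  have T: "0 \<le> A + 1 + T" by (simp add: T_def)
  have small: "C1 * exp ((- T - l * s) / 3) * (1 + s) ^ k \<le> 1 / 2" if s: "0 \<le> s" for s
  proof -
    have "C1 * exp ((- T - l * s) / 3) * (1 + s) ^ k \<le> C1 * exp ((- T - l * s) / 3) * (Bk * exp (l * s / 3))"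
      using C1 expk[OF s] by (intro mult_left_mono) auto
    also have "\<dots> = (C1 * Bk) * (exp ((- T - l * s) / 3) * exp (l * s / 3))" by simp
    also have "exp ((- T - l * s) / 3) * exp (l * s / 3) = exp (- T / 3)"
      by (simp add: diff_divide_distrib flip: exp_add)
    also have "(C1 * Bk) * exp (- T / 3) \<le> (C1 * Bk) * exp (- ln (2 * C1 * Bk))"
      using C1 Bk by (intro mult_left_mono) (auto simp: T_def)
    also have "\<dots> = 1 / 2" using C1 Bk by (simp add: exp_minus field_simps)
    finally show ?thesis .
  qed
  define B where "B = exp (K * ((A + 1 + T) / l) + 1) * (1 + R)"
  have B0: "0 \<le> B" using R by (simp add: B_def)
  have strip: "norm (f z) \<le> B" if z: "- T \<le> x z" "x z \<le> A + 1" for z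
  proof -
    define L where "L = (A + 1 - x z) / l"
    have L: "0 \<le> L" "L \<le> (A + 1 + T) / l" using z l by (auto simp: L_def intro: divide_right_mono)
    have "x (z + of_real L * e) = A + 1" unfolding xe using l by (simp add: L_def)
    hence fw: "norm (f (z + of_real L * e)) < R" by (intro right) simp
    have "dist (z + of_real L * e) z = L" using L ne by (simp add: dist_norm norm_mult)
    hence "1 + norm (f z) \<le> exp (K * L + 1) * (1 + norm (f (z + of_real L * e)))"
      using gr[of z "z + of_real L * e"] by simp
    also have "\<dots> \<le> exp (K * ((A + 1 + T) / l) + 1) * (1 + R)"
      using fw mult_left_mono[OF L(2), of K] K by (intro mult_mono) auto
    finally show ?thesis by (simp add: B_def)
  qed
  define B' where "B' = C k * (1 + B)"
  define Q where "Q = 2 * real k * B' + 2 * R + 1"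
  have B'0: "0 \<le> B'" using B0 Ck by (simp add: B'_def)
  \<comment> \<open>Bootstrap along the ray from w to z: if q is the maximum of |f| / (1 + s)^k
    there, then |W| \<le> R + (1 + q) / 2. Taylor's formula of order k at w returns q \<le> R + (1 +
    q) / 2 + k B', so q \<le> Q, independently of the length of the ray.\<close>
  have left: "norm (f z) \<le> Q * (1 + (- T - x z) / l) ^ k" if xz: "x z \<le> - T" for z
  proof -
    define t where "t = (- T - x z) / l"
    have t: "0 \<le> t" using xz l by (simp add: t_def)
    define w where "w = z + of_real t * e"
    have xw: "x w = - T" unfolding w_def xe using l by (simp add: t_def)
    have fw: "norm (f w) \<le> B" by (rule strip) (use xw T in auto)
    define p where "p = (\<lambda>s. w - of_real s * e)"
    have xp: "x (p s) = - T - l * s" for s using xe[of w "- s"] xw by (simp add: p_def mult.commute)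
    have pt: "p t = z" by (simp add: p_def w_def)
    have cont: "continuous_on {0..t} (\<lambda>s. norm (f (p s)) / (1 + s) ^ k)"
      unfolding p_def
      by (intro continuous_intros continuous_on_compose2[of UNIV f "{0..t}"] holomorphic_on_imp_continuous_on[OF f]) auto
    obtain s0 where s0: "s0 \<in> {0..t}"
      "\<And>s. s \<in> {0..t} \<Longrightarrow> norm (f (p s)) / (1 + s) ^ k \<le> norm (f (p s0)) / (1 + s0) ^ k"
      using continuous_attains_sup[OF compact_Icc _ cont] t by auto
    define q where "q = norm (f (p s0)) / (1 + s0) ^ k"
    have q0: "0 \<le> q" using s0(1) by (simp add: q_def)
    have fq: "norm (f (p s)) \<le> q * (1 + s) ^ k" if s: "s \<in> {0..t}" for s
    proof -
      have "0 < (1 + s) ^ k" using s by (intro zero_less_power) auto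
      thus ?thesis using s0(2)[OF s] by (simp add: q_def pos_divide_le_eq)
    qed
    have Wq: "norm (W (p s)) \<le> R + (1 + q) / 2" if s: "s \<in> {0..t}" for s
    proof -
      have one: "1 \<le> (1 + s) ^ k" using s by (intro one_le_power) auto
      have "1 + norm (f (p s)) \<le> (1 + s) ^ k * (1 + q)" using fq[OF s] one by (simp add: algebra_simps)
      hence "C1 * exp (x (p s) / 3) * (1 + norm (f (p s))) \<le> C1 * exp (x (p s) / 3) * ((1 + s) ^ k * (1 + q))"
        using C1 by (intro mult_left_mono) auto
      also have "\<dots> = (C1 * exp ((- T - l * s) / 3) * (1 + s) ^ k) * (1 + q)" by (simp add: xp)
      also have "\<dots> \<le> 1 / 2 * (1 + q)" using small[of s] s q0 by (intro mult_right_mono) auto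
      finally have "C1 * exp (x (p s) / 3) * (1 + norm (f (p s))) \<le> (1 + q) / 2" by simp
      thus ?thesis using Wle[of "p s"] by linarith
    qed
    define y where "y = p s0"
    have nyw: "norm (y - w) = s0" using s0(1) ne by (simp add: y_def p_def norm_mult)
    have seg: "\<exists>s\<in>{0..t}. v = p s" if vs: "v \<in> closed_segment w y" for v
    proof -
      obtain u where u: "0 \<le> u" "u \<le> 1" "v = (1 - u) *\<^sub>R w + u *\<^sub>R y" using vs by (auto simp: closed_segment_def)
      have "v = p (u * s0)" unfolding u(3) y_def p_def by (simp add: algebra_simps scaleR_conv_of_real)
      moreover have "u * s0 \<le> 1 * s0" using u s0(1) by (intro mult_right_mono) auto
      hence "u * s0 \<in> {0..t}" using u s0(1) by auto
      ultimately show ?thesis by blast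
    qed
    obtain n where n: "k = Suc n" using k by (cases k) auto
    have "norm ((deriv ^^ 0) f y - (\<Sum>i\<le>n. (deriv ^^ i) f w * (y - w) ^ i / fact i))
        \<le> (R + (1 + q) / 2) * norm (y - w) ^ Suc n / fact n"
    proof (rule complex_Taylor[of "closed_segment w y"])
      show "((deriv ^^ i) f has_field_derivative (deriv ^^ Suc i) f v) (at v within closed_segment w y)" for i v
        by (rule has_field_derivative_at_within[OF has_field_derivative_higher_deriv[OF f open_UNIV UNIV_I]])
      show "norm ((deriv ^^ Suc n) f v) \<le> R + (1 + q) / 2" if v: "v \<in> closed_segment w y" for v
        using seg[OF v] Wq by (auto simp: W_def n)
    qed auto
    hence "norm (f y - (\<Sum>i\<le>n. (deriv ^^ i) f w * (y - w) ^ i / fact i)) \<le> (R + (1 + q) / 2) * s0 ^ k / fact n"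
      by (simp add: nyw n)
    also have "\<dots> \<le> (R + (1 + q) / 2) * s0 ^ k / 1"
      using R q0 s0(1) by (intro divide_left_mono mult_nonneg_nonneg) (auto simp: fact_ge_1)
    also have "\<dots> \<le> (R + (1 + q) / 2) * (1 + s0) ^ k"
      using R q0 s0(1) by (auto intro!: mult_left_mono power_mono)
    finally have 1: "norm (f y - (\<Sum>i\<le>n. (deriv ^^ i) f w * (y - w) ^ i / fact i)) \<le> (R + (1 + q) / 2) * (1 + s0) ^ k" .
    have "norm (\<Sum>i\<le>n. (deriv ^^ i) f w * (y - w) ^ i / fact i) \<le> (\<Sum>i\<le>n. B' * (1 + s0) ^ k)"
    proof (rule sum_norm_le)
      fix i assume i: "i \<in> {..n}"
      have "norm ((deriv ^^ i) f w) \<le> C i * (1 + norm (f w))" by (rule derb)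
      also have "\<dots> \<le> C k * (1 + B)"
      proof (rule mult_mono)
        have "(fact i :: real) \<le> fact k" by (rule fact_mono) (use i n in simp)
        thus "C i \<le> C k" unfolding C_def by (rule mult_right_mono) simp
      qed (use fw Ck in auto)
      finally have d: "norm ((deriv ^^ i) f w) \<le> B'" by (simp add: B'_def)
      have "norm ((y - w) ^ i / fact i) = s0 ^ i / fact i" by (simp add: norm_divide norm_power nyw)
      also have "\<dots> \<le> s0 ^ i / 1" using s0(1) by (intro divide_left_mono) (auto simp: fact_ge_1)
      also have "\<dots> \<le> (1 + s0) ^ i" using s0(1) by (auto intro!: power_mono)
      also have "\<dots> \<le> (1 + s0) ^ k" using s0(1) i by (intro power_increasing) (auto simp: n)
      finally have "norm ((y - w) ^ i / fact i) \<le> (1 + s0) ^ k" .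
      with d have "norm ((deriv ^^ i) f w) * norm ((y - w) ^ i / fact i) \<le> B' * (1 + s0) ^ k"
        using B'0 by (intro mult_mono) auto
      thus "norm ((deriv ^^ i) f w * (y - w) ^ i / fact i) \<le> B' * (1 + s0) ^ k"
        by (simp add: norm_mult norm_divide)
    qed
    also have "\<dots> = real k * B' * (1 + s0) ^ k" by (simp add: n)
    finally have "norm (f y) \<le> (R + (1 + q) / 2) * (1 + s0) ^ k + real k * B' * (1 + s0) ^ k"
      using 1 norm_triangle_ineq[of "f y - (\<Sum>i\<le>n. (deriv ^^ i) f w * (y - w) ^ i / fact i)"
        "(\<Sum>i\<le>n. (deriv ^^ i) f w * (y - w) ^ i / fact i)"] by simp
    also have "\<dots> = (R + (1 + q) / 2 + real k * B') * (1 + s0) ^ k" by (simp add: algebra_simps)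
    finally have "q \<le> R + (1 + q) / 2 + real k * B'"
      using s0(1) unfolding q_def y_def[symmetric] by (subst pos_divide_le_eq) auto
    hence "q \<le> Q" by (simp add: Q_def field_simps)
    hence "q * (1 + t) ^ k \<le> Q * (1 + t) ^ k" using t by (intro mult_right_mono) auto
    moreover have "norm (f z) \<le> q * (1 + t) ^ k" using fq[of t] t by (simp add: pt)
    ultimately show ?thesis by (simp add: t_def)
  qed
  have Q0: "0 \<le> Q" using B'0 R by (simp add: Q_def)
  define Z where "Z = Q * (1 + norm d / l) ^ k + B + R"
  have "norm (f z) \<le> Z * (1 + norm z) ^ k" for z
  proof -
    have one: "1 \<le> (1 + norm z) ^ k" by (intro one_le_power) auto
    have P0: "0 \<le> Q * (1 + norm d / l) ^ k" using Q0 l by simp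
    consider "x z \<le> - T" | "- T \<le> x z" "x z \<le> A + 1" | "A < x z" by linarith
    thus ?thesis
    proof cases
      case 1
      have "- x z \<le> norm (\<gamma> * z + d)" unfolding x_def using abs_Re_le_cmod[of "\<gamma> * z + d"] by linarith
      also have "\<dots> \<le> l * norm z + norm d" using norm_triangle_ineq[of "\<gamma> * z" d] by (simp add: norm_mult l_def)
      finally have "- T - x z \<le> l * norm z + norm d" by (simp add: T_def)
      hence "(- T - x z) / l \<le> (l * norm z + norm d) / l" using l by (intro divide_right_mono) auto
      also have "\<dots> = norm z + norm d / l" using l by (simp add: field_simps)
      finally have a0: "(- T - x z) / l \<le> norm z + norm d / l" .
      have a: "1 + (- T - x z) / l \<le> (1 + norm d / l) * (1 + norm z)"
      proof -
        have "(1 + norm d / l) * (1 + norm z) = 1 + norm z + norm d / l + norm d / l * norm z" by (simp add: algebra_simps add_divide_distrib)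
        moreover have "0 \<le> norm d / l * norm z" using l by simp
        ultimately show ?thesis using a0 by linarith
      qed
      have nn: "0 \<le> 1 + (- T - x z) / l" using 1 l by simp
      have "norm (f z) \<le> Q * (1 + (- T - x z) / l) ^ k" by (rule left[OF 1])
      also have "\<dots> \<le> Q * ((1 + norm d / l) * (1 + norm z)) ^ k"
        using a nn Q0 by (intro mult_left_mono power_mono) auto
      also have "\<dots> = (Q * (1 + norm d / l) ^ k) * (1 + norm z) ^ k" by (simp add: power_mult_distrib)
      also have "\<dots> \<le> Z * (1 + norm z) ^ k" using B0 R by (intro mult_right_mono) (auto simp: Z_def)
      finally show ?thesis .
    next
      case 2
      have "norm (f z) \<le> B" by (rule strip[OF 2])
      also have "\<dots> \<le> Z * 1" using P0 R by (simp add: Z_def)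
      also have "\<dots> \<le> Z * (1 + norm z) ^ k" using one P0 B0 R by (intro mult_left_mono) (auto simp: Z_def)
      finally show ?thesis .
    next
      case 3
      have "norm (f z) \<le> R" using right[OF 3] by simp
      also have "\<dots> \<le> Z * 1" using P0 B0 by (simp add: Z_def)
      also have "\<dots> \<le> Z * (1 + norm z) ^ k" using one P0 B0 R by (intro mult_left_mono) (auto simp: Z_def)
      finally show ?thesis .
    qed
  qed
  thus ?thesis by (rule polynomial_growth_deriv_constant[OF f])
qed

section \<open>The cubic relation\<close>

lemma Wronskian_zero_imp_proportional:
  assumes V: "V holomorphic_on UNIV" and v: "v holomorphic_on UNIV" and z0: "v z0 \<noteq> (0::complex)"
    and wr: "\<And>z. deriv V z * v z = V z * deriv v z"
  shows "\<exists>l. \<forall>z. V z = l * v z"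
proof -
  obtain r where r: "r > 0" "\<And>z. dist z0 z < r \<Longrightarrow> v z \<noteq> 0"
    using continuous_at_avoid[OF isCont_entire[OF v] z0] by blast
  have dV: "(V has_field_derivative deriv V z) (at z)" for z using holomorphic_derivI[OF V open_UNIV UNIV_I] .
  have dv: "(v has_field_derivative deriv v z) (at z)" for z using holomorphic_derivI[OF v open_UNIV UNIV_I] .
  have "\<exists>c. \<forall>z\<in>ball z0 r. V z / v z = c"
  proof (rule has_field_derivative_zero_constant)
    fix z assume "z \<in> ball z0 r"
    hence nz: "v z \<noteq> 0" using r(2) by simp
    have "((\<lambda>z. V z / v z) has_field_derivative (deriv V z * v z - V z * deriv v z) / (v z * v z)) (at z)"
      by (rule DERIV_divide[OF dV dv nz])
    hence "((\<lambda>z. V z / v z) has_field_derivative 0) (at z)" by (simp add: wr)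
    thus "((\<lambda>z. V z / v z) has_field_derivative 0) (at z within ball z0 r)"
      by (rule has_field_derivative_at_within)
  qed simp
  then obtain l where l: "\<And>z. z \<in> ball z0 r \<Longrightarrow> V z / v z = l" by blast
  have eq: "V z = l * v z" if "z \<in> ball z0 r" for z using l[OF that] r(2)[of z] that by (auto simp: field_simps)
  have "V z = l * v z" for z
    by (rule analytic_continuation_open[of "ball z0 r" UNIV V "\<lambda>z. l * v z"])
       (use r(1) eq V v in \<open>auto intro!: holomorphic_intros\<close>)
  thus ?thesis by blast
qed

text \<open>Where \<open>v\<close> is large, \<open>V / v\<close> is close to a cube root of \<open>A\<close> with error \<open>O(|v|\<^sup>-\<^sup>2)\<close>, so
  \<open>V' v - V v' = v\<^sup>2 (V / v)'\<close> stays bounded.\<close>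

lemma cubic_relation_Wronskian_bound:
  assumes V: "V holomorphic_on UNIV" and v: "v holomorphic_on UNIV" and A: "A \<noteq> (0::complex)"
    and rel: "\<And>z. (V z) ^ 3 + p * V z + q = A * ((v z) ^ 3 + p * v z + q)"
    and D: "1 \<le> D" "\<And>w. 1 \<le> norm (v w) \<Longrightarrow> norm (V w) \<le> D * norm (v w)"
    and \<kappa>: "0 < \<kappa>" and R: "0 < R" "1 \<le> \<kappa> * R"
    and low: "\<And>z w. R \<le> norm (v z) \<Longrightarrow> dist z w < 1 \<Longrightarrow> \<kappa> * norm (v z) \<le> norm (v w)"
  shows "\<exists>B. \<forall>z. R + sqrt (2 * B) \<le> norm (v z) \<longrightarrow> norm (deriv V z * v z - V z * deriv v z) \<le> B"
proof -
  \<comment> \<open>\<open>E\<close> collects what is left of the two cubics besides the leading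
    terms: |V^3 - A v^3| \<le> E |v| wherever |v| \<ge> 1.\<close>
  define E where "E = norm A * norm p + norm A * norm q + norm p * D + norm q"
  have E0: "0 \<le> E" using D by (simp add: E_def)
  \<comment> \<open>A lower bound for |V / v|^2 once |V / v|^3 \<ge> |A| / 2 is known.\<close>
  define m0 where "m0 = min 1 (norm A / 2)"
  have m0: "0 < m0" using A by (simp add: m0_def)
  define B where "B = 2 * E / \<kappa>\<^sup>2 / m0 + E / (\<kappa>\<^sup>2 * norm A)"
  have dV: "(V has_field_derivative deriv V z) (at z)" for z using holomorphic_derivI[OF V open_UNIV UNIV_I] .
  have dv: "(v has_field_derivative deriv v z) (at z)" for z using holomorphic_derivI[OF v open_UNIV UNIV_I] .
  have "norm (deriv V z * v z - V z * deriv v z) \<le> B" if z: "R + sqrt (2 * B) \<le> norm (v z)" for z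
  proof -
    have B0: "0 \<le> B" using E0 m0 by (simp add: B_def)
    have zR: "R \<le> norm (v z)" using z B0 by (smt (verit) real_sqrt_ge_zero mult_nonneg_nonneg)
    have y0: "0 < norm (v z)" using zR R by linarith
    have big: "1 \<le> norm (v w)" "\<kappa> * norm (v z) \<le> norm (v w)" if w: "w \<in> ball z 1" for w
    proof -
      show 2: "\<kappa> * norm (v z) \<le> norm (v w)" using low[OF zR] w by simp
      have "\<kappa> * R \<le> \<kappa> * norm (v z)" using zR \<kappa> by (intro mult_left_mono) auto
      thus "1 \<le> norm (v w)" using 2 R by linarith
    qed
    define \<phi> where "\<phi> = (\<lambda>w. (V w / v w) ^ 3 - A)"
    have nz: "v w \<noteq> 0" if w: "w \<in> ball z 1" for w using big(1)[OF w] by auto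
    have hol\<phi>: "\<phi> holomorphic_on ball z 1" unfolding \<phi>_def using nz
      by (intro holomorphic_intros holomorphic_on_subset[OF V] holomorphic_on_subset[OF v]) auto
    have \<phi>b: "norm (\<phi> w) \<le> E / (\<kappa> * norm (v z))\<^sup>2" if w: "w \<in> ball z 1" for w
    proof -
      define y where "y = norm (v w)"
      have y: "1 \<le> y" using big(1)[OF w] by (simp add: y_def)
      have "\<phi> w * (v w) ^ 3 = (V w) ^ 3 - A * (v w) ^ 3" using nz[OF w] by (simp add: \<phi>_def field_simps)
      also have "\<dots> = A * p * v w + A * q - p * V w - q" using rel[of w] by algebra
      finally have "norm (\<phi> w) * y ^ 3 = norm (A * p * v w + A * q - p * V w - q)"
        unfolding y_def by (metis norm_mult norm_power)
      also have "\<dots> \<le> norm (A * p * v w) + norm (A * q) + norm (p * V w) + norm q"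
        by (intro order_trans[OF norm_triangle_ineq4] order_trans[OF norm_triangle_ineq] add_mono order_refl)
      also have "\<dots> \<le> norm A * norm p * y + norm A * norm q * y + norm p * (D * y) + norm q * y"
        unfolding norm_mult y_def[symmetric]
        using D(2)[of w] y mult_left_mono[OF y, of "norm A * norm q"] mult_left_mono[OF y, of "norm q"]
        by (intro add_mono mult_left_mono) (auto simp: y_def)
      also have "\<dots> = E * y" by (simp add: E_def algebra_simps)
      finally have "y * (norm (\<phi> w) * y\<^sup>2) \<le> y * E" by (simp add: power2_eq_square power3_eq_cube mult_ac)
      hence "norm (\<phi> w) * y\<^sup>2 \<le> E" using y by (subst (asm) mult_le_cancel_left_pos) auto
      hence "norm (\<phi> w) \<le> E / y\<^sup>2" using y by (subst pos_le_divide_eq) auto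
      also have "\<dots> \<le> E / (\<kappa> * norm (v z))\<^sup>2"
        using big(2)[OF w] E0 y0 \<kappa> y by (intro divide_left_mono power_mono mult_pos_pos) (auto simp: y_def)
      finally show ?thesis .
    qed
    have "norm ((deriv ^^ 1) \<phi> z) \<le> fact 1 * (E / (\<kappa> * norm (v z))\<^sup>2) / (1 / 2) ^ 1"
      by (rule Cauchy_bound_sub[OF hol\<phi> _ _ \<phi>b]) auto
    hence d\<phi>: "norm (deriv \<phi> z) \<le> 2 * E / (\<kappa> * norm (v z))\<^sup>2" by (simp add: mult.commute)
    have vz: "v z \<noteq> 0" using y0 by auto
    define r where "r = V z / v z"
    \<comment> \<open>The derivative of \<phi> is 3 r^2 times the Wronskian divided by v^2, so
      Cauchy's bound O(|v|^(-2)) for it becomes a bound for the Wronskian.\<close>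
    have "(\<phi> has_field_derivative 3 * r\<^sup>2 * ((deriv V z * v z - V z * deriv v z) / (v z * v z))) (at z)"
    proof -
      have "((\<lambda>w. (V w / v w) ^ 3) has_field_derivative of_nat 3 * ((deriv V z * v z - V z * deriv v z) / (v z * v z) * (V z / v z) ^ (3 - Suc 0))) (at z)"
        by (rule DERIV_power[OF DERIV_divide[OF dV dv vz]])
      hence "((\<lambda>w. (V w / v w) ^ 3 - A) has_field_derivative of_nat 3 * ((deriv V z * v z - V z * deriv v z) / (v z * v z) * (V z / v z) ^ (3 - Suc 0)) - 0) (at z)"
        by (rule DERIV_diff[OF _ DERIV_const])
      thus ?thesis by (simp add: \<phi>_def r_def numeral_2_eq_2 mult_ac)
    qed
    from DERIV_imp_deriv[OF this]
    have "deriv \<phi> z * (v z)\<^sup>2 = 3 * r\<^sup>2 * (deriv V z * v z - V z * deriv v z)"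
      using vz by (simp add: power2_eq_square)
    hence "3 * (norm r)\<^sup>2 * norm (deriv V z * v z - V z * deriv v z) = norm (deriv \<phi> z) * (norm (v z))\<^sup>2"
      by (metis norm_mult norm_power norm_numeral)
    also have "\<dots> \<le> 2 * E / (\<kappa> * norm (v z))\<^sup>2 * (norm (v z))\<^sup>2" using d\<phi> by (intro mult_right_mono) auto
    also have "\<dots> = 2 * E / \<kappa>\<^sup>2" using y0 by (simp add: power_mult_distrib)
    finally have N1: "3 * (norm r)\<^sup>2 * norm (deriv V z * v z - V z * deriv v z) \<le> 2 * E / \<kappa>\<^sup>2" .
    \<comment> \<open>The threshold sqrt (2 B) makes the error |r^3 - A| at most |A| / 2 and so
      keeps r away from 0.\<close>
    have "sqrt (2 * B) \<le> norm (v z)" using z R by linarith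
    hence "2 * B \<le> (norm (v z))\<^sup>2" by (rule sqrt_le_D)
    moreover have "E / (\<kappa>\<^sup>2 * norm A) \<le> B" using E0 m0 by (simp add: B_def)
    ultimately have "2 * (E / (\<kappa>\<^sup>2 * norm A)) \<le> (norm (v z))\<^sup>2" by linarith
    hence "2 * E \<le> (norm (v z))\<^sup>2 * (\<kappa>\<^sup>2 * norm A)" using \<kappa> A by (simp add: pos_divide_le_eq)
    hence "E / (\<kappa> * norm (v z))\<^sup>2 \<le> norm A / 2"
      using \<kappa> y0 by (subst pos_divide_le_eq) (auto simp: power_mult_distrib mult_ac)
    moreover have "norm (r ^ 3 - A) \<le> E / (\<kappa> * norm (v z))\<^sup>2" using \<phi>b[of z] by (simp add: \<phi>_def r_def)
    ultimately have "norm (r ^ 3 - A) \<le> norm A / 2" by linarith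
    hence r3: "norm A / 2 \<le> norm r ^ 3" using norm_triangle_ineq2[of A "r ^ 3"] by (simp add: norm_minus_commute norm_power)
    have "m0 \<le> (norm r)\<^sup>2"
    proof (cases "1 \<le> norm r")
      case True thus ?thesis using one_le_power[OF True, of 2] min.cobounded1[of 1 "norm A / 2"] unfolding m0_def by linarith
    next
      case False
      hence "norm r ^ 3 \<le> norm r ^ 2" by (intro power_decreasing) auto
      thus ?thesis using r3 min.cobounded2[of 1 "norm A / 2"] unfolding m0_def by linarith
    qed
    hence "m0 \<le> 3 * (norm r)\<^sup>2" using m0 by linarith
    hence "m0 * norm (deriv V z * v z - V z * deriv v z) \<le> 3 * (norm r)\<^sup>2 * norm (deriv V z * v z - V z * deriv v z)"
      by (intro mult_right_mono) auto
    hence "m0 * norm (deriv V z * v z - V z * deriv v z) \<le> 2 * E / \<kappa>\<^sup>2" using N1 by linarith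
    hence "norm (deriv V z * v z - V z * deriv v z) \<le> 2 * E / \<kappa>\<^sup>2 / m0" using m0 by (subst pos_le_divide_eq) (auto simp: mult.commute)
    also have "\<dots> \<le> B" using E0 by (simp add: B_def)
    finally show ?thesis .
  qed
  thus ?thesis by blast
qed

lemma entire_square_eq_const_cases:
  assumes f: "f holomorphic_on UNIV" and g: "g holomorphic_on UNIV"
    and sq: "\<And>z. (f z)\<^sup>2 = \<gamma>\<^sup>2 * (g z :: complex)\<^sup>2"
  shows "(\<forall>z. f z = \<gamma> * g z) \<or> (\<forall>z. f z = - \<gamma> * g z)"
proof (rule ccontr)
  assume neg: "\<not> ?thesis"
  then obtain w where "f w \<noteq> - \<gamma> * g w" by blast
  hence w: "f w + \<gamma> * g w \<noteq> 0" by (simp add: eq_neg_iff_add_eq_0)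
  have "f z - \<gamma> * g z = 0" for z
  proof (rule entire_mult_eq_0[of "\<lambda>z. f z - \<gamma> * g z" "\<lambda>z. f z + \<gamma> * g z" w])
    show "(f z - \<gamma> * g z) * (f z + \<gamma> * g z) = 0" for z using sq[of z] by algebra
  qed (use w in \<open>auto intro!: holomorphic_intros f g\<close>)
  thus False using neg by simp
qed

lemma exp_solution:
  assumes y: "\<And>z. (y has_field_derivative c * y z) (at z)"
  shows "y z = y 0 * exp (c * z :: complex)"
proof -
  have "((\<lambda>z. y z * exp (- c * z)) has_field_derivative 0) (at z within UNIV)" for z
  proof -
    have "((\<lambda>z. exp (- c * z)) has_field_derivative exp (- c * z) * (- c)) (at z)"
      by (auto intro!: derivative_eq_intros)
    from DERIV_mult[OF y this] show ?thesis by (simp add: algebra_simps)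
  qed
  hence "\<exists>d. \<forall>z\<in>UNIV. y z * exp (- c * z) = d" by (intro has_field_derivative_zero_constant) auto
  then obtain d where d: "\<And>z. y z * exp (- c * z) = d" by blast
  have "y z * exp (- c * z) = y 0" using d[of z] d[of 0] by simp
  thus ?thesis by (simp add: exp_minus field_simps)
qed

text \<open>If \<open>f'' = \<rho>(f - s)\<close> and \<open>k\<close> is odd, \<open>f\<^sup>(\<^sup>k\<^sup>)\<close> is a multiple of \<open>f'\<close>; unless \<open>f'\<^sup>2 = \<rho>(f - s)\<^sup>2\<close>
  the substitution \<open>e\<^sup>\<gamma>\<^sup>z \<mapsto> const \<cdot> e\<^sup>-\<^sup>\<gamma>\<^sup>z\<close> fixes \<open>f\<close> and negates \<open>f'\<close>, so the cubic relation forces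
  \<open>f\<^sup>(\<^sup>k\<^sup>)\<close> to take finitely many values.\<close>

lemma second_order_affine:
  assumes f: "f holomorphic_on UNIV" and k: "0 < k" and nc: "\<not> (deriv ^^ k) f constant_on UNIV"
    and ode: "\<And>z. (deriv ^^ 2) f z = \<rho> * (f z - s)"
    and rel: "\<And>z. cubic a b c ((deriv ^^ k) f z) = A * cubic a b c (f z)"
  shows "\<exists>l m. \<forall>z. (deriv ^^ k) f z = l * f z + m"
proof -
  let ?D = "\<lambda>n. (deriv ^^ n) f"
  have dD: "(?D n has_field_derivative ?D (Suc n) z) (at z)" for n z
    by (rule has_field_derivative_higher_deriv[OF f open_UNIV UNIV_I])
  have holD: "?D n holomorphic_on UNIV" for n by (rule holomorphic_higher_deriv[OF f open_UNIV])
  have rec: "?D (n + 3) z = \<rho> * ?D (n + 1) z" for n z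
  proof (induction n arbitrary: z)
    case 0
    have "?D 2 = (\<lambda>z. \<rho> * (f z - s))" using ode by blast
    hence "?D 3 z = deriv (\<lambda>z. \<rho> * (f z - s)) z" by (simp add: numeral_3_eq_3 numeral_2_eq_2)
    also have "((\<lambda>z. \<rho> * (f z - s)) has_field_derivative \<rho> * ?D 1 z) (at z)"
      using dD[of 0 z] by (auto intro!: derivative_eq_intros)
    hence "deriv (\<lambda>z. \<rho> * (f z - s)) z = \<rho> * ?D 1 z" by (rule DERIV_imp_deriv)
    finally show ?case by simp
  next
    case (Suc n)
    have "?D (Suc n + 3) z = deriv (?D (n + 3)) z" by (simp only: add_Suc funpow.simps o_apply)
    also have "?D (n + 3) = (\<lambda>z. \<rho> * ?D (n + 1) z)" using Suc by blast
    also have "((\<lambda>z. \<rho> * ?D (n + 1) z) has_field_derivative \<rho> * ?D (Suc n + 1) z) (at z)"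
      using dD[of "n + 1" z] by (auto intro!: derivative_eq_intros)
    hence "deriv (\<lambda>z. \<rho> * ?D (n + 1) z) z = \<rho> * ?D (Suc n + 1) z" by (rule DERIV_imp_deriv)
    finally show ?case by simp
  qed
  have odd: "?D (2 * j + 1) z = \<rho> ^ j * ?D 1 z" for j z
  proof (induction j)
    case (Suc j)
    have "?D (2 * Suc j + 1) z = ?D (2 * j + 3) z" by (simp add: numeral_3_eq_3)
    also have "\<dots> = \<rho> * ?D (2 * j + 1) z" by (rule rec)
    finally show ?case using Suc by simp
  qed simp
  have even: "?D (2 * j + 2) z = \<rho> ^ j * (\<rho> * (f z - s))" for j z
  proof (induction j)
    case 0 show ?case using ode[of z] by (simp add: numeral_2_eq_2)
  next
    case (Suc j)
    have "?D (2 * Suc j + 2) z = ?D ((2 * j + 1) + 3) z" by (simp add: numeral_3_eq_3)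
    also have "\<dots> = \<rho> * ?D ((2 * j + 1) + 1) z" by (rule rec)
    finally show ?case using Suc by simp
  qed
  show ?thesis
  proof (cases "even k")
    case True
    then obtain i where i: "k = 2 * i" by (elim evenE)
    then obtain j where "i = Suc j" using k by (cases i) auto
    hence kj: "k = 2 * j + 2" using i by simp
    have "?D k z = \<rho> ^ Suc j * f z + (- (\<rho> ^ Suc j) * s)" for z
      unfolding kj even by (simp add: algebra_simps)
    thus ?thesis by blast
  next
    case False
    then obtain j where kj: "k = 2 * j + 1" by (elim oddE)
    define \<sigma> where "\<sigma> = \<rho> ^ j"
    have W: "?D k z = \<sigma> * ?D 1 z" for z unfolding kj odd \<sigma>_def ..
    have dv: "((\<lambda>z. f z - s) has_field_derivative ?D 1 z) (at z)" for z
      using dD[of 0 z] by (auto intro!: derivative_eq_intros)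
    have d1: "(?D 1 has_field_derivative \<rho> * (f z - s)) (at z)" for z
      using dD[of 1 z] ode[of z] by (simp add: numeral_2_eq_2)
    \<comment> \<open>The first integral of the equation. If its value \<tau> is 0, then f' itself
      is a multiple of f - s.\<close>
    have "((\<lambda>z. (?D 1 z)\<^sup>2 - \<rho> * (f z - s)\<^sup>2) has_field_derivative 0) (at z within UNIV)" for z
      by (rule derivative_eq_intros d1 dv refl)+ (simp add: algebra_simps)
    hence "\<exists>\<tau>. \<forall>z\<in>UNIV. (?D 1 z)\<^sup>2 - \<rho> * (f z - s)\<^sup>2 = \<tau>"
      by (intro has_field_derivative_zero_constant) auto
    then obtain \<tau> where \<tau>: "\<And>z. (?D 1 z)\<^sup>2 - \<rho> * (f z - s)\<^sup>2 = \<tau>" by blast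
    define \<gamma> where "\<gamma> = csqrt \<rho>"
    have \<gamma>: "\<gamma>\<^sup>2 = \<rho>" by (simp add: \<gamma>_def)
    have hv: "(\<lambda>z. f z - s) holomorphic_on UNIV" by (intro holomorphic_intros f)
    show ?thesis
    proof (cases "\<tau> = 0")
      case True
      have "(?D 1 z)\<^sup>2 = \<gamma>\<^sup>2 * (f z - s)\<^sup>2" for z using \<tau>[of z] True by (simp add: \<gamma>)
      from entire_square_eq_const_cases[OF holD hv this]
      obtain \<delta> where \<delta>: "\<And>z. ?D 1 z = \<delta> * (f z - s)" by (metis minus_mult_left)
      have "?D k z = (\<sigma> * \<delta>) * f z + (- (\<sigma> * \<delta>) * s)" for z unfolding W \<delta> by (simp add: algebra_simps)
      thus ?thesis by blast
    next
      case nz: False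
      have \<rho>0: "\<rho> \<noteq> 0"
      proof
        assume "\<rho> = 0"
        hence "(?D 1 has_field_derivative 0) (at z within UNIV)" for z using d1[of z] by simp
        hence "\<exists>d. \<forall>z\<in>UNIV. ?D 1 z = d" by (intro has_field_derivative_zero_constant) auto
        then obtain d where d: "\<And>z. ?D 1 z = d" by blast
        have "\<And>z. ?D k z = \<sigma> * d" unfolding W d by (rule refl)
        thus False using nc unfolding constant_on_def by blast
      qed
      hence \<gamma>0: "\<gamma> \<noteq> 0" using \<gamma> by auto
      \<comment> \<open>\<open>y1\<close> and \<open>y2\<close> are the two factors of the first
        integral. They are multiples of exp (- \<gamma> z) and exp (\<gamma> z), and their product
        \<tau> \<noteq> 0 keeps them from vanishing.\<close>
      define y1 where "y1 = (\<lambda>z. ?D 1 z - \<gamma> * (f z - s))"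
      define y2 where "y2 = (\<lambda>z. ?D 1 z + \<gamma> * (f z - s))"
      have "(y1 has_field_derivative (- \<gamma>) * y1 z) (at z)" for z
        unfolding y1_def \<gamma>[symmetric]
        by (rule derivative_eq_intros d1[unfolded \<gamma>[symmetric]] dv refl)+ (simp add: algebra_simps power2_eq_square)
      hence y1: "y1 z = y1 0 * exp (- \<gamma> * z)" for z by (rule exp_solution)
      have "(y2 has_field_derivative \<gamma> * y2 z) (at z)" for z
        unfolding y2_def
        by (rule derivative_eq_intros d1[unfolded \<gamma>[symmetric]] dv refl)+ (simp add: algebra_simps power2_eq_square)
      hence y2: "y2 z = y2 0 * exp (\<gamma> * z)" for z by (rule exp_solution)
      have y12: "y1 z * y2 z = \<tau>" for z
      proof -
        have "y1 z * y2 z = (?D 1 z)\<^sup>2 - \<gamma>\<^sup>2 * (f z - s)\<^sup>2"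
          by (simp add: y1_def y2_def algebra_simps power2_eq_square)
        thus ?thesis by (simp only: \<gamma> \<tau>)
      qed
      have n1: "y1 z \<noteq> 0" and n2: "y2 z \<noteq> 0" for z using y12[of z] nz by auto
      have mirror: "\<exists>z'. f z' = f z \<and> ?D k z' = - ?D k z" for z
      proof -
        \<comment> \<open>Chosen so that y2 z' = - y1 z. The constant product then gives y1 z' = -
          y2 z, which preserves y2 - y1 = 2 \<gamma> (f - s) and negates y2 + y1 = 2 f'.\<close>
        define z' where "z' = Ln (- y1 z / y2 0) / \<gamma>"
        have "exp (\<gamma> * z') = - y1 z / y2 0" using \<gamma>0 n1[of z] n2[of 0] by (simp add: z'_def)
        hence a: "y2 z' = - y1 z" using y2[of z'] n2[of 0] by simp
        have "y1 z' * y2 z' = y1 z * y2 z" by (simp only: y12)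
        hence "y1 z * (y1 z' + y2 z) = 0" unfolding a by algebra
        hence b: "y1 z' = - y2 z" using n1[of z] by (simp add: eq_neg_iff_add_eq_0)
        have v2: "2 * \<gamma> * (f w - s) = y2 w - y1 w" and D2: "2 * ?D 1 w = y2 w + y1 w" for w
          by (simp_all add: y1_def y2_def algebra_simps)
        have "2 * \<gamma> * (f z' - s) = 2 * \<gamma> * (f z - s)" by (simp only: v2 a b) simp
        hence "f z' = f z" using \<gamma>0 by simp
        moreover have "2 * ?D 1 z' = 2 * (- ?D 1 z)" by (simp only: mult_minus_right D2 a b) simp
        hence "?D 1 z' = - ?D 1 z" by simp
        ultimately show ?thesis by (auto simp: W)
      qed
      \<comment> \<open>Comparing P at W and - W leaves only the odd part of P, so every value of W
        is a root of x (x^2 + e2).\<close>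
      define e2 where "e2 = a * b + b * c + c * a"
      have "?D k z \<in> {0, csqrt (- e2), - csqrt (- e2)}" for z
      proof -
        obtain z' where z': "f z' = f z" "?D k z' = - ?D k z" using mirror by blast
        have "cubic a b c (?D k z) = cubic a b c (- ?D k z)" using rel[of z] rel[of z'] z' by simp
        moreover have "cubic a b c x - cubic a b c (- x) = 2 * (x * (x\<^sup>2 + e2))" for x
          unfolding cubic_def e2_def by algebra
        ultimately have "2 * (?D k z * ((?D k z)\<^sup>2 + e2)) = 0" by (metis right_minus_eq)
        hence "?D k z = 0 \<or> (?D k z)\<^sup>2 = (csqrt (- e2))\<^sup>2" by (auto simp: add_eq_0_iff)
        thus ?thesis unfolding power2_eq_iff by blast
      qed
      thus ?thesis using entire_nonconstant_avoids_finite[OF holD nc, of "{0, csqrt (- e2), - csqrt (- e2)}"] by blast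
    qed
  qed
qed

text \<open>The growth estimate is used in both directions: it bounds the derivatives by |f|, and
  with the points exchanged it keeps |v| large on a unit disc about a point where it is large. The
  shift by \<open>s\<close> removes the quadratic term of P, and this is what makes the error in (V
  / v)^3 of order |v|^(-2).\<close>

lemma cubic_relation_affine:
  assumes f: "f holomorphic_on UNIV" and nc: "\<not> f constant_on UNIV" and k: "0 < k" and K: "0 < K"
    and gr: "\<And>w z. 1 + norm (f z) \<le> exp (K * dist w z + 1) * (1 + norm (f w))"
    and ncW: "\<not> (deriv ^^ k) f constant_on UNIV" and A: "A \<noteq> 0"
    and rel: "\<And>z. cubic a b c ((deriv ^^ k) f z) = A * cubic a b c (f z)"
  shows "\<exists>l m. \<forall>z. (deriv ^^ k) f z = l * f z + m"
proof -
  let ?D = "\<lambda>n. (deriv ^^ n) f"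
  have dD: "(?D n has_field_derivative ?D (Suc n) z) (at z)" for n z
    by (rule has_field_derivative_higher_deriv[OF f open_UNIV UNIV_I])
  have holD: "?D n holomorphic_on UNIV" for n by (rule holomorphic_higher_deriv[OF f open_UNIV])
  define C where "C = fact (k + 2) * exp (K + 1)"
  have "(1::real) * 1 \<le> fact (k + 2) * exp (K + 1)"
    by (rule mult_mono) (use K in \<open>auto simp del: fact_Suc intro: fact_ge_1\<close>)
  hence C1: "1 \<le> C" by (simp only: C_def mult_1)
  have derb: "norm (?D n z) \<le> C * (1 + norm (f z))" if n: "n \<le> k + 2" for n z
  proof -
    have "(fact n :: real) \<le> fact (k + 2)" by (rule fact_mono[OF n])
    hence "fact n * exp (K + 1) * (1 + norm (f z)) \<le> C * (1 + norm (f z))"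
      unfolding C_def by (intro mult_right_mono) auto
    thus ?thesis using higher_deriv_le_of_growth[OF f gr K, of n z] by linarith
  qed
  define s where "s = (a + b + c) / 3"
  define p where "p = a * b + b * c + c * a - 3 * s\<^sup>2"
  define q where "q = cubic a b c s"
  have s3: "3 * s = a + b + c" by (simp add: s_def)
  have cub: "cubic a b c x = (x - s) ^ 3 + p * (x - s) + q" for x
    unfolding q_def p_def cubic_def using s3 by algebra
  define v where "v = (\<lambda>z. f z - s)"
  define V where "V = (\<lambda>z. ?D k z - s)"
  have hv: "v holomorphic_on UNIV" unfolding v_def by (intro holomorphic_intros f)
  have hV: "V holomorphic_on UNIV" unfolding V_def by (intro holomorphic_on_diff holD holomorphic_on_const)
  have "(v has_field_derivative ?D 1 z - 0) (at z)" for z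
    unfolding v_def by (rule DERIV_diff[OF _ DERIV_const]) (use dD[of 0 z] in simp)
  hence fdv: "(v has_field_derivative ?D 1 z) (at z)" for z by simp
  have "(V has_field_derivative ?D (Suc k) z - 0) (at z)" for z
    unfolding V_def by (rule DERIV_diff[OF dD DERIV_const])
  hence fdV: "(V has_field_derivative ?D (Suc k) z) (at z)" for z by simp
  have dv: "deriv v z = ?D 1 z" and dV: "deriv V z = ?D (Suc k) z" for z
    using DERIV_imp_deriv[OF fdv] DERIV_imp_deriv[OF fdV] by auto
  have rel': "(V z) ^ 3 + p * V z + q = A * ((v z) ^ 3 + p * v z + q)" for z
    using rel[of z] by (simp add: cub V_def v_def)
  have fv: "norm (f z) \<le> norm (v z) + norm s" "norm (v z) \<le> norm (f z) + norm s" for z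
    using norm_triangle_sub[of "f z" s] norm_triangle_ineq4[of "f z" s] by (auto simp: v_def)
  have Vle: "norm (V z) \<le> C * (1 + norm (f z)) + norm s" for z
    using derb[of k z] norm_triangle_ineq4[of "?D k z" s] by (simp add: V_def)
  define D where "D = C * (2 + norm s) + norm s"
  have D: "1 \<le> D" using mult_mono[of 1 C 1 "2 + norm s"] C1 norm_ge_zero[of s] unfolding D_def by linarith
  have VD: "norm (V w) \<le> D * norm (v w)" if w: "1 \<le> norm (v w)" for w
  proof -
    define y where "y = norm (v w)"
    have y: "1 \<le> y" using w by (simp add: y_def)
    have "1 + norm (f w) \<le> (1 + norm s) * 1 + y" using fv(1)[of w] by (simp add: y_def)
    also have "\<dots> \<le> (1 + norm s) * y + y" using y by (intro add_right_mono mult_left_mono) auto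
    also have "\<dots> = (2 + norm s) * y" by (simp add: algebra_simps)
    finally have "C * (1 + norm (f w)) \<le> C * ((2 + norm s) * y)" using C1 by (intro mult_left_mono) auto
    moreover have "norm s * 1 \<le> norm s * y" using y by (intro mult_left_mono) auto
    ultimately have "norm (V w) \<le> C * ((2 + norm s) * y) + norm s * y" using Vle[of w] by linarith
    also have "\<dots> = D * y" by (simp add: D_def algebra_simps)
    finally show ?thesis by (simp add: y_def)
  qed
  define \<kappa> where "\<kappa> = exp (- (K + 1)) / 2"
  have \<kappa>: "0 < \<kappa>" by (simp add: \<kappa>_def)
  \<comment> \<open>For |v z| \<ge> R the additive constants of the exchanged growth estimate cost
    at most half of 2 \<kappa> |v z|.\<close>
  define R where "R = (2 * \<kappa> * norm s + 1 + norm s) / \<kappa>"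
  have "0 \<le> 2 * \<kappa> * norm s" using \<kappa> by simp
  hence pos: "1 \<le> 2 * \<kappa> * norm s + 1 + norm s" using norm_ge_zero[of s] by linarith
  have \<kappa>R: "\<kappa> * R = 2 * \<kappa> * norm s + 1 + norm s" using \<kappa> by (simp add: R_def)
  have R: "0 < R" unfolding R_def using pos \<kappa> by (intro divide_pos_pos) linarith+
  have \<kappa>R1: "1 \<le> \<kappa> * R" unfolding \<kappa>R by (rule pos)
  have low: "\<kappa> * norm (v z) \<le> norm (v w)" if z: "R \<le> norm (v z)" and zw: "dist z w < 1" for z w
  proof -
    have "K * dist w z \<le> K * 1" using zw K by (intro mult_left_mono) (auto simp: dist_commute)
    hence "exp (K * dist w z + 1) * (1 + norm (f w)) \<le> exp (K + 1) * (1 + norm (f w))" by (intro mult_right_mono) auto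
    hence "1 + norm (f z) \<le> exp (K + 1) * (1 + norm (f w))" using gr[of z w] by linarith
    hence "exp (- (K + 1)) * (1 + norm (f z)) \<le> exp (- (K + 1)) * (exp (K + 1) * (1 + norm (f w)))"
      by (intro mult_left_mono) auto
    also have "\<dots> = (exp (- (K + 1)) * exp (K + 1)) * (1 + norm (f w))" by (simp only: mult.assoc)
    also have "exp (- (K + 1)) * exp (K + 1) = 1" by (simp flip: exp_add)
    finally have 1: "2 * \<kappa> * (1 + norm (f z)) \<le> 1 + norm (f w)" by (simp add: \<kappa>_def)
    have "2 * \<kappa> * (norm (v z) - norm s) \<le> 2 * \<kappa> * (1 + norm (f z))" using fv(2)[of z] \<kappa> by (intro mult_left_mono) auto
    hence 2: "2 * \<kappa> * norm (v z) - 2 * \<kappa> * norm s \<le> 1 + norm (v w) + norm s"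
      using 1 fv(1)[of w] by (simp add: right_diff_distrib)
    have "2 * \<kappa> * norm s + 1 + norm s \<le> \<kappa> * norm (v z)"
      using z \<kappa> by (simp add: R_def pos_divide_le_eq mult.commute)
    thus ?thesis using 2 by linarith
  qed
  define N where "N = (\<lambda>z. ?D (Suc k) z * v z - V z * ?D 1 z)"
  have "\<exists>B. \<forall>z. R + sqrt (2 * B) \<le> norm (v z) \<longrightarrow> norm (deriv V z * v z - V z * deriv v z) \<le> B"
    by (rule cubic_relation_Wronskian_bound[OF hV hv A rel' D VD \<kappa> R \<kappa>R1 low])
  then obtain B where B': "\<forall>z. R + sqrt (2 * B) \<le> norm (v z) \<longrightarrow> norm (deriv V z * v z - V z * deriv v z) \<le> B" ..
  have B: "norm (N z) \<le> B" if "R + sqrt (2 * B) \<le> norm (v z)" for z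
    using mp[OF spec[OF B'] that] unfolding N_def dv dV .
  have hN: "N holomorphic_on UNIV" unfolding N_def by (intro holomorphic_on_diff holomorphic_on_mult holD hv hV)
  have "N constant_on UNIV"
  \<comment> \<open>Where v is not large, f is bounded, and so are the derivatives that occur in
    \<open>N\<close>.\<close>
  proof (rule Liouville_theorem[OF hN])
    define R1 where "R1 = R + sqrt (2 * B)"
    define C2 where "C2 = C * (1 + R1 + norm s)"
    have "norm (N z) \<le> \<bar>B\<bar> + \<bar>C2 * R1 + (C2 + norm s) * C2\<bar>" for z
    proof (cases "R1 \<le> norm (v z)")
      case True thus ?thesis using B[of z] by (auto simp: R1_def)
    next
      case False
      have "1 + norm (f z) \<le> 1 + R1 + norm s" using fv(1)[of z] False by simp
      hence cc: "C * (1 + norm (f z)) \<le> C2" unfolding C2_def using C1 by (intro mult_left_mono) auto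
      have e: "norm (?D (Suc k) z) \<le> C2" "norm (?D 1 z) \<le> C2" "norm (V z) \<le> C2 + norm s"
        using derb[of "Suc k" z] derb[of 1 z] Vle[of z] cc by auto
      have "norm (N z) \<le> norm (?D (Suc k) z) * norm (v z) + norm (V z) * norm (?D 1 z)"
        unfolding N_def using norm_triangle_ineq4[of "?D (Suc k) z * v z" "V z * ?D 1 z"] by (simp only: norm_mult)
      also have "\<dots> \<le> C2 * R1 + (C2 + norm s) * C2"
        using e False order_trans[OF norm_ge_zero e(1)] order_trans[OF norm_ge_zero e(3)]
        by (intro add_mono mult_mono) auto
      finally show ?thesis by linarith
    qed
    thus "bounded (range N)" unfolding bounded_iff by blast
  qed
  then obtain n where Nn: "\<And>z. N z = n" unfolding constant_on_def by blast
  obtain z0 where z0: "v z0 \<noteq> 0" using nc unfolding constant_on_def v_def by auto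
  show ?thesis
  proof (cases "n = 0")
    case True
    have "deriv V z * v z = V z * deriv v z" for z using Nn[of z] True by (simp add: N_def dv dV)
    from Wronskian_zero_imp_proportional[OF hV hv z0 this] obtain l where l: "\<And>z. V z = l * v z" by blast
    have "?D k z = l * f z + (s - l * s)" for z using l[of z] by (simp add: V_def v_def algebra_simps)
    thus ?thesis by blast
  next
    case False
    \<comment> \<open>Derivative of the constant Wronskian: v and V have proportional second
      derivatives.\<close>
    have N0: "?D (Suc (Suc k)) z * v z = V z * ?D 2 z" for z
    proof -
      have "(N has_field_derivative (?D (Suc (Suc k)) z * v z + ?D 1 z * ?D (Suc k) z) - (?D (Suc k) z * ?D 1 z + ?D (Suc 1) z * V z)) (at z)"
        unfolding N_def by (intro DERIV_diff DERIV_mult dD fdv fdV)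
      moreover have "(N has_field_derivative 0) (at z)" using Nn by (simp add: fun_eq_iff[symmetric] ext[of N "\<lambda>_. n"])
      ultimately have "(?D (Suc (Suc k)) z * v z + ?D 1 z * ?D (Suc k) z) - (?D (Suc k) z * ?D 1 z + ?D (Suc 1) z * V z) = 0"
        by (rule DERIV_unique)
      thus ?thesis by (simp add: algebra_simps numeral_2_eq_2)
    qed
    \<comment> \<open>At a zero of v the non-zero Wronskian gives V \<noteq> 0, so f'' = (V'' / V) v
      near it and the quotient f'' / v stays bounded.\<close>
    obtain \<rho> where \<rho>: "\<rho> holomorphic_on UNIV" "\<And>z. ?D 2 z = \<rho> z * v z"
    proof (rule entire_quotient[OF holD hv z0, of 2])
      fix z assume vz: "v z = 0"
      hence Vz: "V z \<noteq> 0" using Nn[of z] False by (auto simp: N_def)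
      have "isCont (\<lambda>w. norm (?D (Suc (Suc k)) w / V w)) z"
        by (intro continuous_intros isCont_entire[OF holD] isCont_entire[OF hV] Vz)
      hence "((\<lambda>w. norm (?D (Suc (Suc k)) w / V w)) \<longlongrightarrow> norm (?D (Suc (Suc k)) z / V z)) (at z)" by (simp add: isCont_def)
      hence ev: "\<forall>\<^sub>F w in at z. norm (?D (Suc (Suc k)) w / V w) < norm (?D (Suc (Suc k)) z / V z) + 1"
        by (rule order_tendstoD) simp
      have "(V \<longlongrightarrow> V z) (at z)" using isCont_entire[OF hV] by (simp add: isCont_def)
      hence "\<forall>\<^sub>F w in at z. V w \<noteq> 0" using Vz by (rule tendsto_imp_eventually_ne)
      with ev have "\<forall>\<^sub>F w in at z. norm (?D 2 w) \<le> (norm (?D (Suc (Suc k)) z / V z) + 1) * norm (v w)"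
      proof eventually_elim
        case (elim w)
        have "?D 2 w = ?D (Suc (Suc k)) w / V w * v w" using N0[of w] elim by (simp add: field_simps)
        hence "norm (?D 2 w) = norm (?D (Suc (Suc k)) w / V w) * norm (v w)" by (simp only: norm_mult)
        also have "\<dots> \<le> (norm (?D (Suc (Suc k)) z / V z) + 1) * norm (v w)" using elim by (intro mult_right_mono) auto
        finally show ?case .
      qed
      thus "\<exists>C. \<forall>\<^sub>F w in at z. norm (?D 2 w) \<le> C * norm (v w)" by blast
    qed (rule that; assumption)
    have \<rho>V: "?D (Suc (Suc k)) z = \<rho> z * V z" for z
    proof -
      have "?D (Suc (Suc k)) z - \<rho> z * V z = 0"
      proof (rule entire_mult_eq_0[of "\<lambda>z. ?D (Suc (Suc k)) z - \<rho> z * V z" v z0])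
        show "(?D (Suc (Suc k)) z - \<rho> z * V z) * v z = 0" for z using N0[of z] \<rho>(2)[of z] by (simp add: algebra_simps)
      qed (use z0 in \<open>auto intro!: holomorphic_on_diff holomorphic_on_mult holD[of "Suc (Suc k)", simplified] \<rho> hV hv\<close>)
      thus ?thesis by simp
    qed
    have "\<rho> constant_on UNIV"
    proof (rule Liouville_theorem[OF \<rho>(1)])
      define D2 where "D2 = C * (2 + norm s) + norm s"
      have D2: "1 \<le> D2" using D unfolding D_def D2_def .
      define m1 where "m1 = norm n / (2 * D2)"
      have m1: "0 < m1" using False D2 by (simp add: m1_def)
      \<comment> \<open>Where |v| \<ge> 1, use \<rho> v = f'' = O(|v|). Elsewhere the products
        \<rho> v = f'' and \<rho> V = V'' are bounded by \<open>D2\<close>, and the non-zero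
        Wronskian n prevents v and V from both being smaller than \<open>m1\<close>.\<close>
      have "norm (\<rho> z) \<le> D2 + D2 / m1" for z
      proof (cases "1 \<le> norm (v z)")
        case True
        have "norm (\<rho> z) * norm (v z) = norm (?D 2 z)" by (simp only: \<rho>(2) norm_mult)
        also have "\<dots> \<le> C * (1 + norm (f z))" by (rule derb) simp
        also have "\<dots> \<le> C * ((2 + norm s) * norm (v z))"
        proof (rule mult_left_mono)
          have "1 + norm (f z) \<le> (1 + norm s) * 1 + norm (v z)" using fv(1)[of z] by simp
          also have "\<dots> \<le> (1 + norm s) * norm (v z) + norm (v z)" using True by (intro add_right_mono mult_left_mono) auto
          finally show "1 + norm (f z) \<le> (2 + norm s) * norm (v z)" by (simp add: algebra_simps)
        qed (use C1 in simp)
        finally have "norm (\<rho> z) * norm (v z) \<le> (C * (2 + norm s)) * norm (v z)" by (simp add: mult_ac)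
        hence "norm (\<rho> z) \<le> C * (2 + norm s)" by (rule mult_right_le_imp_le) (use True in linarith)
        also have "\<dots> \<le> D2" by (simp add: D2_def)
        finally show ?thesis using D2 m1 by (simp add: add_increasing2)
      next
        case v1: False
        have "C * (1 + norm (f z)) \<le> C * (2 + norm s)" using fv(1)[of z] v1 C1 by (intro mult_left_mono) auto
        moreover have "C * (2 + norm s) \<le> D2" by (simp add: D2_def)
        ultimately have "norm (?D i z) \<le> D2" if "i \<le> k + 2" for i using derb[OF that, of z] by linarith
        from this[of "Suc k"] this[of 1] this[of 2] this[of "Suc (Suc k)"]
        have e: "norm (?D (Suc k) z) \<le> D2" "norm (?D 1 z) \<le> D2" "norm (?D 2 z) \<le> D2"
          "norm (?D (Suc (Suc k)) z) \<le> D2" by auto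
        have "norm n \<le> norm (?D (Suc k) z) * norm (v z) + norm (V z) * norm (?D 1 z)"
          using norm_triangle_ineq4[of "?D (Suc k) z * v z" "V z * ?D 1 z"] Nn[of z] unfolding N_def by (simp only: norm_mult)
        also have "\<dots> \<le> D2 * norm (v z) + norm (V z) * D2" using e D2 by (intro add_mono mult_mono) auto
        finally have nn: "norm n \<le> D2 * (norm (v z) + norm (V z))" by (simp add: algebra_simps)
        have two: "norm n = 2 * (D2 * m1)" using D2 by (simp add: m1_def)
        have "m1 \<le> norm (v z) \<or> m1 \<le> norm (V z)"
        proof (rule ccontr)
          assume "\<not> ?thesis"
          hence "norm (v z) + norm (V z) < m1 + m1" by simp
          hence "D2 * (norm (v z) + norm (V z)) < D2 * (m1 + m1)" using D2 by (intro mult_strict_left_mono) auto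
          thus False using nn two by (simp add: algebra_simps)
        qed
        moreover have "norm (\<rho> z) \<le> D2 / m1" if y: "m1 \<le> norm y" "norm (\<rho> z * y) \<le> D2" for y :: complex
        proof -
          have "norm (\<rho> z) * m1 \<le> norm (\<rho> z) * norm y" using y(1) by (intro mult_left_mono) auto
          also have "\<dots> \<le> D2" using y(2) by (simp add: norm_mult)
          finally show ?thesis using m1 by (simp add: pos_le_divide_eq)
        qed
        ultimately have "norm (\<rho> z) \<le> D2 / m1" using e(3,4) unfolding \<rho>V \<rho>(2) by blast
        thus ?thesis using D2 by simp
      qed
      thus "bounded (range \<rho>)" unfolding bounded_iff by blast
    qed
    then obtain r where r: "\<And>z. \<rho> z = r" unfolding constant_on_def by blast
    have "?D 2 z = r * (f z - s)" for z unfolding \<rho>(2) r v_def ..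
    from second_order_affine[OF f k ncW this rel] show ?thesis .
  qed
qed

section \<open>Linear differential equations and the conclusion\<close>

lemma bij_betw_roots_theta:
  assumes k: "0 < k" and \<beta>: "\<beta> ^ k = l" and l: "l \<noteq> 0"
  shows "bij_betw (\<lambda>i. root_theta k ^ i * \<beta>) {..<k} {w. w ^ k = l}"
proof -
  have \<beta>0: "\<beta> \<noteq> 0" using \<beta> l k by auto
  have "bij_betw (\<lambda>i. root_theta k ^ i) {..<k} {w. w ^ k = 1}"
    using Complex.bij_betw_roots_unity[OF k] by (simp add: root_theta_def Complex.DeMoivre mult_ac)
  moreover have "bij_betw (\<lambda>w. w * \<beta>) {w. w ^ k = 1} {w. w ^ k = l}"
  proof (rule bij_betw_byWitness[where f' = "\<lambda>w. w / \<beta>"])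
    show "(\<lambda>w. w * \<beta>) ` {w. w ^ k = 1} \<subseteq> {w. w ^ k = l}" using \<beta> by (auto simp: power_mult_distrib)
    show "(\<lambda>w. w / \<beta>) ` {w. w ^ k = l} \<subseteq> {w. w ^ k = 1}" using \<beta> l by (auto simp: power_divide)
  qed (use \<beta>0 in auto)
  ultimately show ?thesis using bij_betw_trans by (fastforce simp: o_def)
qed

lemma root_theta_power_k: "0 < k \<Longrightarrow> root_theta k ^ k = 1"
  unfolding root_theta_def Complex.DeMoivre by simp

lemma exists_complex_root: "0 < k \<Longrightarrow> l \<noteq> 0 \<Longrightarrow> \<exists>\<beta>::complex. \<beta> ^ k = l"
  by (rule exI[of _ "exp (Ln l / of_nat k)"]) (simp flip: exp_of_nat_mult)

lemma sum_roots_inverse_power: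
  assumes k: "0 < k" and l: "l \<noteq> (0::complex)" and j: "j < k"
  shows "(\<Sum>w | w ^ k = l. inverse w ^ j) = (if j = 0 then of_nat k else 0)"
proof -
  obtain \<beta> where \<beta>: "\<beta> ^ k = l" using exists_complex_root[OF k l] by blast
  note bij = bij_betw_roots_theta[OF k \<beta> l]
  have \<beta>0: "\<beta> \<noteq> 0" using \<beta> l k by auto
  define t where "t = inverse (root_theta k ^ j)"
  have "(\<Sum>w | w ^ k = l. inverse w ^ j) = (\<Sum>i<k. inverse (root_theta k ^ i * \<beta>) ^ j)"
    by (rule sum.reindex_bij_betw[OF bij, symmetric])
  also have "\<dots> = (\<Sum>i<k. inverse \<beta> ^ j * t ^ i)"
    by (rule sum.cong) (simp_all add: t_def power_mult_distrib power_inverse flip: power_mult, simp add: mult.commute)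
  also have "\<dots> = inverse \<beta> ^ j * (\<Sum>i<k. t ^ i)" by (simp add: sum_distrib_left)
  finally have eq: "(\<Sum>w | w ^ k = l. inverse w ^ j) = inverse \<beta> ^ j * (\<Sum>i<k. t ^ i)" .
  show ?thesis
  proof (cases "j = 0")
    case True thus ?thesis using eq by (simp add: t_def)
  next
    case False
    have "root_theta k ^ j * \<beta> \<noteq> root_theta k ^ 0 * \<beta>"
      using bij_betw_imp_inj_on[OF bij] j k False unfolding inj_on_def by blast
    hence t1: "t \<noteq> 1" by (auto simp: t_def)
    have "t ^ k = inverse ((root_theta k ^ k) ^ j)" by (simp add: t_def power_inverse mult.commute flip: power_mult)
    hence "t ^ k = 1" by (simp add: root_theta_power_k[OF k])
    hence "(\<Sum>i<k. t ^ i) = 0" using geometric_sum[OF t1, of k] by simp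
    thus ?thesis using eq False by simp
  qed
qed

text \<open>\<open>G w\<close> is the projection of g to the solutions of y' = w y, a discrete
  Fourier transform over the k-th roots of l. By orthogonality of the roots these projections add up
  to g.\<close>

lemma linear_ode_exponential_sum:
  assumes g: "g holomorphic_on UNIV" and k: "0 < k" and l: "l \<noteq> 0"
    and ode: "\<And>z. (deriv ^^ k) g z = l * g z"
  shows "\<exists>C. \<forall>z. g z = (\<Sum>w | w ^ k = l. C w * exp (w * z))"
proof -
  let ?D = "\<lambda>n. (deriv ^^ n) g"
  define G where "G = (\<lambda>w z. (\<Sum>j<k. inverse w ^ j * ?D j z) / of_nat k)"
  have dD: "(?D n has_field_derivative ?D (Suc n) z) (at z)" for n z
    by (rule has_field_derivative_higher_deriv[OF g open_UNIV UNIV_I])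
  have G: "G w z = G w 0 * exp (w * z)" if w: "w ^ k = l" for w z
  proof (rule exp_solution)
    fix z
    have w0: "w \<noteq> 0" using w l k by auto
    have "(G w has_field_derivative (\<Sum>j<k. inverse w ^ j * ?D (Suc j) z) / of_nat k) (at z)"
      unfolding G_def by (intro DERIV_cdivide DERIV_sum DERIV_cmult dD)
    moreover have "(\<Sum>j<k. inverse w ^ j * ?D (Suc j) z) = w * (\<Sum>j<k. inverse w ^ j * ?D j z)"
    proof -
      have "(\<Sum>j<k. inverse w ^ j * ?D (Suc j) z) = w * (\<Sum>j<k. inverse w ^ Suc j * ?D (Suc j) z)"
        unfolding sum_distrib_left using w0 by (intro sum.cong) auto
      \<comment> \<open>The index shift leaves two boundary terms, which cancel because w^(-k) g^(k)
        = g.\<close>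
      also have "(\<Sum>j<k. inverse w ^ Suc j * ?D (Suc j) z) = (\<Sum>j<Suc k. inverse w ^ j * ?D j z) - ?D 0 z"
        by (subst sum.lessThan_Suc_shift) simp
      also have "\<dots> = (\<Sum>j<k. inverse w ^ j * ?D j z) + inverse w ^ k * ?D k z - ?D 0 z" by simp
      also have "inverse w ^ k * ?D k z = ?D 0 z" using w l by (simp add: ode power_inverse)
      finally show ?thesis by simp
    qed
    ultimately show "(G w has_field_derivative w * G w z) (at z)" by (simp add: G_def)
  qed
  have "g z = (\<Sum>w | w ^ k = l. G w 0 * exp (w * z))" for z
  proof -
    have "(\<Sum>w | w ^ k = l. G w 0 * exp (w * z)) = (\<Sum>w | w ^ k = l. G w z)"
      by (rule sum.cong[OF refl], rule G[symmetric]) simp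
    also have "\<dots> = (\<Sum>w | w ^ k = l. \<Sum>j<k. inverse w ^ j * (?D j z / of_nat k))"
      by (simp add: G_def sum_divide_distrib)
    also have "\<dots> = (\<Sum>j<k. \<Sum>w | w ^ k = l. inverse w ^ j * (?D j z / of_nat k))" by (rule sum.swap)
    also have "\<dots> = (\<Sum>j<k. (\<Sum>w | w ^ k = l. inverse w ^ j) * (?D j z / of_nat k))"
      by (simp only: sum_distrib_right)
    also have "\<dots> = (\<Sum>j<k. if j = 0 then g z else 0)"
      by (rule sum.cong) (use k in \<open>auto simp: sum_roots_inverse_power[OF k l]\<close>)
    also have "\<dots> = g z" using k by simp
    finally show ?thesis by simp
  qed
  thus ?thesis by (intro exI[of _ "\<lambda>w. G w 0"] allI)
qed

text \<open>The root \<beta> is free, and it is used to make the last coefficient non-zero: if exp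
  (w0 z) occurs in g, then \<beta> = w0 \<theta> gives \<theta>^(k-1) \<beta> = w0.\<close>

lemma linear_ode_is_L_theta:
  assumes g: "g holomorphic_on UNIV" and k: "0 < k" and l: "l \<noteq> 0"
    and ode: "\<And>z. (deriv ^^ k) g z = l * g z" and nz: "g z0 \<noteq> 0"
  obtains L \<beta> where "is_L_theta k L" "\<beta> ^ k = l" "\<And>z. g z = L (\<beta> * z)"
proof -
  obtain C where C: "\<And>z. g z = (\<Sum>w | w ^ k = l. C w * exp (w * z))"
    using linear_ode_exponential_sum[OF g k l ode] by blast
  obtain w0 where w0: "w0 ^ k = l" "C w0 \<noteq> 0"
  proof (rule ccontr)
    assume "\<not> thesis"
    hence "C w = 0" if "w ^ k = l" for w using that \<open>\<And>w0. w0 ^ k = l \<Longrightarrow> C w0 \<noteq> 0 \<Longrightarrow> thesis\<close> by blast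
    hence "g z0 = 0" unfolding C by (intro sum.neutral) auto
    thus False using nz by blast
  qed
  define \<beta> where "\<beta> = w0 * root_theta k"
  have \<beta>: "\<beta> ^ k = l" using w0(1) root_theta_power_k[OF k] by (simp add: \<beta>_def power_mult_distrib)
  define c where "c = (\<lambda>i. C (root_theta k ^ i * \<beta>))"
  define L where "L = (\<lambda>u. \<Sum>i<k. c i * exp (root_theta k ^ i * u))"
  have "root_theta k ^ (k - 1) * \<beta> = w0 * (root_theta k ^ (k - 1) * root_theta k)" by (simp add: \<beta>_def)
  also have "root_theta k ^ (k - 1) * root_theta k = 1"
    using root_theta_power_k[OF k] k by (simp flip: power_Suc2)
  finally have "c (k - 1) \<noteq> 0" using w0(2) by (simp add: c_def)
  hence "is_L_theta k L" unfolding is_L_theta_def L_def by blast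
  moreover have "g z = L (\<beta> * z)" for z
  proof -
    have "g z = (\<Sum>i<k. C (root_theta k ^ i * \<beta>) * exp ((root_theta k ^ i * \<beta>) * z))"
      unfolding C by (rule sum.reindex_bij_betw[OF bij_betw_roots_theta[OF k \<beta> l], symmetric])
    thus ?thesis by (simp add: L_def c_def mult.assoc)
  qed
  ultimately show thesis using that \<beta> by blast
qed

section \<open>Affine permutations of the three values\<close>

lemma cubic_identity_of_infinite:
  assumes inf: "infinite X" and eq: "\<And>x. x \<in> X \<Longrightarrow> cubic a b c (l * x + m) = A * cubic a b c x"
  shows "cubic a b c (l * x + m) = A * cubic a b c x"
proof -
  define P where "P = [:- a, 1:] * [:- b, 1:] * [:- c, 1:]"
  define \<phi> where "\<phi> = pcompose P [:m, l:] - smult A P"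
  have P: "poly P x = cubic a b c x" for x by (simp add: P_def cubic_def algebra_simps)
  have \<phi>: "poly \<phi> x = cubic a b c (l * x + m) - A * cubic a b c x" for x
    by (simp add: \<phi>_def poly_pcompose P algebra_simps)
  have "X \<subseteq> {x. poly \<phi> x = 0}" using eq by (auto simp: \<phi>)
  hence "\<phi> = 0" using inf poly_roots_finite finite_subset by blast
  thus ?thesis using \<phi>[of x] by simp
qed

text \<open>Two fixed points force the identity. A transposition is a point reflection, and the
  third value is the midpoint of the exchanged ones, so one of the three linear factors vanishes. A
  3-cycle is a rotation by a primitive cube root of unity, and the values form an equilateral
  triangle, which the quadratic form expresses.\<close>

lemma affine_permutation_cases:
  fixes a b c l m :: complex
  assumes dist: "a \<noteq> b" "b \<noteq> c" "a \<noteq> c" and l: "l \<noteq> 0"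
    and perm: "\<And>x. x \<in> {a, b, c} \<Longrightarrow> l * x + m \<in> {a, b, c}"
  shows "l = 1 \<and> m = 0
    \<or> l = - 1 \<and> m = 2 / 3 * (a + b + c) \<and> (2 * a - b - c) * (2 * b - c - a) * (2 * c - a - b) = 0
    \<or> l\<^sup>2 + l + 1 = 0 \<and> 3 * m = (1 - l) * (a + b + c) \<and> a\<^sup>2 + b\<^sup>2 + c\<^sup>2 - a * b - b * c - c * a = 0"
proof -
  have fix2: "l = 1 \<and> m = 0" if e: "l * x + m = x" "l * y + m = y" and "x \<noteq> y" for x y
  proof -
    have "(l - 1) * (x - y) = (l * x + m - x) - (l * y + m - y)" by (simp add: algebra_simps)
    hence "(l - 1) * (x - y) = 0" by (simp add: e)
    hence "l = 1" using \<open>x \<noteq> y\<close> by simp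
    thus ?thesis using e by simp
  qed
  have swap: "l = - 1 \<and> m = x + y \<and> 2 * t = x + y"
    if e: "l * x + m = y" "l * y + m = x" "l * t + m = t" and "x \<noteq> y" for x y t
  proof -
    have "(l + 1) * (x - y) = (l * x + m - y) - (l * y + m - x)" by (simp add: algebra_simps)
    hence "(l + 1) * (x - y) = 0" by (simp add: e)
    hence l: "l = - 1" using \<open>x \<noteq> y\<close> by (simp add: eq_neg_iff_add_eq_0)
    have "m = x + y" using e(1) by (simp add: l algebra_simps)
    moreover have "m = 2 * t" using e(3) by (simp add: l algebra_simps)
    ultimately show ?thesis using l by simp
  qed
  have cyc: "l\<^sup>2 + l + 1 = 0 \<and> 3 * m = (1 - l) * (x + y + t) \<and> x\<^sup>2 + y\<^sup>2 + t\<^sup>2 - x * y - y * t - t * x = 0"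
    if e: "l * x + m = y" "l * y + m = t" "l * t + m = x" and "x \<noteq> y" for x y t
  proof -
    have m: "m = y - l * x" using e(1) by (simp add: algebra_simps)
    have t: "t = l * y + y - l * x" using e(2) by (simp add: m algebra_simps)
    have "(l\<^sup>2 + l + 1) * (x - y) = x - (l * t + m)" unfolding m t by algebra
    hence "(l\<^sup>2 + l + 1) * (x - y) = 0" by (simp add: e(3))
    hence l: "l\<^sup>2 + l + 1 = 0" using \<open>x \<noteq> y\<close> by simp
    have "3 * m - (1 - l) * (x + y + t) = - (x - y) * (l\<^sup>2 + l + 1)" unfolding m t by algebra
    hence 1: "3 * m = (1 - l) * (x + y + t)" by (simp add: l)
    have "x\<^sup>2 + y\<^sup>2 + t\<^sup>2 - x * y - y * t - t * x = (x - y)\<^sup>2 * (l\<^sup>2 + l + 1)" unfolding t by algebra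
    thus ?thesis using l 1 by simp
  qed
  have inj: "x = y" if "l * x + m = l * y + m" for x y using that l by simp
  have two: "l = - 1 \<and> m = 2 / 3 * (a + b + c) \<and> (2 * a - b - c) * (2 * b - c - a) * (2 * c - a - b) = 0"
    if "l = - 1 \<and> m = x + y \<and> 2 * t = x + y" "x + y + t = a + b + c"
      "2 * t - x - y \<in> {2 * a - b - c, 2 * b - c - a, 2 * c - a - b}" for x y t
  proof -
    have "3 * m = 2 * (a + b + c)" using that(1,2) by algebra
    hence "m = 2 / 3 * (a + b + c)" by (simp add: field_simps)
    moreover have "2 * t - x - y = 0" using that(1) by simp
    ultimately show ?thesis using that(1,3) by auto
  qed
  consider "l * a + m = a" "l * b + m = b"
    | "l * a + m = b" "l * b + m = a" "l * c + m = c"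
    | "l * a + m = c" "l * c + m = a" "l * b + m = b"
    | "l * b + m = c" "l * c + m = b" "l * a + m = a"
    | "l * a + m = b" "l * b + m = c" "l * c + m = a"
    | "l * a + m = c" "l * c + m = b" "l * b + m = a"
    using perm[of a] perm[of b] perm[of c] inj[of a b] inj[of b c] inj[of a c] dist by auto
  thus ?thesis
  proof cases
    case 1 thus ?thesis using fix2[of a b] dist by blast
  next
    case 2 thus ?thesis using two[OF swap[of a b c]] dist by auto
  next
    case 3 thus ?thesis using two[OF swap[of a c b]] dist by (auto simp: algebra_simps)
  next
    case 4 thus ?thesis using two[OF swap[of b c a]] dist by (auto simp: algebra_simps)
  next
    case 5 thus ?thesis using cyc[of a b c] dist by simp
  next
    case 6 thus ?thesis using cyc[of a c b] dist by (simp add: algebra_simps)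
  qed
qed

lemma higher_deriv_diff_const:
  assumes "f holomorphic_on UNIV" "0 < k"
  shows "(deriv ^^ k) (\<lambda>z. f z - d) z = (deriv ^^ k) f z"
  using higher_deriv_diff[OF assms(1) holomorphic_on_const open_UNIV UNIV_I, of k d z] assms(2) by simp

lemma quadratic_cube_root_of_unity:
  assumes "l\<^sup>2 + l + 1 = (0::complex)"
  obtains s where "s \<in> {1, - 1}" "l = (- 1 + s * \<i> * of_real (sqrt 3)) / 2"
proof -
  define t where "t = 2 * l + 1"
  have "t\<^sup>2 = (\<i> * of_real (sqrt 3))\<^sup>2"
  proof -
    have "t\<^sup>2 = 4 * (l\<^sup>2 + l + 1) - 3" unfolding t_def by algebra
    also have "\<dots> = - 3" by (simp add: assms)
    also have "\<dots> = (\<i> * of_real (sqrt 3))\<^sup>2" by (simp add: power_mult_distrib flip: of_real_power)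
    finally show ?thesis .
  qed
  hence "t = \<i> * of_real (sqrt 3) \<or> t = - (\<i> * of_real (sqrt 3))" by (simp only: power2_eq_iff)
  moreover have "l = (- 1 + t) / 2" by (simp add: t_def)
  ultimately show thesis using that[of 1] that[of "- 1"] by (auto simp: mult.assoc)
qed

lemma sharing_implies_affine:
  fixes k :: nat and f :: "complex \<Rightarrow> complex" and a b c :: complex
  assumes k: "0 < k" and f: "f holomorphic_on UNIV" "\<not> f constant_on UNIV"
    and zeros: "\<And>z. f z = 0 \<Longrightarrow> int k \<le> zorder f z"
    and dist: "a \<noteq> b" "b \<noteq> c" "a \<noteq> c"
    and sh: "share_CM f ((deriv ^^ k) f) {a, b, c}"
  obtains l m where "\<And>z. (deriv ^^ k) f z = l * f z + m" "l \<noteq> 0"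
    "\<And>x. x \<in> {a, b, c} \<Longrightarrow> l * x + m \<in> {a, b, c}"
proof -
  define W where "W = (deriv ^^ k) f"
  have hW: "W holomorphic_on UNIV" unfolding W_def by (rule holomorphic_higher_deriv[OF f(1) open_UNIV])
  have shW: "share_CM f W {a, b, c}" using sh by (simp add: W_def)
  have ncW: "\<not> W constant_on UNIV" by (rule share_CM_constant[OF f shW _ _ dist(1)]) auto
  have "f z \<in> {a, b, c} \<longleftrightarrow> (deriv ^^ k) f z \<in> {a, b, c}" for z
    using share_CM_zorder[OF f shW, of z] share_CM_zorder[OF hW ncW share_CM_sym[OF shW], of z]
    unfolding W_def by blast
  then obtain C where C: "\<And>z. norm (deriv f z) \<le> C * (1 + (norm (f z))\<^sup>2)"
    using sharing_spherical_deriv_bounded[OF f(1) k zeros dist] by blast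
  obtain K0 where K0: "0 < K0" "\<And>z. norm (deriv f z) \<le> K0 * (1 + norm (f z))"
    using deriv_le_of_spherical_deriv_le[OF f C] by blast
  define K where "K = 2 * K0"
  have K: "0 < K" using K0 by (simp add: K_def)
  have gr: "1 + norm (f z) \<le> exp (K * dist w z + 1) * (1 + norm (f w))" for w z
    unfolding K_def by (rule growth_of_deriv_le[OF f(1) K0])
  obtain \<alpha> where \<alpha>: "\<alpha> holomorphic_on UNIV" "\<And>z. cubic a b c (W z) = exp (\<alpha> z) * cubic a b c (f z)"
    using share_CM_imp_exp_relation[OF f hW ncW dist shW] by blast
  define \<sigma> where "\<sigma> = (1 + norm a) * (1 + norm b) * (1 + norm c)"
  have \<sigma>: "0 < \<sigma>" by (auto simp: \<sigma>_def intro!: mult_pos_pos add_pos_nonneg)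
  define D where "D = fact k * exp (K + 1)"
  have D: "0 < D" by (simp add: D_def)
  have WD: "1 + norm (W z) \<le> (1 + D) * (1 + norm (f z))" for z
  proof -
    have "(1 + D) * (1 + norm (f z)) = 1 + norm (f z) + D * (1 + norm (f z))" by (simp add: algebra_simps)
    moreover have "norm (W z) \<le> D * (1 + norm (f z))"
      unfolding W_def D_def by (rule higher_deriv_le_of_growth[OF f(1) gr K])
    ultimately show ?thesis using norm_ge_zero[of "f z"] by linarith
  qed
  define F0 where "F0 = (1 + D) * (1 + norm (f 0))"
  have F0: "0 < F0" using D by (auto simp: F0_def intro!: mult_pos_pos add_pos_nonneg)
  define A' where "A' = 3 + ln (\<sigma> * F0 ^ 3)"
  \<comment> \<open>Growth from the origin contributes exp (K |z| + 1); its cube explains 3 K and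
    the summand 3 in \<open>A'\<close>. The hypothesis covers both y = f z and y = W z.\<close>
  have bound: "norm (cubic a b c y) \<le> exp (3 * K * norm z + A')" if y: "1 + norm y \<le> (1 + D) * (1 + norm (f z))" for y z
  proof -
    have "1 + norm (f z) \<le> exp (K * norm z + 1) * (1 + norm (f 0))" using gr[of z 0] by simp
    hence "(1 + D) * (1 + norm (f z)) \<le> (1 + D) * (exp (K * norm z + 1) * (1 + norm (f 0)))"
      using D by (intro mult_left_mono) auto
    hence y1: "1 + norm y \<le> exp (K * norm z + 1) * F0" using y by (simp add: F0_def mult_ac)
    have "norm (cubic a b c y) \<le> \<sigma> * (1 + norm y) ^ 3" unfolding \<sigma>_def by (rule cubic_upper)
    also have "\<dots> \<le> \<sigma> * (exp (K * norm z + 1) * F0) ^ 3" using y1 \<sigma> by (intro mult_left_mono power_mono) auto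
    also have "\<dots> = exp (K * norm z + 1) ^ 3 * (\<sigma> * F0 ^ 3)" by (simp add: power_mult_distrib)
    also have "exp (K * norm z + 1) ^ 3 = exp (3 * (K * norm z + 1))" by (simp flip: exp_of_nat_mult)
    also have "\<sigma> * F0 ^ 3 = exp (ln (\<sigma> * F0 ^ 3))" using \<sigma> F0 by simp
    also have "exp (3 * (K * norm z + 1)) * exp (ln (\<sigma> * F0 ^ 3)) = exp (3 * K * norm z + A')"
      by (simp add: A'_def algebra_simps flip: exp_add)
    finally show ?thesis .
  qed
  have cf: "(\<lambda>z. cubic a b c (f z)) holomorphic_on UNIV" unfolding cubic_def by (intro holomorphic_intros f)
  obtain w where w: "cubic a b c (f w) \<noteq> 0"
    using entire_nonconstant_avoids_finite[OF f, of "{a, b, c}"] by (auto simp: cubic_eq_0_iff)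
  have "\<exists>\<gamma> d. \<forall>z. \<alpha> z = \<gamma> * z + d"
  proof (rule exp_quotient_linear[OF cf \<alpha>(1) w, of "3 * K" A'])
    show "norm (cubic a b c (f z)) \<le> exp (3 * K * norm z + A')" for z
    proof (rule bound)
      show "1 + norm (f z) \<le> (1 + D) * (1 + norm (f z))"
        using D mult_right_mono[of 1 "1 + D" "1 + norm (f z)"] by simp
    qed
    show "norm (exp (\<alpha> z) * cubic a b c (f z)) \<le> exp (3 * K * norm z + A')" for z
      unfolding \<alpha>(2)[symmetric] by (rule bound[OF WD])
  qed (use K in simp)
  then obtain \<gamma> d where lin: "\<And>z. \<alpha> z = \<gamma> * z + d" by blast
  have rel: "cubic a b c ((deriv ^^ k) f z) = exp (\<gamma> * z + d) * cubic a b c (f z)" for z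
    using \<alpha>(2)[of z] by (simp add: W_def lin)
  have "\<gamma> = 0"
    using exp_relation_nonconstant_imp_deriv_constant[OF f(1) k K gr _ rel] ncW unfolding W_def by blast
  hence rel0: "cubic a b c ((deriv ^^ k) f z) = exp d * cubic a b c (f z)" for z using rel[of z] by simp
  obtain l m where lm: "\<And>z. (deriv ^^ k) f z = l * f z + m"
    using cubic_relation_affine[OF f k K gr ncW[unfolded W_def] exp_not_eq_zero rel0] by blast
  have l: "l \<noteq> 0"
  proof
    assume "l = 0"
    hence "W z = m" for z using lm[of z] by (simp add: W_def)
    thus False using ncW unfolding constant_on_def by blast
  qed
  have inf: "infinite (range f)"
  proof
    assume "finite (range f)"
    from entire_nonconstant_avoids_finite[OF f this] show False by blast
  qed
  \<comment> \<open>Since f takes infinitely many values, the relation becomes a polynomial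
    identity, so x -> l x + m carries roots of P to roots of P.\<close>
  have "cubic a b c (l * x + m) = exp d * cubic a b c x" for x
  proof (rule cubic_identity_of_infinite[OF inf])
    fix y assume "y \<in> range f"
    then obtain z where "y = f z" by blast
    thus "cubic a b c (l * y + m) = exp d * cubic a b c y" using rel0[of z] lm[of z] by simp
  qed
  hence "l * x + m \<in> {a, b, c}" if "x \<in> {a, b, c}" for x
    using that cubic_eq_0_iff[of a b c] by (metis mult_zero_right)
  thus thesis using that[OF lm l] by blast
qed

theorem theorem1p1:
  fixes k :: nat and f :: "complex \<Rightarrow> complex" and a b c :: complex
  assumes "0 < k"
    and "f holomorphic_on UNIV"
    and "\<not> f constant_on UNIV"
    and "\<forall>z. f z = 0 \<longrightarrow> int k \<le> zorder f z"
    and "a \<noteq> b" and "b \<noteq> c" and "a \<noteq> c"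
    and "share_CM f ((deriv ^^ k) f) {a, b, c}"
  shows "(\<exists>L \<beta>. is_L_theta k L \<and> \<beta> ^ k - 1 = 0 \<and> (\<forall>z. f z = L (\<beta> * z)))
    \<or> ((\<exists>L \<eta>. is_L_theta k L \<and> \<eta> ^ k + 1 = 0 \<and>
           (\<forall>z. f z = L (\<eta> * z) + 2 / 3 * (a + b + c))) \<and>
        (2 * a - b - c) * (2 * b - c - a) * (2 * c - a - b) = 0)
    \<or> ((\<exists>L \<zeta>. \<exists>s \<in> {1, -1}. is_L_theta k L \<and> \<zeta> \<noteq> 1 \<and> \<zeta> ^ (3 * k) - 1 = 0 \<and>
           (\<forall>z. f z = L (\<zeta> * z) + (3 + s * \<i> * of_real (sqrt 3)) / 6 * (a + b + c))) \<and>
        a\<^sup>2 + b\<^sup>2 + c\<^sup>2 - a * b - b * c - c * a = 0)"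
proof -
  obtain l m where lm: "\<And>z. (deriv ^^ k) f z = l * f z + m" "l \<noteq> 0"
    "\<And>x. x \<in> {a, b, c} \<Longrightarrow> l * x + m \<in> {a, b, c}"
    by (rule sharing_implies_affine[OF assms(1-3) _ assms(5-8)]) (use assms(4) in blast)+
  \<comment> \<open>Subtracting the zero d of x -> l x + m makes the equation homogeneous: y = f - d
    satisfies y^(k) = l y.\<close>
  have form: "\<exists>L \<beta>. is_L_theta k L \<and> \<beta> ^ k = l \<and> (\<forall>z. f z = L (\<beta> * z) + d)" if d: "l * d + m = 0" for d
  proof -
    have h: "(\<lambda>z. f z - d) holomorphic_on UNIV" by (intro holomorphic_intros assms)
    have ode: "(deriv ^^ k) (\<lambda>z. f z - d) z = l * (f z - d)" for z
    proof -
      have "l * (f z - d) = l * f z + m - (l * d + m)" by (simp add: algebra_simps)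
      thus ?thesis using higher_deriv_diff_const[OF assms(2,1), of d z] by (simp add: lm(1) d)
    qed
    obtain z0 where z0: "f z0 \<noteq> d" using assms(3) unfolding constant_on_def by blast
    hence z0: "f z0 - d \<noteq> 0" by simp
    obtain L \<beta> where L: "is_L_theta k L" "\<beta> ^ k = l" "\<And>z. f z - d = L (\<beta> * z)"
      by (rule linear_ode_is_L_theta[OF h assms(1) lm(2) ode z0]) blast
    have "f z = L (\<beta> * z) + d" for z using L(3)[of z] by (simp add: diff_eq_eq)
    thus ?thesis using L(1,2) by blast
  qed
  from affine_permutation_cases[OF assms(5-7) lm(2,3)]
  consider "l = 1" "m = 0"
    | "l = - 1" "m = 2 / 3 * (a + b + c)" "(2 * a - b - c) * (2 * b - c - a) * (2 * c - a - b) = 0"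
    | "l\<^sup>2 + l + 1 = 0" "3 * m = (1 - l) * (a + b + c)" "a\<^sup>2 + b\<^sup>2 + c\<^sup>2 - a * b - b * c - c * a = 0"
    by blast
  thus ?thesis
  proof cases
    case 1
    thus ?thesis using form[of 0] by auto
  next
    case 2
    have "\<exists>L \<eta>. is_L_theta k L \<and> \<eta> ^ k = l \<and> (\<forall>z. f z = L (\<eta> * z) + 2 / 3 * (a + b + c))"
      by (rule form) (simp only: 2(1,2) mult_minus_left mult_1_left left_minus)
    then obtain L \<eta> where L: "is_L_theta k L" "\<eta> ^ k = l" "\<forall>z. f z = L (\<eta> * z) + 2 / 3 * (a + b + c)" by blast
    have "\<eta> ^ k + 1 = 0" by (simp add: L(2) 2(1))
    thus ?thesis using L(1,3) 2(3) by blast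
  next
    case 3
    obtain s where s: "s \<in> {1, - 1}" "l = (- 1 + s * \<i> * of_real (sqrt 3)) / 2"
      by (rule quadratic_cube_root_of_unity[OF 3(1)])
    \<comment> \<open>The zero - m / l of the affine map: with 3 m = (1 - l) (a + b + c) it is (1 -
      1 / l) / 3 times the sum, and 1 / l = l^2 = - 1 - l.\<close>
    define d where "d = (2 + l) / 3 * (a + b + c)"
    have "3 * (l * d + m) = (l\<^sup>2 + l + 1) * (a + b + c)"
      unfolding distrib_left 3(2) d_def by (simp add: field_simps power2_eq_square)
    hence "3 * (l * d + m) = 0" by (simp only: 3(1) mult_zero_left)
    hence "l * d + m = 0" by (metis mult_eq_0_iff zero_neq_numeral)
    from form[OF this] obtain L \<zeta> where L: "is_L_theta k L" "\<zeta> ^ k = l" "\<forall>z. f z = L (\<zeta> * z) + d" by blast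
    have "(2 + l) / 3 = (3 + s * \<i> * of_real (sqrt 3)) / 6" unfolding s(2) by (simp add: field_simps)
    hence d: "d = (3 + s * \<i> * of_real (sqrt 3)) / 6 * (a + b + c)" by (simp only: d_def)
    have "l ^ 3 - 1 = (l - 1) * (l\<^sup>2 + l + 1)" by algebra
    hence "l ^ 3 = 1" by (simp add: 3(1))
    hence "\<zeta> ^ (3 * k) - 1 = 0" using L(2) by (simp add: mult.commute[of 3] power_mult)
    moreover have "\<zeta> \<noteq> 1"
    proof
      assume "\<zeta> = 1"
      hence "l = 1" using L(2) by simp
      thus False using 3(1) by simp
    qed
    ultimately show ?thesis using L(1,3) s(1) 3(3) unfolding d by blast
  qed
qed

end
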